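(* Let $c\in\mathbb{F}$. The algebra isomorphism $\mathbb{F}[x]\to A(V_{\mathcal{V}ir}(c,0))$, $f(x)\mapsto f([\omega])$, reduces to an algebra isomorphism from $\mathbb{F}[x]/(x^p-x)\mathbb{F}[x]$ onto the Zhu algebra $A(V^0_{\mathcal{V}ir}(c,0))$. That is, the map sending $f(x)+(x^p-x)\mathbb{F}[x]$ to $f([\omega+I_0])\in A(V^0_{\mathcal{V}ir}(c,0))$ is a well-defined algebra isomorphism.
   Context: $\mathbb{F}$ is an algebraically closed field of prime characteristic $p\ge 3$; all vector spaces are over $\mathbb{F}$. $\mathbb{N}$ denotes the nonnegative integers. For $m\in\mathbb{Z}$, $n\in\mathbb{N}$, $\binom{m}{n}=m(m-1)\cdots(m+1-n)/n!\in\mathbb{Z}$, regarded as an element of $\mathbb{F}$. Vertex algebras: a vertex algebra is a vector space $V$ with a linear map $Y(\cdot,x):V\to(\mathrm{End}\,V)[[x,x^{-1}]]$, $v\mapsto Y(v,x)=\sum_{n\in\mathbb{Z}}v_nx^{-n-1}$, and a vector $\mathbf 1\in V$ such that $Y(u,x)v\in V((x))$; $Y(\mathbf 1,x)=\mathrm{id}$; $Y(v,x)\mathbf 1\in V[[x]]$ with constant term $v$; and for $u,v,w\in V$ the Jacobi identity $x_0^{-1}\delta\left(\frac{x_1-x_2}{x_0}\right)Y(u,x_1)Y(v,x_2)w-x_0^{-1}\delta\left(\frac{x_2-x_1}{-x_0}\right)Y(v,x_2)Y(u,x_1)w=x_2^{-1}\delta\left(\frac{x_1-x_0}{x_2}\right)Y(Y(u,x_0)v,x_2)w$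 holds, where $\delta(x)=\sum_{n\in\mathbb{Z}}x^n$ and $(x_1\pm x_2)^n$ is expanded in nonnegative powers of the second variable. An ideal is a subspace $I$ with $v_nw,\,w_nv\in I$ for all $v\in V$, $w\in I$, $n\in\mathbb{Z}$. A $\mathbb{Z}$-graded vertex algebra is a vertex algebra with a grading $V=\bigoplus_{n\in\mathbb{Z}}V_{(n)}$ such that $\mathbf 1\in V_{(0)}$ and $u_kV_{(n)}\subset V_{(m+n-k-1)}$ for $u\in V_{(m)}$; write $\deg u=m$ for $u\in V_{(m)}$. Zhu algebra: for a $\mathbb{Z}$-graded vertex algebra $V$ and $a,b\in V$ with $a$ homogeneous put $a*b=\mathrm{Res}_z\frac{(1+z)^{\deg a}}{z}Y(a,z)b=\sum_{i\ge0}\binom{\deg a}{i}a_{i-1}b$ and, for $n\in\mathbb{N}$, $a\circ_nb=\mathrm{Res}_z\frac{(1+z)^{\deg a}}{z^{n+2}}Y(a,z)b=\sum_{i\ge0}\binom{\deg a}{i}a_{i-n-2}b$, extended linearly in $a$. Let $O(V)$ be the span of all $a\circ_nb$. Then $A(V)=V/O(V)$ is a unital associative algebra under $*$ with identity $\mathbf 1+O(V)$; write $[u]=u+O(V)$. Virasoro: $\mathcal{V}ir$ is the Lie algebra with basis $\{L_n\mid n\in\mathbb{Z}\}\cup\{\mathbf c\}$, $\mathbf c$ central, $[L_m,L_n]=(m-n)L_{m+n}+\frac12\binom{m+1}{3}\delta_{m+n,0}\mathbf c$. $V_{\mathcal{V}ir}(c,0)$ is the $\mathcal{V}ir$-module induced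 from the one-dimensional module $\mathbb{F}$ of the subalgebra spanned by $\mathbf c$ and $L_n$ ($n\ge-1$), where $\mathbf c$ acts as $c$ and each $L_n$ ($n\ge -1$) acts as $0$; $\mathbf 1=1\otimes1$. It has a unique vertex algebra structure with vacuum $\mathbf 1$ and $Y(\omega,x)=\sum_{n\in\mathbb{Z}}L_nx^{-n-2}$, where $\omega=L_{-2}\mathbf 1$; it is $\mathbb{Z}$-graded by $\deg\mathbf 1=0$, $\deg L_n=-n$. It is known that $f(x)\mapsto f([\omega])$ is an algebra isomorphism from $\mathbb{F}[x]$ onto $A(V_{\mathcal{V}ir}(c,0))$. Let $\delta_{p\mid n}=1$ if $p\mid n$ and $0$ otherwise. $I_0$ is the $\mathcal{V}ir$-submodule of $V_{\mathcal{V}ir}(c,0)$ generated by $(L_{-n}^p-\delta_{p\mid n}L_{-np})\mathbf 1$ for $n\ge2$; it is a graded ideal of the vertex algebra, and $V^0_{\mathcal{V}ir}(c,0)=V_{\mathcal{V}ir}(c,0)/I_0$. *)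

theory Defs
  imports
    "HOL-Algebra.Module"
    "HOL-Algebra.QuotRing"
    "HOL-Algebra.Algebraic_Closure_Type"
    "HOL-Computational_Algebra.Computational_Algebra"
begin

section \<open>Vector spaces, algebras and quotients\<close>

text \<open>
  Vector spaces and associative algebras over the field \<open>'k\<close> are \<open>module\<close> records. For a record
  that is only used as a vector space, the fields \<open>mult\<close> and \<open>one\<close> carry no meaning.
\<close>

abbreviation scalars :: "'k::field ring"
  where "scalars \<equiv> ring_of_type_algebra"

abbreviation is_subspace :: "('k::field, 'v, 'z) module_scheme \<Rightarrow> 'v set \<Rightarrow> bool"
  where "is_subspace V N \<equiv> submodule N scalars V"

definition lin_span :: "('k::field, 'v, 'z) module_scheme \<Rightarrow> 'v set \<Rightarrow> 'v set"
  where "lin_span V S = is_subspace V hull S"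

text \<open>A sum over an arbitrary index set, all but finitely many of whose terms vanish.\<close>

definition fsum :: "('v, 'z) ring_scheme \<Rightarrow> ('i \<Rightarrow> 'v) \<Rightarrow> 'v"
  where "fsum V f = (\<Oplus>\<^bsub>V\<^esub>i\<in>{i. f i \<noteq> \<zero>\<^bsub>V\<^esub>}. f i)"

text \<open>
  The library's \<open>Quot\<close>, with the induced scalar multiplication. If \<open>N\<close> is merely a subspace, this
  is the quotient vector space, and its \<open>mult\<close> field is meaningless.
\<close>

definition quot_algebra :: "('k, 'v, 'z) module_scheme \<Rightarrow> 'v set \<Rightarrow> ('k, 'v set) module"
  where "quot_algebra A N =
    ring.extend (A Quot N) (module.fields (\<lambda>a C. \<Union>x\<in>C. N +>\<^bsub>A\<^esub> (a \<odot>\<^bsub>A\<^esub> x)))"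

definition algebra_iso ::
    "('k, 'v, 'y) module_scheme \<Rightarrow> ('k, 'w, 'z) module_scheme \<Rightarrow> ('v \<Rightarrow> 'w) set"
  where "algebra_iso A B =
    {h \<in> ring_iso A B. \<forall>a. \<forall>x\<in>carrier A. h (a \<odot>\<^bsub>A\<^esub> x) = a \<odot>\<^bsub>B\<^esub> h x}"

definition poly_algebra :: "('k::field, 'k poly) module"
  where "poly_algebra = ring.extend ring_of_type_algebra (module.fields Polynomial.smult)"

text \<open>\<open>f(a)\<close> for a polynomial \<open>f\<close> and an element \<open>a\<close> of the algebra \<open>A\<close>.\<close>

definition alg_eval :: "('k::field, 'v, 'z) module_scheme \<Rightarrow> 'k poly \<Rightarrow> 'v \<Rightarrow> 'v"
  where "alg_eval A f a =
    (\<Oplus>\<^bsub>A\<^esub>i\<in>{..Polynomial.degree f}. Polynomial.coeff f i \<odot>\<^bsub>A\<^esub> (a [^]\<^bsub>A\<^esub> i))"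


section \<open>Vertex algebras\<close>

text \<open>
  \<open>nprod V u n v\<close> is \<open>u\<^sub>n v\<close>, and \<open>grading V n\<close> is the homogeneous subspace of degree \<open>n\<close>.
\<close>

record ('k, 'v) vertex_alg = "('k, 'v) module" +
  vac :: 'v
  nprod :: "'v \<Rightarrow> int \<Rightarrow> 'v \<Rightarrow> 'v"
  grading :: "int \<Rightarrow> 'v set"

text \<open>
  The binomial coefficient of an integer \<open>m\<close>, mapped to \<open>'k\<close>. It agrees with \<open>m gchoose n\<close>, whose
  type constraint in the library rules out integer arguments.
\<close>

definition ibinom :: "int \<Rightarrow> nat \<Rightarrow> 'k::field"
  where "ibinom m n = of_int ((\<Prod>i<n. m - int i) div fact n)"

text \<open>
  The axiom \<open>jacobi\<close> is the Jacobi identity, read off as the coefficient of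
  \<open>x\<^sub>0\<close> to the \<open>-l-1\<close>, \<open>x\<^sub>1\<close> to the \<open>-m-1\<close>, \<open>x\<^sub>2\<close> to the \<open>-n-1\<close>. The right-hand side contributes
  \<open>(-1)^i * ibinom (i - m - 1) i = ibinom m i\<close>.
\<close>

locale vertex_algebra =
  fixes V :: "('k::field, 'v, 'z) vertex_alg_scheme" (structure)
  assumes vector_space: "module scalars V"
    and vac_closed: "vac V \<in> carrier V"
    and nprod_closed: "\<lbrakk>u \<in> carrier V; v \<in> carrier V\<rbrakk> \<Longrightarrow> nprod V u n v \<in> carrier V"
    and nprod_add_left: "\<lbrakk>u \<in> carrier V; u' \<in> carrier V; v \<in> carrier V\<rbrakk> \<Longrightarrow>
      nprod V (u \<oplus> u') n v = nprod V u n v \<oplus> nprod V u' n v"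
    and nprod_smult_left: "\<lbrakk>u \<in> carrier V; v \<in> carrier V\<rbrakk> \<Longrightarrow>
      nprod V (a \<odot> u) n v = a \<odot> nprod V u n v"
    and nprod_add_right: "\<lbrakk>u \<in> carrier V; v \<in> carrier V; v' \<in> carrier V\<rbrakk> \<Longrightarrow>
      nprod V u n (v \<oplus> v') = nprod V u n v \<oplus> nprod V u n v'"
    and nprod_smult_right: "\<lbrakk>u \<in> carrier V; v \<in> carrier V\<rbrakk> \<Longrightarrow>
      nprod V u n (a \<odot> v) = a \<odot> nprod V u n v"
    and truncation: "\<lbrakk>u \<in> carrier V; v \<in> carrier V\<rbrakk> \<Longrightarrow> \<exists>N. \<forall>n\<ge>N. nprod V u n v = \<zero>"
    and vacuum: "v \<in> carrier V \<Longrightarrow> nprod V (vac V) n v = (if n = -1 then v else \<zero>)"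
    and creation: "\<lbrakk>v \<in> carrier V; n \<ge> 0\<rbrakk> \<Longrightarrow> nprod V v n (vac V) = \<zero>"
      "v \<in> carrier V \<Longrightarrow> nprod V v (-1) (vac V) = v"
    and jacobi: "\<lbrakk>u \<in> carrier V; v \<in> carrier V; w \<in> carrier V\<rbrakk> \<Longrightarrow>
      fsum V (\<lambda>i. ((-1) ^ i * ibinom l i) \<odot> nprod V u (m + l - int i) (nprod V v (n + int i) w))
      \<ominus> fsum V (\<lambda>i. ((-1) powi l * (-1) ^ i * ibinom l i) \<odot>
            nprod V v (n + l - int i) (nprod V u (m + int i) w))
      = fsum V (\<lambda>i. ibinom m i \<odot> nprod V (nprod V u (l + int i) v) (m + n - int i) w)"

definition hom_decomp :: "('k::field, 'v, 'z) vertex_alg_scheme \<Rightarrow> 'v \<Rightarrow> (int \<Rightarrow> 'v) \<Rightarrow> bool"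
  where "hom_decomp V v d \<longleftrightarrow>
    finite {n. d n \<noteq> \<zero>\<^bsub>V\<^esub>} \<and> (\<forall>n. d n \<in> grading V n) \<and> v = fsum V d"

locale graded_vertex_algebra = vertex_algebra +
  assumes grading_subspace: "is_subspace V (grading V n)"
    and grading_direct: "v \<in> carrier V \<Longrightarrow> \<exists>!d. hom_decomp V v d"
    and vac_degree: "vac V \<in> grading V 0"
    and nprod_degree: "\<lbrakk>u \<in> grading V m; v \<in> grading V n\<rbrakk> \<Longrightarrow>
      nprod V u k v \<in> grading V (m + n - k - 1)"

definition hom_comp :: "('k::field, 'v, 'z) vertex_alg_scheme \<Rightarrow> 'v \<Rightarrow> int \<Rightarrow> 'v"
  where "hom_comp V v = (THE d. hom_decomp V v d)"

text \<open>The quotient by a graded ideal \<open>I\<close>; the operations on cosets follow the library's \<open>Quot\<close>.\<close>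

definition quot_vertex_alg ::
    "('k, 'v, 'z) vertex_alg_scheme \<Rightarrow> 'v set \<Rightarrow> ('k, 'v set) vertex_alg"
  where "quot_vertex_alg V I = module.extend (quot_algebra V I) (vertex_alg.fields
    (I +>\<^bsub>V\<^esub> vac V)
    (\<lambda>C n D. \<Union>x\<in>C. \<Union>z\<in>D. I +>\<^bsub>V\<^esub> nprod V x n z)
    (\<lambda>n. (\<lambda>v. I +>\<^bsub>V\<^esub> v) ` grading V n))"


section \<open>The Zhu algebra\<close>

text \<open>
  For \<open>a\<close> of degree \<open>d\<close>, the residue of \<open>(1 + z)^d * z^(-k) * Y(a,z) b\<close> is
  \<open>zhu_res_hom V d k a b\<close>; \<open>zhu_res\<close> extends it linearly in \<open>a\<close>.
\<close>

definition zhu_res_hom ::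
    "('k::field, 'v, 'z) vertex_alg_scheme \<Rightarrow> int \<Rightarrow> int \<Rightarrow> 'v \<Rightarrow> 'v \<Rightarrow> 'v"
  where "zhu_res_hom V d k a b =
    fsum V (\<lambda>i. ibinom d i \<odot>\<^bsub>V\<^esub> nprod V a (int i - k) b)"

definition zhu_res :: "('k::field, 'v, 'z) vertex_alg_scheme \<Rightarrow> int \<Rightarrow> 'v \<Rightarrow> 'v \<Rightarrow> 'v"
  where "zhu_res V k a b = fsum V (\<lambda>d. zhu_res_hom V d k (hom_comp V a d) b)"

definition zhu_star :: "('k::field, 'v, 'z) vertex_alg_scheme \<Rightarrow> 'v \<Rightarrow> 'v \<Rightarrow> 'v"
  where "zhu_star V a b = zhu_res V 1 a b"

definition zhu_circ :: "('k::field, 'v, 'z) vertex_alg_scheme \<Rightarrow> nat \<Rightarrow> 'v \<Rightarrow> 'v \<Rightarrow> 'v"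
  where "zhu_circ V n a b = zhu_res V (int n + 2) a b"

definition zhu_O :: "('k::field, 'v, 'z) vertex_alg_scheme \<Rightarrow> 'v set"
  where "zhu_O V = lin_span V {zhu_circ V n a b | n a b. a \<in> carrier V \<and> b \<in> carrier V}"

definition zhu_algebra :: "('k::field, 'v, 'z) vertex_alg_scheme \<Rightarrow> ('k, 'v set) module"
  where "zhu_algebra V = quot_algebra (V\<lparr>mult := zhu_star V, one := vac V\<rparr>) (zhu_O V)"

definition zhu_class :: "('k::field, 'v, 'z) vertex_alg_scheme \<Rightarrow> 'v \<Rightarrow> 'v set"
  where "zhu_class V u = zhu_O V +>\<^bsub>V\<^esub> u"


section \<open>Enveloping algebras and induced modules\<close>

text \<open>
  A Lie algebra with basis indexed by \<open>'b\<close> is given by the brackets \<open>br x y\<close> of basis elements, as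
  finitely supported coefficient functions. Its tensor algebra is the free algebra on \<open>'b\<close>, that
  is, the space of finitely supported functions on words with the concatenation product.
\<close>

type_synonym ('b, 'k) tensor = "'b list \<Rightarrow> 'k"

definition tensor_algebra :: "('k::field, ('b, 'k) tensor) module"
  where "tensor_algebra =
    \<lparr>carrier = {f. finite {w. f w \<noteq> 0}},
     monoid.mult = (\<lambda>f g w. \<Sum>i\<le>length w. f (take i w) * g (drop i w)),
     one = (\<lambda>w. if w = [] then 1 else 0),
     ring.zero = (\<lambda>w. 0),
     add = (\<lambda>f g w. f w + g w),
     module.smult = (\<lambda>a f w. a * f w)\<rparr>"

definition lin_tensor :: "('b \<Rightarrow> 'k::field) \<Rightarrow> ('b, 'k) tensor"
  where "lin_tensor x = (\<lambda>w. case w of [b] \<Rightarrow> x b | _ \<Rightarrow> 0)"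

definition gen_tensor :: "'b \<Rightarrow> ('b, 'k::field) tensor"
  where "gen_tensor b = lin_tensor (\<lambda>b'. if b' = b then 1 else 0)"

definition env_ideal :: "('b \<Rightarrow> 'b \<Rightarrow> 'b \<Rightarrow> 'k::field) \<Rightarrow> ('b, 'k) tensor set"
  where "env_ideal br = (let T = tensor_algebra in
    Idl\<^bsub>T\<^esub> {gen_tensor x \<otimes>\<^bsub>T\<^esub> gen_tensor y \<ominus>\<^bsub>T\<^esub> gen_tensor y \<otimes>\<^bsub>T\<^esub> gen_tensor x
            \<ominus>\<^bsub>T\<^esub> lin_tensor (br x y) | x y. True})"

definition env_algebra :: "('b \<Rightarrow> 'b \<Rightarrow> 'b \<Rightarrow> 'k::field) \<Rightarrow> ('k, ('b, 'k) tensor set) module"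
  where "env_algebra br = quot_algebra tensor_algebra (env_ideal br)"

definition env_gen :: "('b \<Rightarrow> 'b \<Rightarrow> 'b \<Rightarrow> 'k::field) \<Rightarrow> 'b \<Rightarrow> ('b, 'k) tensor set"
  where "env_gen br x = env_ideal br +>\<^bsub>tensor_algebra\<^esub> gen_tensor x"

text \<open>
  Let \<open>S\<close> be a set of basis elements spanning a subalgebra \<open>B\<close>, acting on a one-dimensional
  module \<open>k\<close> through the character \<open>\<chi>\<close>. As a vector space, the tensor product over \<open>k\<close> of the
  enveloping algebra \<open>U\<close> with \<open>k\<close> is \<open>U\<close>; passing to the tensor product over the enveloping algebra
  of \<open>B\<close> means dividing by the span of all \<open>u x - \<chi>(x) u\<close> with \<open>u \<in> U\<close>, \<open>x \<in> S\<close>. The field \<open>one\<close>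
  of the resulting record is \<open>1 \<otimes> 1\<close>.
\<close>

definition induced_relations ::
    "('b \<Rightarrow> 'b \<Rightarrow> 'b \<Rightarrow> 'k::field) \<Rightarrow> 'b set \<Rightarrow> ('b \<Rightarrow> 'k) \<Rightarrow> ('b, 'k) tensor set set"
  where "induced_relations br S \<chi> = (let U = env_algebra br in
    lin_span U {u \<otimes>\<^bsub>U\<^esub> env_gen br x \<ominus>\<^bsub>U\<^esub> \<chi> x \<odot>\<^bsub>U\<^esub> u | u x. u \<in> carrier U \<and> x \<in> S})"

definition induced_module ::
    "('b \<Rightarrow> 'b \<Rightarrow> 'b \<Rightarrow> 'k::field) \<Rightarrow> 'b set \<Rightarrow> ('b \<Rightarrow> 'k) \<Rightarrow> ('k, ('b, 'k) tensor set set) module"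
  where "induced_module br S \<chi> = quot_algebra (env_algebra br) (induced_relations br S \<chi>)"

definition induced_action ::
    "('b \<Rightarrow> 'b \<Rightarrow> 'b \<Rightarrow> 'k::field) \<Rightarrow> 'b set \<Rightarrow> ('b \<Rightarrow> 'k) \<Rightarrow> 'b
      \<Rightarrow> ('b, 'k) tensor set set \<Rightarrow> ('b, 'k) tensor set set"
  where "induced_action br S \<chi> x C = (let U = env_algebra br in
    \<Union>u\<in>C. induced_relations br S \<chi> +>\<^bsub>U\<^esub> (env_gen br x \<otimes>\<^bsub>U\<^esub> u))"


section \<open>The Virasoro vertex algebra\<close>

datatype vir_basis = Vir_L int | Vir_c

fun vir_bracket :: "vir_basis \<Rightarrow> vir_basis \<Rightarrow> vir_basis \<Rightarrow> 'k::field"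
  where
    "vir_bracket (Vir_L m) (Vir_L n) (Vir_L k) = (if k = m + n then of_int (m - n) else 0)"
  | "vir_bracket (Vir_L m) (Vir_L n) Vir_c = (if m + n = 0 then 1 / 2 * ibinom (m + 1) 3 else 0)"
  | "vir_bracket Vir_c _ _ = 0"
  | "vir_bracket _ Vir_c _ = 0"

definition vir_sub :: "vir_basis set"
  where "vir_sub = insert Vir_c {Vir_L n | n. n \<ge> -1}"

definition vir_char :: "'k::field \<Rightarrow> vir_basis \<Rightarrow> 'k"
  where "vir_char c x = (case x of Vir_c \<Rightarrow> c | Vir_L n \<Rightarrow> 0)"

type_synonym 'k vir_vec = "(vir_basis, 'k) tensor set set"

text \<open>The induced module underlying the vertex algebra, its vacuum \<open>1 \<otimes> 1\<close>, and the action of \<open>L\<^sub>n\<close>.\<close>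

definition vir_module :: "'k::field \<Rightarrow> ('k, 'k vir_vec) module"
  where "vir_module c = induced_module vir_bracket vir_sub (vir_char c)"

definition vir_vac :: "'k::field \<Rightarrow> 'k vir_vec"
  where "vir_vac c = \<one>\<^bsub>vir_module c\<^esub>"

definition vir_L :: "'k::field \<Rightarrow> int \<Rightarrow> 'k vir_vec \<Rightarrow> 'k vir_vec"
  where "vir_L c n = induced_action vir_bracket vir_sub (vir_char c) (Vir_L n)"

definition vir_omega :: "'k::field \<Rightarrow> 'k vir_vec"
  where "vir_omega c = vir_L c (-2) (vir_vac c)"

text \<open>Degrees: \<open>deg 1 = 0\<close> and \<open>deg L\<^sub>n = -n\<close>.\<close>

definition vir_grading :: "'k::field \<Rightarrow> int \<Rightarrow> 'k vir_vec set"
  where "vir_grading c n =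
    lin_span (vir_module c) {foldr (vir_L c) ks (vir_vac c) | ks. - sum_list ks = n}"

text \<open>The space \<open>vir_module c\<close> with vertex operators \<open>Y\<close>; \<open>Y u n v\<close> stands for \<open>u\<^sub>n v\<close>.\<close>

definition vir_vertex_alg ::
    "'k::field \<Rightarrow> ('k vir_vec \<Rightarrow> int \<Rightarrow> 'k vir_vec \<Rightarrow> 'k vir_vec) \<Rightarrow> ('k, 'k vir_vec) vertex_alg"
  where "vir_vertex_alg c Y =
    module.extend (vir_module c) (vertex_alg.fields (vir_vac c) Y (vir_grading c))"

text \<open>
  \<open>Y\<close> is the vertex algebra structure determined by \<open>Y(\<omega>,x) = \<Sum>\<^sub>n L\<^sub>n x^(-n-2)\<close>, which means that
  \<open>\<omega>\<^sub>n = L\<^sub>n\<^sub>-\<^sub>1\<close>.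
\<close>

definition is_vir_vertex_structure ::
    "'k::field \<Rightarrow> ('k vir_vec \<Rightarrow> int \<Rightarrow> 'k vir_vec \<Rightarrow> 'k vir_vec) \<Rightarrow> bool"
  where "is_vir_vertex_structure c Y \<longleftrightarrow>
    graded_vertex_algebra (vir_vertex_alg c Y) \<and>
    (\<forall>n. \<forall>v\<in>carrier (vir_module c). Y (vir_omega c) n v = vir_L c (n - 1) v)"

definition vir_submodule :: "'k::field \<Rightarrow> 'k vir_vec set \<Rightarrow> bool"
  where "vir_submodule c N \<longleftrightarrow>
    is_subspace (vir_module c) N \<and> (\<forall>n. \<forall>v\<in>N. vir_L c n v \<in> N)"

text \<open>
  The submodule \<open>I\<^sub>0\<close>. The central element acts as a scalar, so \<open>vir_submodule\<close> need not
  mention it.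
\<close>

definition vir_I0 :: "'k::field \<Rightarrow> 'k vir_vec set"
  where "vir_I0 c = (let p = CHAR('k); M = vir_module c in
    vir_submodule c hull
      {(vir_L c (- n) ^^ p) (vir_vac c)
         \<ominus>\<^bsub>M\<^esub> (if int p dvd n then vir_L c (- n * int p) (vir_vac c) else \<zero>\<^bsub>M\<^esub>) | n. n \<ge> 2})"

definition vir0_vertex_alg ::
    "'k::field \<Rightarrow> ('k vir_vec \<Rightarrow> int \<Rightarrow> 'k vir_vec \<Rightarrow> 'k vir_vec) \<Rightarrow> ('k, 'k vir_vec set) vertex_alg"
  where "vir0_vertex_alg c Y = quot_vertex_alg (vir_vertex_alg c Y) (vir_I0 c)"

definition vir0_omega :: "'k::field \<Rightarrow> 'k vir_vec set"
  where "vir0_omega c = vir_I0 c +>\<^bsub>vir_module c\<^esub> vir_omega c"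

end

theory Submission
  imports Defs "HOL-Library.Poly_Mapping" "HOL-Number_Theory.Cong"
begin

text \<open>
  Let \<open>V\<close> be the universal Virasoro vertex algebra. In \<open>A(V)\<close> one has
  \<open>[L\<^bsub>-n\<^esub> v] = (-1)\<^sup>n ((n - 1) [\<omega>] [v] - [L\<^sub>-\<^sub>1 v])\<close>; read as a recursion on words in the \<open>L\<^sub>n\<close> this
  defines a linear map \<open>ev\<close> from \<open>V\<close> to polynomials, which respects the defining relations of the
  induced module. Its kernel is spanned by the vectors \<open>\<omega> \<circ>\<^sub>n v\<close>, because \<open>L\<^sub>-\<^sub>2 + L\<^sub>-\<^sub>1\<close> and the operators
  \<open>L\<^bsub>-n\<^esub> + 2 L\<^bsub>-n+1\<^esub> + L\<^bsub>-n+2\<^esub>\<close> with \<open>n \<ge> 3\<close> generate \<open>V\<close> from the vacuum. As \<open>p \<ge> 3\<close>, already \<open>L\<^sub>-\<^sub>1\<close>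
  and \<open>L\<^sub>-\<^sub>2\<close> generate \<open>V\<close>, and an induction along them shows that \<open>ev\<close> sends \<open>a * b\<close> to the product
  \<open>ev a ev b\<close> and \<open>a \<circ>\<^sub>n b\<close> to \<open>0\<close>.

  In characteristic \<open>p\<close> the elements \<open>L\<^bsub>-n\<^esub>\<^sup>p - \<delta> L\<^bsub>-np\<^esub>\<close> commute with all \<open>L\<^sub>k\<close>, and
  \<open>ev\<close> maps the corresponding generators of \<open>I\<^sub>0\<close> to multiples of \<open>x\<^sup>p - x\<close>, the one with \<open>n = 2\<close> to
  \<open>x\<^sup>p - x\<close> itself. Hence \<open>ev\<close> maps \<open>I\<^sub>0\<close> onto the ideal \<open>(x\<^sup>p - x)\<close> and induces the isomorphism. That
  \<open>I\<^sub>0\<close> is an ideal follows from Jacobson's formula for \<open>p\<close>-th powers of sums, applied to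
  the divided powers of the translation operator.
\<close>

section \<open>Preliminaries in characteristic \<open>p\<close>\<close>

text \<open>The recursion for \<open>ev\<close> comes from the products
  \<open>\<omega> \<circ>\<^sub>n v\<close>. As \<omega> has degree 2, they are L(-n) v + 2 L(-n+1)
  v + L(-n+2) v with n \<ge> 3. The characteristic polynomial is (t + 1)^2, so modulo these vectors
  L(-n) v is (-1)^n times an affine function of n, fixed by its values at n = 1 and n = 2. No basis
  of V is used. That \<open>ev\<close> is well defined is checked on the defining relations, and a
  statement about all vectors is proved by showing that the vectors satisfying it are stable under
  operators that generate V from the vacuum. Characteristic p is felt in two places. Divided powers
  of translation are not obtained from powers of L(-1), so a Virasoro submodule need not be an ideal
  for formal reasons; Jacobson's formula controls the divided powers of the generators of the
  submodule. And L(0) sees degrees only modulo p, so homogeneous components are always taken from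
  the grading itself. The Zhu algebra is not analysed by its own structure theory: once
  \<open>ev\<close> is multiplicative, O of the quotient is the image of all v with x^p - x dividing
  \<open>ev v\<close>.\<close>

definition ad :: "'r::ring_1 \<Rightarrow> 'r \<Rightarrow> 'r"
  where "ad x y = x * y - y * x"

text \<open>\<open>ad x\<close> is the difference of left and right multiplication by
  \<open>x\<close>. These commute, so this is their binomial expansion.\<close>

lemma ad_power:
  "(ad x ^^ m) y = (\<Sum>i\<le>m. of_int ((-1) ^ i * int (m choose i)) * (x ^ (m - i) * y * x ^ i))"
proof (induction m)
  case 0
  show ?case by simp
next
  case (Suc m)
  define c where "c i = (of_int ((-1) ^ i * int (m choose i)) :: 'a)" for i
  define c' where "c' i = (of_int ((-1) ^ i * int (Suc m choose i)) :: 'a)" for i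
  have c'0: "c' 0 = c 0" by (simp add: c_def c'_def)
  have c'S: "c' (Suc i) = c (Suc i) - c i" for i
    by (simp add: c_def c'_def algebra_simps)
  have cz: "c (Suc m) = 0" by (simp add: c_def binomial_eq_0)
  have comm: "x * (c i * z) = c i * (x * z)" for i z
    unfolding c_def by (metis mult_of_int_commute mult.assoc)
  have 1: "x * (\<Sum>i\<le>m. c i * (x ^ (m - i) * y * x ^ i)) =
     (\<Sum>i\<le>Suc m. c i * (x ^ (Suc m - i) * y * x ^ i))"
    by (simp add: sum_distrib_left comm cz Suc_diff_le mult.assoc)
  have 2: "(\<Sum>i\<le>m. c i * (x ^ (m - i) * y * x ^ i)) * x =
     (\<Sum>i\<le>m. c i * (x ^ (m - i) * y * x ^ Suc i))"
    by (simp add: sum_distrib_right mult.assoc power_commutes)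
  have "(ad x ^^ Suc m) y = (\<Sum>i\<le>Suc m. c i * (x ^ (Suc m - i) * y * x ^ i))
     - (\<Sum>i\<le>m. c i * (x ^ (m - i) * y * x ^ Suc i))"
    unfolding 1[symmetric] 2[symmetric] Suc.IH[folded c_def, symmetric] by (simp add: ad_def)
  also have "\<dots> = (\<Sum>i\<le>Suc m. c' i * (x ^ (Suc m - i) * y * x ^ i))"
    unfolding sum.atMost_Suc_shift c'0 c'S
    by (simp add: algebra_simps sum_subtractf)
  finally show ?case unfolding c'_def .
qed

text \<open>Two neighbours in row p - 1 of Pascal's triangle add up to an entry of row p that is
  divisible by p, so the entries of row p - 1 alternate in sign modulo p.\<close>

lemma binomial_prime_minus_one:
  assumes "prime p" "of_nat p = (0 :: 'r::ring_1)" "i < p"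
  shows "(of_int ((-1) ^ i * int ((p - 1) choose i)) :: 'r) = 1"
  using assms(3)
proof (induction i)
  case (Suc i)
  have "p dvd p choose (Suc i)" using Suc.prems assms(1) by (intro dvd_choose_prime) auto
  then have "(of_nat (p choose (Suc i)) :: 'r) = 0"
    using assms(2) by (auto elim!: dvdE)
  moreover have "p choose Suc i = ((p - 1) choose i) + ((p - 1) choose Suc i)"
    using Suc.prems by (cases p) auto
  ultimately have "(of_nat ((p - 1) choose Suc i) :: 'r) = - of_nat ((p - 1) choose i)"
    by (simp add: add_eq_0_iff)
  with Suc show ?case by simp
qed simp

text \<open>The right-hand side is the derivative of x^p in the direction y for noncommuting x and
  y. Jacobson's formula rests on its being an iterated commutator.\<close>

lemma ad_power_prime_minus_one:
  fixes x y :: "'r::ring_1"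
  assumes "prime p" "of_nat p = (0 :: 'r)"
  shows "(ad x ^^ (p - 1)) y = (\<Sum>i<p. x ^ (p - 1 - i) * y * x ^ i)"
proof -
  have "{..p - 1} = {..<p}" using prime_gt_0_nat[OF assms(1)] by auto
  moreover have "(\<Sum>i<p. of_int ((-1) ^ i * int ((p - 1) choose i)) * (x ^ (p - 1 - i) * y * x ^ i))
     = (\<Sum>i<p. x ^ (p - 1 - i) * y * x ^ i)"
    using binomial_prime_minus_one[OF assms] by (intro sum.cong) simp_all
  ultimately show ?thesis unfolding ad_power by simp
qed

lemma power_prime_commutator:
  fixes x y :: "'r::ring_1"
  assumes "prime p" "of_nat p = (0 :: 'r)"
  shows "x ^ p * y - y * x ^ p = (ad x ^^ p) y"
proof -
  have p: "p = Suc (p - 1)" using prime_gt_0_nat[OF assms(1)] by simp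
  have z: "(of_int ((-1) ^ i * int (p choose i)) :: 'r) = 0" if "0 < i" "i < p" for i
  proof -
    have "p dvd p choose i" using that assms(1) by (intro dvd_choose_prime) auto
    then have "(of_nat (p choose i) :: 'r) = 0" using assms(2) by (auto elim!: dvdE)
    then show ?thesis by simp
  qed
  have "(ad x ^^ p) y = (\<Sum>i\<in>{0, p}. of_int ((-1) ^ i * int (p choose i)) * (x ^ (p - i) * y * x ^ i))"
    unfolding ad_power
  proof (rule sum.mono_neutral_right)
    show "\<forall>i\<in>{..p} - {0, p}. of_int ((-1) ^ i * int (p choose i)) * (x ^ (p - i) * y * x ^ i) = 0"
      using z by (metis DiffE atMost_iff insertCI le_neq_implies_less mult_zero_left neq0_conv)
  qed auto
  also have "\<dots> = x ^ p * y + (- 1) ^ p * (y * x ^ p)"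
    using p by (simp)
  \<comment> \<open>Reading the sign off the coefficient at \<open>i = p - 1\<close> covers p = 2 as
    well.\<close>
  also have "(- 1) ^ p = (-1 :: 'r)"
    using binomial_prime_minus_one[OF assms, of "p - 1"] p
    by (metis binomial_n_n diff_less mult.right_neutral of_int_1 of_int_minus of_int_power of_nat_1
        power_Suc prime_gt_0_nat assms(1) zero_less_one mult_minus1 )
  finally show ?thesis by simp
qed

text \<open>Jacobson's formula for the \<open>p\<close>-th power of a sum, up to an unspecified Lie polynomial. The
  formal derivative of \<open>(x t + y)\<^sup>p\<close> with respect to \<open>t\<close> is \<open>ad (x t + y)\<^bsup>p-1\<^esup> x\<close>.\<close>

locale lie_subring =
  fixes G :: "'r::ring_1 set"
  assumes zero: "0 \<in> G"
    and diff: "x \<in> G \<Longrightarrow> y \<in> G \<Longrightarrow> x - y \<in> G"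
    and ad: "x \<in> G \<Longrightarrow> y \<in> G \<Longrightarrow> ad x y \<in> G"
begin

lemma add: "x \<in> G \<Longrightarrow> y \<in> G \<Longrightarrow> x + y \<in> G"
  using diff[of x "- y"] diff[of 0 y] zero by simp

lemma sum: "(\<And>i. i \<in> A \<Longrightarrow> f i \<in> G) \<Longrightarrow> sum f A \<in> G"
  by (induction A rule: infinite_finite_induct) (auto simp: zero add)

lemma of_nat_mult: "x \<in> G \<Longrightarrow> of_nat n * x \<in> G"
  by (induction n) (auto simp: zero add distrib_right)

lemma fps_ad_power:
  assumes A: "\<And>k. A $ k \<in> G" and "\<And>k. f $ k \<in> G"
  shows "(ad A ^^ m) f $ k \<in> G"
proof (induction m arbitrary: k)
  case (Suc m)
  define g where "g = (ad A ^^ m) f"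
  \<comment> \<open>Reversing one of the two convolutions pairs the terms into commutators of
    coefficients.\<close>
  have "(\<Sum>i=0..k. g $ i * A $ (k - i)) = (\<Sum>i=0..k. g $ (k - i) * A $ i)"
    by (rule sum.reindex_bij_witness[of _ "\<lambda>i. k - i" "\<lambda>i. k - i"]) auto
  then have "ad A g $ k = (\<Sum>i=0..k. ad (A $ i) (g $ (k - i)))"
    by (simp add: ad_def fps_mult_nth sum_subtractf)
  with Suc A show ?case by (auto simp: g_def intro!: sum ad)
qed (simp add: assms)

text \<open>Put A = y + x t. The outer coefficients of A^p are y^p and x^p. For 0 < k < p, k times
  the k-th coefficient is a coefficient of the derivative of A^p, hence lies in \<open>G\<close>,
  and k is invertible modulo p.\<close>

lemma power_add_prime:
  fixes p :: nat
  assumes p: "prime p" "of_nat p = (0 :: 'r)" and x: "x \<in> G" and y: "y \<in> G"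
  shows "(x + y) ^ p - x ^ p - y ^ p \<in> G"
proof -
  define A where "A = fps_const y + fps_const x * fps_X"
  have A: "A $ k = (if k = 0 then y else if k = 1 then x else 0)" for k
    by (simp add: A_def)
  have step: "(A ^ Suc m) $ k = y * (A ^ m) $ k + (if k = 0 then 0 else x * (A ^ m) $ (k - 1))" for m k
  proof -
    have "(A ^ Suc m) $ k = (fps_const y * A ^ m + fps_const x * (fps_X * A ^ m)) $ k"
      by (simp add: A_def algebra_simps)
    then show ?thesis by (simp only: fps_add_nth fps_mult_left_const_nth fps_X_mult_nth) auto
  qed
  have gt: "(A ^ m) $ k = 0" if "k > m" for m k
    using that by (induction m arbitrary: k) (auto simp: step simp del: power_Suc)
  have bot: "(A ^ m) $ 0 = y ^ m" for m
    by (induction m) (auto simp: step simp del: power_Suc, simp)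
  have top: "(A ^ m) $ m = x ^ m" for m
    by (induction m) (auto simp: step gt simp del: power_Suc, simp)
  \<comment> \<open>Summing all coefficients plays the role of setting t = 1.\<close>
  have total: "(\<Sum>k\<le>m. (A ^ m) $ k) = (x + y) ^ m" for m
  proof (induction m)
    case (Suc m)
    have "(\<Sum>k\<le>Suc m. (A ^ Suc m) $ k) = y * (\<Sum>k\<le>Suc m. (A ^ m) $ k) + x * (\<Sum>k\<le>m. (A ^ m) $ k)"
    proof -
      have "(\<Sum>k\<le>Suc m. if k = 0 then 0 else x * (A ^ m) $ (k - 1)) = x * (\<Sum>k\<le>m. (A ^ m) $ k)"
        by (subst sum.atMost_Suc_shift) (simp add: sum_distrib_left)
      then show ?thesis unfolding step sum.distrib by (simp only: sum_distrib_left)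
    qed
    also have "(\<Sum>k\<le>Suc m. (A ^ m) $ k) = (\<Sum>k\<le>m. (A ^ m) $ k)"
      by (simp add: gt)
    finally show ?case using Suc by (simp add: distrib_right)
  qed simp
  have deriv: "fps_deriv (A ^ m) = (\<Sum>i<m. A ^ (m - 1 - i) * fps_const x * A ^ i)" for m
  proof (induction m)
    case (Suc m)
    have dA: "fps_deriv A = fps_const x" by (simp add: A_def)
    have "fps_deriv (A ^ Suc m) = A * (\<Sum>i<m. A ^ (m - 1 - i) * fps_const x * A ^ i) + fps_const x * A ^ m"
      by (simp add: Suc dA)
    also have "A * (\<Sum>i<m. A ^ (m - 1 - i) * fps_const x * A ^ i) = (\<Sum>i<m. A ^ (m - i) * fps_const x * A ^ i)"
      unfolding sum_distrib_left
    proof (rule sum.cong[OF refl], goal_cases)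
      case (1 i)
      then have "m - i = Suc (m - 1 - i)" by auto
      then show ?case by (simp add: mult.assoc)
    qed
    finally show ?case by simp
  qed simp
  have "fps_deriv (A ^ p) = (ad A ^^ (p - 1)) (fps_const x)"
  proof -
    have "(of_nat p :: 'r fps) = 0" using p(2) by (simp flip: fps_of_nat)
    from ad_power_prime_minus_one[OF p(1) this] show ?thesis by (simp add: deriv)
  qed
  moreover have "(ad A ^^ (p - 1)) (fps_const x) $ k \<in> G" for k
    using x y zero by (intro fps_ad_power) (auto simp: A)
  ultimately have "of_nat (Suc k) * (A ^ p) $ (Suc k) \<in> G" for k
    by (metis Suc_eq_plus1 fps_deriv_nth)
  then have k: "of_nat k * (A ^ p) $ k \<in> G" if "k > 0" for k
    using that by (cases k) auto
  have mid: "(A ^ p) $ k \<in> G" if "0 < k" "k < p" for k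
  proof -
    \<comment> \<open>\<open>G\<close> is only an additive group, so dividing by \<open>k\<close>
      means multiplying by a natural number inverse to \<open>k\<close> modulo
      \<open>p\<close>.\<close>
    have "coprime k p" using that p(1)
      by (metis coprime_commute nat_dvd_not_less prime_imp_coprime)
    then obtain k' where "[k * k' = 1] (mod p)" using cong_solve_coprime_nat by auto
    then have "[k' * k = 1] (mod p)" by (simp add: mult.commute)
    then obtain q1 q2 where "k' * k + p * q1 = 1 + p * q2"
      unfolding cong_iff_lin_nat by (metis mult.commute)
    then have "(of_nat (k' * k + p * q1) :: 'r) = of_nat (1 + p * q2)" by (simp only:)
    then have "of_nat k' * of_nat k = (1 :: 'r)" using p(2) by simp
    then have "(A ^ p) $ k = of_nat k' * (of_nat k * (A ^ p) $ k)"
      by (simp flip: mult.assoc)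
    with of_nat_mult k[OF that(1)] show ?thesis by metis
  qed
  have "p > 0" using p(1) prime_gt_0_nat by blast
  then have "{..p} = insert 0 (insert p {0<..<p})" by auto
  then have "(x + y) ^ p = y ^ p + (x ^ p + (\<Sum>k\<in>{0<..<p}. (A ^ p) $ k))"
    unfolding total[symmetric] using \<open>p > 0\<close> by (simp add: bot top)
  moreover have "(\<Sum>k\<in>{0<..<p}. (A ^ p) $ k) \<in> G" by (rule sum) (use mid in auto)
  ultimately show ?thesis by (simp add: algebra_simps)
qed

lemma power_sum_prime:
  fixes p :: nat
  assumes p: "prime p" "of_nat p = (0 :: 'r)" and A: "finite A" "\<And>i. i \<in> A \<Longrightarrow> f i \<in> G"
  shows "(\<Sum>i\<in>A. f i) ^ p - (\<Sum>i\<in>A. f i ^ p) \<in> G"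
  using A
proof (induction A)
  case empty
  show ?case using prime_gt_0_nat[OF p(1)] by (simp add: zero power_0_left)
next
  case (insert i A)
  have "(f i + sum f A) ^ p - f i ^ p - sum f A ^ p \<in> G"
    by (rule power_add_prime[OF p]) (use insert in \<open>auto intro: sum\<close>)
  from add[OF this insert.IH] insert show ?case by (simp add: algebra_simps)
qed

end

section \<open>Binomial coefficients\<close>

text \<open>The integer behind \<open>ibinom\<close>. Identities that involve cancelling a factor 6
  are settled here, before reduction modulo a characteristic that may be 3.\<close>

definition ichoose :: "int \<Rightarrow> nat \<Rightarrow> int"
  where "ichoose m n = (\<Prod>i<n. m - int i) div fact n"

lemma ibinom_ichoose: "ibinom m n = of_int (ichoose m n)"
  by (simp add: ibinom_def ichoose_def)

lemma ibinom_0 [simp]: "ibinom m 0 = 1"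
  by (simp add: ibinom_def)

lemma ibinom_1 [simp]: "ibinom m (Suc 0) = of_int m"
  by (simp add: ibinom_def)

lemma ichoose_of_nat: "ichoose (int m) n = int (m choose n)"
  using gbinomial_nneg[of "int m" n] by (simp add: gbinomial_prod_rev atLeast0LessThan ichoose_def)

lemma ibinom_of_nat: "ibinom (int m) n = (of_nat (m choose n) :: 'k::field)"
  by (simp add: ibinom_ichoose ichoose_of_nat)

lemma ibinom_0_left [simp]: "ibinom 0 n = (if n = 0 then 1 else 0 :: 'k::field)"
  using ibinom_of_nat[of 0 n] by (cases n) simp_all

lemma ibinom_minus_one: "ibinom (-1) n = ((-1) ^ n :: 'k::field)"
  using uminus_one_gbinomial[of n]
  by (simp add: ibinom_ichoose gbinomial_prod_rev atLeast0LessThan ichoose_def)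

lemma six_ichoose_3: "6 * ichoose m 3 = m * (m - 1) * (m - 2)"
  using gbinomial_int_mult_fact[of 3 m]
  by (simp add: gbinomial_prod_rev atLeast0LessThan ichoose_def numeral_3_eq_3 fact_numeral mult.assoc)

section \<open>The polynomial \<open>x\<^sup>p - x\<close>\<close>

lemma of_nat_power_CHAR:
  assumes "CHAR('k::comm_semiring_1) = p" "prime p"
  shows "(of_nat n :: 'k) ^ p = of_nat n"
proof (induction n)
  case 0
  show ?case using prime_gt_0_nat[OF assms(2)] by (simp add: power_0_left)
next
  case (Suc n)
  have "(1 + of_nat n :: 'k) ^ p = 1 ^ p + of_nat n ^ p"
    using assms by (intro freshmans_dream) auto
  then show ?case by (simp only: of_nat_Suc Suc power_one)
qed

lemma pcompose_power: "pcompose (f ^ n) g = pcompose f g ^ n"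
  for f g :: "'k::field poly"
  by (induction n) (auto simp: pcompose_mult pcompose_1)

text \<open>In an indeterminate, both sides are monic of degree p and vanish on the p elements of
  the prime field. Substitution then gives every \<open>y\<close>.\<close>

lemma prod_shift_char:
  fixes y :: "'k::field poly"
  assumes "CHAR('k) = p" "prime p"
  shows "(\<Prod>j<p. y + of_nat j) = y ^ p - y"
proof -
  define x0 where "x0 = ([:0, 1:] :: 'k poly)"
  define P where "P = (\<Prod>j<p. x0 + of_nat j)"
  define Q where "Q = x0 ^ p - x0"
  have p: "p > 1" using prime_gt_1_nat assms(2) by blast
  have x0: "x0 + of_nat j = [:of_nat j, 1:]" for j by (simp add: x0_def of_nat_poly)
  have "Polynomial.degree P = (\<Sum>j<p. Polynomial.degree (x0 + of_nat j))"
    unfolding P_def by (rule degree_prod_sum_eq) (simp add: x0)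
  then have degP: "Polynomial.degree P = p" by (simp add: x0)
  have cP: "Polynomial.coeff P p = 1"
    using lead_coeff_prod[of "\<lambda>j. x0 + of_nat j" "{..<p}"] unfolding P_def[symmetric] degP
    by (simp add: x0)
  have Q: "Q = Polynomial.monom 1 p - Polynomial.monom 1 1"
    unfolding Q_def x0_def by (metis monom_altdef power_one_right smult_1_left)
  have "P = Q"
  proof (rule poly_eqI_degree_lead_coeff[of _ p _ "(\<lambda>j. - of_nat j) ` {..<p}"])
    have "inj_on (\<lambda>j. - of_nat j :: 'k) {..<p}"
    proof (rule inj_onI)
      fix a b assume *: "a \<in> {..<p}" "b \<in> {..<p}" "- of_nat a = (- of_nat b :: 'k)"
      then have "[a = b] (mod p)" using assms(1) by (simp add: of_nat_eq_iff_cong_CHAR)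
      with * show "a = b" by (simp add: cong_less_modulus_unique_nat)
    qed
    then show "card ((\<lambda>j. - of_nat j :: 'k) ` {..<p}) \<ge> p" by (simp add: card_image)
  next
    fix z assume "z \<in> (\<lambda>j. - of_nat j :: 'k) ` {..<p}"
    then obtain j where j: "j < p" "z = - of_nat j" by auto
    have "poly P z = (\<Prod>j<p. z + of_nat j)" unfolding P_def poly_prod x0 by (simp add: add.commute)
    also have "\<dots> = 0" using j by auto
    finally have "poly P z = 0" .
    moreover have "poly Q z = 0"
      using of_nat_power_CHAR[OF assms, of j] minus_power_prime_CHAR[of p "of_nat j :: 'k"] assms j
      by (simp add: Q poly_monom)
    ultimately show "poly P z = poly Q z" by simp
  next
    show "Polynomial.degree Q \<le> p" unfolding Q
      using p by (intro degree_diff_le) (auto simp: Polynomial.degree_monom_eq)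
  qed (use degP cP p in \<open>auto simp: Q\<close>)
  then have "pcompose P y = pcompose Q y" by simp
  moreover have "pcompose P y = (\<Prod>j<p. y + of_nat j)"
    unfolding P_def pcompose_prod by (simp add: pcompose_add x0_def pcompose_pCons of_nat_poly add.commute)
  moreover have "pcompose Q y = y ^ p - y"
    unfolding Q_def by (simp add: pcompose_diff pcompose_power x0_def pcompose_pCons)
  ultimately show ?thesis by simp
qed

text \<open>The factor \<open>if p dvd n then 0 else 1\<close> is \<open>n\<^bsup>p-1\<^esup>\<close> in characteristic \<open>p\<close>.\<close>

lemma prod_shift_multiples_char:
  fixes y :: "'k::field poly"
  assumes "CHAR('k) = p" "prime p"
  shows "(\<Prod>j<p. y + of_nat (j * n)) = y ^ p - (if p dvd n then 0 else y)"
proof (cases "p dvd n")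
  case True
  then have "(of_nat (j * n) :: 'k poly) = 0" for j
    using assms(1) by (simp add: of_nat_eq_0_iff_char_dvd)
  with True show ?thesis by (simp del: of_nat_mult)
next
  case False
  define a where "a = (of_nat n :: 'k)"
  have a: "a \<noteq> 0" using False assms(1) by (simp add: a_def of_nat_eq_0_iff_char_dvd)
  have ap: "a ^ p = a" unfolding a_def by (rule of_nat_power_CHAR[OF assms])
  \<comment> \<open>Dividing \<open>y\<close> by \<open>n\<close> turns steps of length
    \<open>n\<close> into steps of length 1.\<close>
  define w where "w = smult (1 / a) y"
  have w: "smult a w = y" using a by (simp add: w_def)
  have *: "y + of_nat (j * n) = smult a (w + of_nat j)" for j
    by (simp add: smult_add_right w) (simp add: a_def of_nat_poly mult.commute)
  have "(\<Prod>j<p. y + of_nat (j * n)) = smult (a ^ p) (\<Prod>j<p. w + of_nat j)"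
    by (simp only: * prod_smult prod_constant card_lessThan)
  also have "\<dots> = smult (a ^ p) (w ^ p) - smult (a ^ p) w"
    by (simp only: prod_shift_char[OF assms] smult_diff_right)
  also have "\<dots> = y ^ p - y"
    by (simp only: smult_power[symmetric] w) (simp only: ap w)
  finally show ?thesis using False by simp
qed

section \<open>The free algebra on \<open>L\<^sub>n\<close>\<close>

text \<open>Concatenation is written additively so that finitely supported functions on words, with
  their convolution product, form the free associative algebra on the modes. Unlike the record
  \<open>tensor_algebra\<close> this is a type of class \<open>ring_1\<close>, to which the results
  on \<open>lie_subring\<close> apply.\<close>

datatype mode_word = Mode_Word (modes: "int list")

instantiation mode_word :: monoid_add
begin
definition "0 = Mode_Word []"
definition "u + v = Mode_Word (modes u @ modes v)"
instance by standard (simp_all add: zero_mode_word_def plus_mode_word_def)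
end

lemma modes_zero [simp]: "modes 0 = []"
  and modes_plus [simp]: "modes (u + v) = modes u @ modes v"
  by (simp_all add: zero_mode_word_def plus_mode_word_def)

type_synonym 'k mode_alg = "mode_word \<Rightarrow>\<^sub>0 'k"

definition mode :: "int \<Rightarrow> 'k::field mode_alg"
  where "mode n = Poly_Mapping.single (Mode_Word [n]) 1"

definition mconst :: "'k::field \<Rightarrow> 'k mode_alg"
  where "mconst a = Poly_Mapping.single 0 a"

lemma mconst_commute: "mconst a * f = f * mconst a"
proof (induction f rule: update_induct)
  case (update f w b)
  have "Poly_Mapping.update w b f = f + Poly_Mapping.single w b"
    by (rule poly_mapping_eqI) (use update in \<open>auto simp: lookup_update lookup_add lookup_single when_def in_keys_iff\<close>)
  with update show ?case by (simp add: algebra_simps mconst_def mult_single)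
qed simp

lemma of_nat_mode_alg_eq_0: "CHAR('k) = p \<Longrightarrow> (of_nat p :: 'k::field mode_alg) = 0"
  by (metis of_nat_CHAR single_of_nat single_zero)

section \<open>A functional on words\<close>

definition vir_cocycle :: "int \<Rightarrow> int \<Rightarrow> 'k::field"
  where "vir_cocycle m n = (if m + n = 0 then 1 / 2 * ibinom (m + 1) 3 else 0)"

text \<open>The functional \<open>g\<close> on the basis, extended linearly and evaluated at the
  bracket of the two arguments. Working with functionals postpones linear combinations of words
  until the tensor algebra enters.\<close>

fun bracket_sum :: "vir_basis \<Rightarrow> vir_basis \<Rightarrow> (vir_basis \<Rightarrow> 'k::field poly) \<Rightarrow> 'k poly"
  where
    "bracket_sum (Vir_L m) (Vir_L n) g =
      Polynomial.smult (of_int (m - n)) (g (Vir_L (m + n))) + Polynomial.smult (vir_cocycle m n) (g Vir_c)"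
  | "bracket_sum Vir_c _ g = 0"
  | "bracket_sum _ Vir_c g = 0"

lemma bracket_sum_c_right [simp]: "bracket_sum x Vir_c g = 0"
  by (cases x) auto

lemma bracket_sum_add: "bracket_sum x y (\<lambda>b. g b + h b) = bracket_sum x y g + bracket_sum x y h"
  by (induction x y g rule: bracket_sum.induct) (auto simp: smult_add_right)

lemma bracket_sum_diff: "bracket_sum x y (\<lambda>b. g b - h b) = bracket_sum x y g - bracket_sum x y h"
  by (induction x y g rule: bracket_sum.induct) (auto simp: smult_diff_right)

lemma bracket_sum_smult:
  "bracket_sum x y (\<lambda>b. Polynomial.smult a (g b)) = Polynomial.smult a (bracket_sum x y g)"
  by (induction x y g rule: bracket_sum.induct) (auto simp: smult_add_right mult.commute)

lemma bracket_sum_mult: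
  "bracket_sum x y (\<lambda>b. a * g b) = a * bracket_sum x y g"
  by (induction x y g rule: bracket_sum.induct) (auto simp: algebra_simps)

lemma bracket_sum_0 [simp]: "bracket_sum x y (\<lambda>b. 0) = 0"
  by (induction x y "\<lambda>_::vir_basis. 0 :: 'a poly" rule: bracket_sum.induct) auto

section \<open>The Virasoro cocycle and the Jacobi identity, tested on functionals\<close>

lemma vir_cocycle_antisym: "vir_cocycle m n = - (vir_cocycle n m :: 'k::field)"
proof (cases "m + n = 0")
  case True
  then have "n = - m" by simp
  then have "6 * ichoose (m + 1) 3 = 6 * (- ichoose (n + 1) 3)"
    using six_ichoose_3[of "m + 1"] six_ichoose_3[of "n + 1"] by (simp add: algebra_simps)
  then have "ichoose (m + 1) 3 = - ichoose (n + 1) 3" by simp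
  then show ?thesis using True
    by (simp add: vir_cocycle_def ibinom_ichoose add.commute flip: of_int_minus)
qed (simp add: vir_cocycle_def add.commute)

text \<open>After multiplication by 6 this is a polynomial identity in two integers. The 6 is
  cancelled over the integers, since it is 0 in the field when p = 3.\<close>

lemma vir_cocycle_jacobi:
  "of_int (n - k) * vir_cocycle m (n + k) - of_int (m - k) * vir_cocycle n (m + k)
    = (of_int (m - n) * vir_cocycle (m + n) k :: 'k::field)"
proof (cases "m + n + k = 0")
  case True
  then have k: "k = - m - n" and "m + (n + k) = 0" "n + (m + k) = 0" by linarith+
  with True have co: "vir_cocycle m (n + k) = (1 / 2 * of_int (ichoose (m + 1) 3) :: 'k)"
    "vir_cocycle n (m + k) = (1 / 2 * of_int (ichoose (n + 1) 3) :: 'k)"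
    "vir_cocycle (m + n) k = (1 / 2 * of_int (ichoose (m + n + 1) 3) :: 'k)"
    by (simp_all add: vir_cocycle_def ibinom_ichoose)
  have "6 * ((n - k) * ichoose (m + 1) 3 - (m - k) * ichoose (n + 1) 3)
     = (n - k) * (6 * ichoose (m + 1) 3) - (m - k) * (6 * ichoose (n + 1) 3)"
    by (simp add: algebra_simps)
  also have "\<dots> = (m - n) * (6 * ichoose (m + n + 1) 3)"
    unfolding six_ichoose_3 k by (simp add: algebra_simps)
  finally have "(n - k) * ichoose (m + 1) 3 - (m - k) * ichoose (n + 1) 3
     = (m - n) * ichoose (m + n + 1) 3" by simp
  then have *: "of_int ((n - k) * ichoose (m + 1) 3 - (m - k) * ichoose (n + 1) 3)
     = (of_int ((m - n) * ichoose (m + n + 1) 3) :: 'k)"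
    by (simp only:)
  have "of_int (n - k) * (h * of_int (ichoose (m + 1) 3)) - of_int (m - k) * (h * of_int (ichoose (n + 1) 3))
     = of_int (m - n) * (h * of_int (ichoose (m + n + 1) 3))" for h :: 'k
    using arg_cong[OF *, of "\<lambda>i. h * i"] by (simp add: algebra_simps)
  from this[of "1 / 2"] show ?thesis unfolding co .
next
  case False
  then have "m + (n + k) \<noteq> 0" "n + (m + k) \<noteq> 0" by linarith+
  with False show ?thesis by (simp add: vir_cocycle_def)
qed

text \<open>A sum of zero forces m to be -1, 0 or 1, where binom(m + 1, 3) vanishes. Hence the
  subalgebra fixing the vacuum sees no central term.\<close>

lemma vir_cocycle_eq_0: "m \<ge> -1 \<Longrightarrow> n \<ge> -1 \<Longrightarrow> vir_cocycle m n = (0 :: 'k::field)"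
proof -
  assume *: "m \<ge> -1" "n \<ge> -1"
  show ?thesis
  proof (cases "m + n = 0")
    case True
    with * have "m = -1 \<or> m = 0 \<or> m = 1" by auto
    then have "6 * ichoose (m + 1) 3 = 0" unfolding six_ichoose_3 by auto
    then show ?thesis by (simp add: vir_cocycle_def ibinom_ichoose)
  qed (simp add: vir_cocycle_def)
qed

lemma bracket_sum_antisym: "bracket_sum x y g = - bracket_sum y x (g :: _ \<Rightarrow> 'k::field poly)"
proof (cases x; cases y)
  fix m n assume [simp]: "x = Vir_L m" "y = Vir_L n"
  have "of_int (m - n) = - (of_int (n - m) :: 'k)" by simp
  then show ?thesis
    using vir_cocycle_antisym[of m n, where 'k = 'k]
    by (simp only: \<open>x = _\<close> \<open>y = _\<close> bracket_sum.simps add.commute[of n m] smult_minus_left minus_add_distrib)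
qed auto

lemma bracket_sum_jacobi:
  "bracket_sum y b (\<lambda>b'. bracket_sum x b' g) - bracket_sum x b (\<lambda>b'. bracket_sum y b' g)
   = bracket_sum x y (\<lambda>b'. bracket_sum b' b (g :: _ \<Rightarrow> 'k::field poly))"
proof (cases "x = Vir_c \<or> y = Vir_c \<or> b = Vir_c")
  case False
  then obtain m n k where [simp]: "x = Vir_L m" "y = Vir_L n" "b = Vir_L k"
    by (metis vir_basis.exhaust)
  define G H where "G = g (Vir_L (m + n + k))" and "H = g Vir_c"
  have G: "g (Vir_L (m + (n + k))) = G" "g (Vir_L (n + (m + k))) = G" "g (Vir_L (m + n + k)) = G"
    by (simp_all add: G_def add.assoc add.left_commute)
  have "of_int (n - k) * of_int (m - (n + k)) - of_int (m - k) * of_int (n - (m + k))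
    = (of_int (m - n) * of_int (m + n - k) :: 'k)"
    by (simp add: algebra_simps)
  moreover have "bracket_sum y b (\<lambda>b'. bracket_sum x b' g) - bracket_sum x b (\<lambda>b'. bracket_sum y b' g)
    = Polynomial.smult (of_int (n - k) * of_int (m - (n + k)) - of_int (m - k) * of_int (n - (m + k))) G
    + Polynomial.smult (of_int (n - k) * vir_cocycle m (n + k) - of_int (m - k) * vir_cocycle n (m + k)) H"
    by (simp only: \<open>x = _\<close> \<open>y = _\<close> \<open>b = _\<close> bracket_sum.simps bracket_sum_c_right G H_def[symmetric]
        smult_add_right smult_smult smult_diff_left smult_0_right) simp
  moreover have "bracket_sum x y (\<lambda>b'. bracket_sum b' b g)
    = Polynomial.smult (of_int (m - n) * of_int (m + n - k)) G
    + Polynomial.smult (of_int (m - n) * vir_cocycle (m + n) k) H"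
    by (simp only: \<open>x = _\<close> \<open>y = _\<close> \<open>b = _\<close> bracket_sum.simps G H_def[symmetric]
        smult_add_right smult_smult smult_0_right) simp
  ultimately show ?thesis by (simp only: vir_cocycle_jacobi)
qed (cases x; cases y; cases b; auto)

text \<open>\<open>word_ad x g w\<close> is the value of \<open>g\<close>, extended linearly, at \<open>ad x\<close> applied to \<open>w\<close>.\<close>

primrec word_ad :: "vir_basis \<Rightarrow> (vir_basis list \<Rightarrow> 'k::field poly) \<Rightarrow> vir_basis list \<Rightarrow> 'k poly"
  where
    "word_ad x g [] = 0"
  | "word_ad x g (b # w) = bracket_sum x b (\<lambda>b'. g (b' # w)) + word_ad x (\<lambda>w'. g (b # w')) w"

lemma word_ad_cong:
  "(\<And>w'. length w' = length w \<Longrightarrow> g w' = h w') \<Longrightarrow> word_ad x g w = word_ad x h w"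
proof (induction w arbitrary: g h)
  case (Cons b w)
  have "(\<lambda>b'. g (b' # w)) = (\<lambda>b'. h (b' # w))"
    by (rule ext) (rule Cons.prems, simp)
  moreover have "word_ad x (\<lambda>w'. g (b # w')) w = word_ad x (\<lambda>w'. h (b # w')) w"
    by (rule Cons.IH, rule Cons.prems) simp
  ultimately show ?case by simp
qed simp

lemma word_ad_add: "word_ad x (\<lambda>w. g w + h w) w = word_ad x g w + word_ad x h w"
  by (induction w arbitrary: g h) (auto simp: bracket_sum_add)

lemma word_ad_diff: "word_ad x (\<lambda>w. g w - h w) w = word_ad x g w - word_ad x h w"
  by (induction w arbitrary: g h) (auto simp: bracket_sum_diff)

lemma word_ad_mult: "word_ad x (\<lambda>w. a * g w) w = a * word_ad x g w"
  by (induction w arbitrary: g) (auto simp: bracket_sum_mult algebra_simps)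

lemma word_ad_smult:
  "word_ad x (\<lambda>w. Polynomial.smult a (g w)) w = Polynomial.smult a (word_ad x g w)"
  by (induction w arbitrary: g) (auto simp: bracket_sum_smult smult_add_right)

lemma word_ad_0 [simp]: "word_ad x (\<lambda>w. 0) w = 0"
  by (induction w) auto

lemma word_ad_c [simp]: "word_ad Vir_c g w = 0"
  by (induction w arbitrary: g) auto

lemma word_ad_append:
  "word_ad x g (u @ v) = word_ad x (\<lambda>u'. g (u' @ v)) u + word_ad x (\<lambda>v'. g (u @ v')) v"
  by (induction u arbitrary: g) auto

lemma word_ad_bracket_sum:
  "word_ad z (\<lambda>w. bracket_sum x y (\<lambda>b. h b w)) w = bracket_sum x y (\<lambda>b. word_ad z (h b) w)"
  by (cases x; cases y) (auto simp: word_ad_add word_ad_smult)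

text \<open>Dual form of [ad x, ad y] = ad [x, y]. Passing to functionals reverses composition,
  which explains the order on the left.\<close>

lemma word_ad_commutator:
  "word_ad y (word_ad x g) w - word_ad x (word_ad y g) w = bracket_sum x y (\<lambda>b. word_ad b g w)"
proof (induction w arbitrary: g)
  case (Cons b w)
  note 1 = bracket_sum_jacobi[of y b x "\<lambda>b'. g (b' # w)"] and 2 = Cons[of "\<lambda>w'. g (b # w')"]
  show ?case
    by (simp add: word_ad_add bracket_sum_add word_ad_bracket_sum flip: 1 2)
qed simp

text \<open>
  In the Zhu algebra \<open>L\<^sub>-\<^sub>n v = (-1)\<^sup>n ((n - 1) [\<omega>] v - L\<^sub>-\<^sub>1 v)\<close> for \<open>n \<ge> 1\<close>, and \<open>L\<^sub>n\<close> for \<open>n \<ge> -1\<close> is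
  commuted through to the vacuum.
\<close>

primrec corr_aux :: "'k::field \<Rightarrow> nat \<Rightarrow> vir_basis list \<Rightarrow> 'k poly"
  where
    "corr_aux c 0 w = 1"
  | "corr_aux c (Suc r) w =
      (case hd w of Vir_c \<Rightarrow> Polynomial.smult c (corr_aux c r (tl w))
       | Vir_L n \<Rightarrow> if n \<ge> -1 then word_ad (Vir_L n) (corr_aux c r) (tl w)
          else (-1) ^ nat (- n) * (of_int (- n - 1) * [:0, 1:] * corr_aux c r (tl w)
            - word_ad (Vir_L (-1)) (corr_aux c r) (tl w)))"

text \<open>The counter of \<open>corr_aux\<close> makes the recursion primitive:
  \<open>word_ad\<close> changes letters of the tail but keeps its length, so the length of the word
  is the right starting value.\<close>

definition corr :: "'k::field \<Rightarrow> vir_basis list \<Rightarrow> 'k poly"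
  where "corr c w = corr_aux c (length w) w"

lemma corr_Nil [simp]: "corr c [] = 1"
  by (simp add: corr_def)

lemma corr_c [simp]: "corr c (Vir_c # w) = Polynomial.smult c (corr c w)"
  by (simp add: corr_def)

lemma word_ad_corr_aux: "word_ad x (corr_aux c (length w)) w = word_ad x (corr c) w"
  by (rule word_ad_cong) (simp add: corr_def)

lemma corr_ge: "n \<ge> -1 \<Longrightarrow> corr c (Vir_L n # w) = word_ad (Vir_L n) (corr c) w"
  by (simp add: corr_def[of _ "_ # _"] word_ad_corr_aux)

lemma corr_lt: "n < -1 \<Longrightarrow> corr c (Vir_L n # w) =
    (-1) ^ nat (- n) * (of_int (- n - 1) * [:0, 1:] * corr c w - word_ad (Vir_L (-1)) (corr c) w)"
  by (simp add: corr_def[of _ "_ # _"] word_ad_corr_aux) (simp add: corr_def)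

section \<open>Vanishing of \<open>corr\<close> on the commutation and vacuum relations\<close>

definition corr_rel :: "'k::field \<Rightarrow> vir_basis \<Rightarrow> vir_basis \<Rightarrow> vir_basis list \<Rightarrow> vir_basis list \<Rightarrow> 'k poly"
  where "corr_rel c x y u v = corr c (u @ x # y # v) - corr c (u @ y # x # v)
    - bracket_sum x y (\<lambda>b. corr c (u @ b # v))"

text \<open>ad z is a derivation, so applied to a relator it changes the prefix, the suffix or the
  two middle letters. The first two give relators again; for the third the Jacobi identity collects
  the terms.\<close>

lemma word_ad_corr_rel:
  assumes "\<And>u' v' x y. length u' = length u \<Longrightarrow> corr_rel c x y u' v' = 0"
  shows "word_ad z (corr c) (u @ x # y # v) - word_ad z (corr c) (u @ y # x # v)
    = bracket_sum x y (\<lambda>b. word_ad z (corr c) (u @ b # v))"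
proof -
  have rel: "corr c (u' @ x' # y' # v') - corr c (u' @ y' # x' # v') = bracket_sum x' y' (\<lambda>b. corr c (u' @ b # v'))"
    if "length u' = length u" for u' v' x' y'
    using assms[OF that, of x' y' v'] by (simp add: corr_rel_def)
  have u: "word_ad z (\<lambda>u'. corr c (u' @ x # y # v)) u - word_ad z (\<lambda>u'. corr c (u' @ y # x # v)) u
     = bracket_sum x y (\<lambda>b. word_ad z (\<lambda>u'. corr c (u' @ b # v)) u)"
    unfolding word_ad_bracket_sum[symmetric] word_ad_diff[symmetric]
    by (rule word_ad_cong) (rule rel)
  have v: "word_ad z (\<lambda>v'. corr c (u @ x # y # v')) v - word_ad z (\<lambda>v'. corr c (u @ y # x # v')) v
     = bracket_sum x y (\<lambda>b. word_ad z (\<lambda>v'. corr c (u @ b # v')) v)"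
    unfolding word_ad_bracket_sum[symmetric] word_ad_diff[symmetric]
    by (rule word_ad_cong) (simp add: rel)
  have "bracket_sum z x (\<lambda>b. corr c (u @ b # y # v)) - bracket_sum z x (\<lambda>b. corr c (u @ y # b # v))
      = bracket_sum z x (\<lambda>b. bracket_sum b y (\<lambda>b. corr c (u @ b # v)))"
    unfolding bracket_sum_diff[symmetric] rel[OF refl] ..
  moreover have "bracket_sum z y (\<lambda>b. corr c (u @ x # b # v)) - bracket_sum z y (\<lambda>b. corr c (u @ b # x # v))
      = bracket_sum z y (\<lambda>b. bracket_sum x b (\<lambda>b. corr c (u @ b # v)))"
    unfolding bracket_sum_diff[symmetric] rel[OF refl] ..
  moreover have "bracket_sum z y (\<lambda>b. bracket_sum x b h) + bracket_sum z x (\<lambda>b. bracket_sum b y h)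
     = bracket_sum x y (\<lambda>b. bracket_sum z b h)" for h :: "vir_basis \<Rightarrow> 'a poly"
    using bracket_sum_jacobi[of x y z h] by (simp add: algebra_simps)
  ultimately show ?thesis
    using u v by (simp add: word_ad_append bracket_sum_add algebra_simps)
qed

text \<open>Both sides agree term by term as long as m + n \<ge> -1. The remaining case is m = n =
  -1, where the bracket is zero.\<close>

lemma bracket_sum_corr_ge:
  assumes "m \<ge> -1" "n \<ge> -1"
  shows "bracket_sum (Vir_L m) (Vir_L n) (\<lambda>b. word_ad b (corr c) v)
    = bracket_sum (Vir_L m) (Vir_L n) (\<lambda>b. corr c (b # v))"
proof (cases "m + n \<ge> -1")
  case False
  with assms have "m = -1" "n = -1" by auto
  then show ?thesis using vir_cocycle_eq_0[of "-1" "-1", where 'k = 'a] by simp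
qed (simp add: vir_cocycle_eq_0[OF assms] corr_ge)

lemma corr_c_second: "corr c (y # Vir_c # v) = Polynomial.smult c (corr c (y # v))"
proof (cases y)
  case (Vir_L n)
  have "word_ad z (corr c) (Vir_c # v) = Polynomial.smult c (word_ad z (corr c) v)" for z
    by (simp add: word_ad_smult)
  then show ?thesis
    by (cases "n \<ge> -1") (simp_all add: Vir_L corr_ge corr_lt algebra_simps smult_diff_right)
qed simp

lemma smult_of_int: "Polynomial.smult (of_int k) f = of_int k * (f :: 'k::field poly)"
  by (simp add: of_int_poly)

text \<open>Both letters act through \<open>word_ad\<close>, so the relation is
  \<open>word_ad_commutator\<close>.\<close>

lemma corr_rel_Nil_ge_ge:
  assumes "m \<ge> -1" "n \<ge> -1"
  shows "corr_rel c (Vir_L m) (Vir_L n) [] v = 0"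
proof -
  let ?C = "\<lambda>b. corr c (b # v)"
  have "corr c (Vir_L a # Vir_L b # v) = bracket_sum (Vir_L a) (Vir_L b) ?C
     + word_ad (Vir_L a) (word_ad (Vir_L b) (corr c)) v" if "a \<ge> -1" "b \<ge> -1" for a b
    using that by (simp only: corr_ge word_ad.simps)
  then show ?thesis
    using word_ad_commutator[of "Vir_L m" "Vir_L n" "corr c" v] assms
      bracket_sum_corr_ge[of n m c v] bracket_sum_antisym[of "Vir_L n" "Vir_L m" ?C]
    by (simp add: corr_rel_def algebra_simps del: bracket_sum.simps word_ad.simps)
qed

text \<open>L(n) acts by a multiplication and by ad L(-1). When L(m) stands second, ad L(-1) also
  hits it; this extra [L(-1), L(m)] compensates the commutator of the two adjoint actions.\<close>

lemma corr_rel_Nil_ge_lt: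
  assumes m: "m \<ge> -1" and n: "n < -1"
  shows "corr_rel c (Vir_L m) (Vir_L n) [] v = 0"
proof -
  let ?C = "\<lambda>b. corr c (b # v)"
  define e f where "e = ((-1) ^ nat (- n) :: 'a poly)" and "f = (of_int (- n - 1) * [:0, 1:] :: 'a poly)"
  have n': "corr c (Vir_L n # w) = e * (f * corr c w - word_ad (Vir_L (-1)) (corr c) w)" for w
    using corr_lt[OF n] by (simp add: e_def f_def)
  have 1: "corr c (Vir_L m # Vir_L n # v) = bracket_sum (Vir_L m) (Vir_L n) ?C
     + e * (f * word_ad (Vir_L m) (corr c) v - word_ad (Vir_L m) (word_ad (Vir_L (-1)) (corr c)) v)"
    by (simp only: corr_ge[OF m] word_ad.simps n' word_ad_mult word_ad_diff)
  have 2: "corr c (Vir_L n # Vir_L m # v) = e * (f * word_ad (Vir_L m) (corr c) v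
     - (bracket_sum (Vir_L (-1)) (Vir_L m) ?C + word_ad (Vir_L (-1)) (word_ad (Vir_L m) (corr c)) v))"
    by (simp only: corr_ge[OF m] word_ad.simps n')
  have 3: "word_ad (Vir_L m) (word_ad (Vir_L (-1)) (corr c)) v
     = word_ad (Vir_L (-1)) (word_ad (Vir_L m) (corr c)) v + bracket_sum (Vir_L (-1)) (Vir_L m) ?C"
    using word_ad_commutator[of "Vir_L m" "Vir_L (-1)" "corr c" v] bracket_sum_corr_ge[of "-1" m c v] m
    by (simp del: bracket_sum.simps word_ad.simps add: algebra_simps)
  show ?thesis
    unfolding corr_rel_def append_Nil 1 2 3 by (simp del: bracket_sum.simps add: algebra_simps)
qed

text \<open>Both orders are expanded in \<open>A\<close>, \<open>B\<close>, \<open>D\<close>: the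
  value at \<open>v\<close> and its first and second derivative under ad L(-1). What remains is a
  polynomial identity in m, n and the indeterminate; m + n < 0 excludes a central term.\<close>

lemma corr_rel_Nil_lt_lt:
  assumes m: "m < -1" and n: "n < -1"
  shows "corr_rel c (Vir_L m) (Vir_L n) [] v = 0"
proof -
  define x :: "'a poly" where "x = [:0, 1:]"
  define e where "e k = ((-1) ^ nat (- k) :: 'a poly)" for k :: int
  define A where "A = corr c v"
  define B where "B = word_ad (Vir_L (-1)) (corr c) v"
  define D where "D = word_ad (Vir_L (-1)) (word_ad (Vir_L (-1)) (corr c)) v"
  have lt: "corr c (Vir_L k # w) = e k * (of_int (- k - 1) * x * corr c w - word_ad (Vir_L (-1)) (corr c) w)"
    if "k < -1" for k w
    using corr_lt[OF that] by (simp add: e_def x_def)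
  have e1: "e (k - 1) = - e k" if "k < -1" for k
  proof -
    have "nat (- (k - 1)) = Suc (nat (- k))" using that by simp
    then show ?thesis by (simp only: e_def power_Suc) simp
  qed
  have e2: "e (m + n) = e m * e n"
  proof -
    have "nat (- (m + n)) = nat (- m) + nat (- n)" using m n by simp
    then show ?thesis by (simp only: e_def power_add)
  qed
  have ad: "word_ad (Vir_L (-1)) (corr c) (Vir_L k # v)
      = of_int (- 1 - k) * (- e k * (of_int (- k) * x * A - B))
        + e k * (of_int (- k - 1) * x * B - D)" if "k < -1" for k
  proof -
    have "vir_cocycle (-1) k = (0 :: 'a)" using that by (simp add: vir_cocycle_def)
    moreover have "corr c (Vir_L (-1 + k) # v) = - e k * (of_int (- k) * x * A - B)"
      using lt[of "k - 1" v] e1[OF that] that by (simp add: A_def B_def)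
    moreover have "word_ad (Vir_L (-1)) (\<lambda>w. corr c (Vir_L k # w)) v = e k * (of_int (- k - 1) * x * B - D)"
      by (simp only: lt[OF that] word_ad_mult word_ad_diff B_def D_def)
    ultimately show ?thesis
      by (simp only: word_ad.simps bracket_sum.simps smult_of_int smult_0_left add_0_right)
  qed
  have *: "corr c (Vir_L a # Vir_L b # v) = e a * (of_int (- a - 1) * x * (e b * (of_int (- b - 1) * x * A - B))
      - (of_int (- 1 - b) * (- e b * (of_int (- b) * x * A - B)) + e b * (of_int (- b - 1) * x * B - D)))"
    if "a < -1" "b < -1" for a b
    unfolding lt[OF that(1)] ad[OF that(2)] lt[OF that(2)] by (simp only: A_def B_def)
  have br: "bracket_sum (Vir_L m) (Vir_L n) (\<lambda>b. corr c (b # v))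
      = of_int (m - n) * (e m * e n * (of_int (- (m + n) - 1) * x * A - B))"
  proof -
    have "vir_cocycle m n = (0 :: 'a)" using m n by (simp add: vir_cocycle_def)
    then show ?thesis using m n lt[of "m + n" v] e2
      by (simp add: smult_of_int A_def B_def del: of_int_diff of_int_add)
  qed
  show ?thesis
    unfolding corr_rel_def append_Nil *[OF m n] *[OF n m] br by (simp add: algebra_simps)
qed

lemma corr_rel_swap: "corr_rel c x y u v = - corr_rel c y x u v"
  using bracket_sum_antisym[of x y "\<lambda>b. corr c (u @ b # v)"] by (simp add: corr_rel_def)

lemma corr_rel_Nil: "corr_rel c x y [] v = 0"
proof (cases x)
  case Vir_c
  then show ?thesis by (simp add: corr_rel_def corr_c_second)
next
  case x: (Vir_L m)
  show ?thesis
  proof (cases y)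
    case Vir_c
    then show ?thesis by (simp add: corr_rel_def corr_c_second)
  next
    case y: (Vir_L n)
    show ?thesis
      using corr_rel_Nil_ge_ge[of m n c v] corr_rel_Nil_ge_lt[of m n c v] corr_rel_Nil_ge_lt[of n m c v]
        corr_rel_Nil_lt_lt[of m n c v] corr_rel_swap[of c x y "[]" v]
      unfolding x y by (metis linorder_not_less neg_equal_0_iff_equal)
  qed
qed

text \<open>The first letter of the prefix acts by scalars, by multiplication with the indeterminate
  and by \<open>word_ad\<close>. All of these respect relations with a shorter prefix.\<close>

lemma corr_rel_eq_0: "corr_rel c x y u v = 0"
proof (induction "length u" arbitrary: u v x y)
  case 0
  then show ?case by (simp add: corr_rel_Nil)
next
  case (Suc r)
  then obtain a w where u: "u = a # w" "length w = r" by (cases u) auto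
  have IH: "corr_rel c x y u' v' = 0" if "length u' = length w" for u' v' x y
    using Suc.hyps(1) that u by simp
  have 1: "corr c (w @ x # y # v) - corr c (w @ y # x # v) = bracket_sum x y (\<lambda>b. corr c (w @ b # v))"
    using IH[of w] by (simp add: corr_rel_def)
  have 2: "word_ad z (corr c) (w @ x # y # v) - word_ad z (corr c) (w @ y # x # v)
    = bracket_sum x y (\<lambda>b. word_ad z (corr c) (w @ b # v))" for z
    by (rule word_ad_corr_rel) (rule IH)
  show ?case
  proof (cases a)
    case Vir_c
    then show ?thesis unfolding corr_rel_def u
      by (simp add: bracket_sum_smult flip: 1 smult_diff_right)
  next
    case (Vir_L n)
    show ?thesis
    proof (cases "n \<ge> -1")
      case True
      then show ?thesis unfolding corr_rel_def u Vir_L append_Cons corr_ge[OF True] 2 by simp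
    next
      case False
      then have n: "n < -1" by simp
      have *: "e * (f * p1 - d1) - e * (f * p2 - d2) = e * (f * (p1 - p2) - (d1 - d2))"
        for e f p1 p2 d1 d2 :: "'a poly"
        by (simp add: algebra_simps)
      show ?thesis
        unfolding corr_rel_def u Vir_L append_Cons corr_lt[OF n] * 1 2 bracket_sum_mult bracket_sum_diff
        by (simp only: diff_self mult_zero_right)
    qed
  qed
qed

text \<open>Moving a first letter L(m) with m \<ge> -1 through the word only produces words of
  smaller length that still end in some L(k) with k \<ge> -1. The other letters reduce to this case
  through ad L(-1).\<close>

lemma corr_vacuum: "n \<ge> -1 \<Longrightarrow> corr c (w @ [Vir_L n]) = 0"
proof (induction "length w" arbitrary: w n)
  case 0
  then show ?case by (simp add: corr_ge)
next
  case (Suc r)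
  then obtain a w' where w: "w = a # w'" "length w' = r" by (cases w) auto
  have IH: "corr c (u @ [Vir_L k]) = 0" if "length u = length w'" "k \<ge> -1" for u k
    using Suc.hyps(1) that w by simp
  have *: "word_ad (Vir_L m) (corr c) (w' @ [Vir_L n]) = 0" if "m \<ge> -1" for m
  proof -
    have "word_ad (Vir_L m) (\<lambda>u. corr c (u @ [Vir_L n])) w' = word_ad (Vir_L m) (\<lambda>u. 0) w'"
      by (rule word_ad_cong) (simp add: IH Suc.prems)
    moreover have "bracket_sum (Vir_L m) (Vir_L n) (\<lambda>b. corr c (w' @ [b])) = 0"
    proof (cases "m + n \<ge> -1")
      case False
      with that Suc.prems have "m = n" by linarith
      then show ?thesis using vir_cocycle_eq_0[OF that Suc.prems, where 'k = 'a] by simp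
    qed (simp add: IH vir_cocycle_eq_0[OF that Suc.prems, where 'k = 'a])
    ultimately show ?thesis
      by (simp add: word_ad_append del: bracket_sum.simps)
  qed
  show ?case
  proof (cases a)
    case Vir_c
    then show ?thesis by (simp add: w IH Suc.prems)
  next
    case (Vir_L m)
    then show ?thesis using *[of m] *[of "-1"] IH[OF refl Suc.prems]
      by (cases "m \<ge> -1") (simp_all add: w corr_ge corr_lt)
  qed
qed

lemma corr_vacuum_c: "corr c (w @ [Vir_c]) = Polynomial.smult c (corr c w)"
proof (induction "length w" arbitrary: w)
  case (Suc r)
  then obtain a w' where w: "w = a # w'" "length w' = r" by (cases w) auto
  have *: "word_ad z (corr c) (w' @ [Vir_c]) = Polynomial.smult c (word_ad z (corr c) w')" for z
  proof -
    have "word_ad z (\<lambda>u. corr c (u @ [Vir_c])) w' = word_ad z (\<lambda>u. Polynomial.smult c (corr c u)) w'"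
      by (rule word_ad_cong) (simp add: Suc.hyps(1) w)
    then show ?thesis by (simp add: word_ad_append word_ad_smult)
  qed
  have IH: "corr c (w' @ [Vir_c]) = Polynomial.smult c (corr c w')"
    using Suc.hyps(1) w by simp
  show ?case
  proof (cases a)
    case Vir_c
    then show ?thesis by (simp add: w IH)
  next
    case (Vir_L m)
    then show ?thesis
      by (cases "m \<ge> -1") (simp_all add: w corr_ge corr_lt * IH algebra_simps smult_diff_right)
  qed
qed simp

section \<open>Vector spaces\<close>

lemma scalars_simps [simp]:
  "carrier scalars = UNIV"
  "add scalars = (+)"
  "monoid.mult scalars = (*)"
  "one scalars = 1"
  "zero scalars = (0 :: 'k::field)"
  by (simp_all add: ring_of_type_algebra_def fun_eq_iff)

lemma cring_scalars: "cring (scalars :: 'k::field ring)"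
  by (rule cring_from_type_algebra)

section \<open>Linear algebra over records: subspaces, sums of finite support, linear maps,
  quotients\<close>

locale vspace =
  fixes V :: "('k::field, 'v, 'z) module_scheme" (structure)
  assumes is_module: "module scalars V"
begin

sublocale module scalars V
  by (rule is_module)

lemma smult_closed' [simp, intro]: "x \<in> carrier V \<Longrightarrow> a \<odot> x \<in> carrier V"
  by (rule smult_closed) auto

lemma smult_add: "x \<in> carrier V \<Longrightarrow> (a + b) \<odot> x = a \<odot> x \<oplus> b \<odot> x"
  using smult_l_distr[of a b x] by simp

lemma smult_vadd: "x \<in> carrier V \<Longrightarrow> y \<in> carrier V \<Longrightarrow> a \<odot> (x \<oplus> y) = a \<odot> x \<oplus> a \<odot> y"
  using smult_r_distr[of a x y] by simp

lemma smult_smult: "x \<in> carrier V \<Longrightarrow> a \<odot> (b \<odot> x) = (a * b) \<odot> x"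
  using smult_assoc1[of a b x] by simp

lemma smult_1 [simp]: "x \<in> carrier V \<Longrightarrow> 1 \<odot> x = x"
  using smult_one[of x] by simp

lemma smult_0 [simp]: "x \<in> carrier V \<Longrightarrow> 0 \<odot> x = \<zero>"
  using smult_l_null[of x] by simp

lemma smult_zero [simp]: "a \<odot> \<zero> = \<zero>"
  using smult_r_null[of a] by simp

lemma smult_uminus: "x \<in> carrier V \<Longrightarrow> (- a) \<odot> x = \<ominus> (a \<odot> x)"
proof -
  assume x: "x \<in> carrier V"
  then have "(- a) \<odot> x \<oplus> a \<odot> x = \<zero>" by (simp flip: smult_add)
  with x show ?thesis by (simp add: M.minus_equality)
qed

lemma smult_minus_one: "x \<in> carrier V \<Longrightarrow> (- 1) \<odot> x = \<ominus> x"
  by (simp add: smult_uminus)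

lemma smult_vdiff: "x \<in> carrier V \<Longrightarrow> y \<in> carrier V \<Longrightarrow> a \<odot> (x \<ominus> y) = a \<odot> x \<ominus> a \<odot> y"
  using smult_vadd[of x "\<ominus> y" a] smult_r_minus[of a y] by (simp add: M.minus_eq)

lemma smult_eq_zeroD: "a \<odot> x = \<zero> \<Longrightarrow> a \<noteq> 0 \<Longrightarrow> x \<in> carrier V \<Longrightarrow> x = \<zero>"
  using smult_smult[of x "inverse a" a] by simp

lemma diff_self [simp]: "x \<in> carrier V \<Longrightarrow> x \<ominus> x = \<zero>"
  by (simp add: M.minus_eq M.r_neg)

lemma diff_add_cancel: "x \<in> carrier V \<Longrightarrow> y \<in> carrier V \<Longrightarrow> (x \<ominus> y) \<oplus> y = x"
  by (simp add: M.minus_eq M.a_assoc M.l_neg)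

lemma diff_eq_zeroD: "x \<ominus> y = \<zero> \<Longrightarrow> x \<in> carrier V \<Longrightarrow> y \<in> carrier V \<Longrightarrow> x = y"
  using diff_add_cancel[of x y] by simp

lemma eq_diff_iff:
  assumes "x \<in> carrier V" "y \<in> carrier V" "z \<in> carrier V"
  shows "x = y \<ominus> z \<longleftrightarrow> x \<oplus> z = y"
proof
  assume "x \<oplus> z = y"
  then show "x = y \<ominus> z" using assms by (auto simp: M.minus_eq M.a_assoc M.r_neg)
qed (use assms diff_add_cancel in auto)

subsection \<open>Subspaces\<close>

lemma is_subspaceI:
  assumes "N \<subseteq> carrier V" "\<zero> \<in> N"
    and "\<And>x y. x \<in> N \<Longrightarrow> y \<in> N \<Longrightarrow> x \<oplus> y \<in> N"
    and "\<And>a x. x \<in> N \<Longrightarrow> a \<odot> x \<in> N"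
  shows "is_subspace V N"
  using assms(1,2,3) assms(4)[of _ "- 1"] assms(4)
  by (intro submoduleI) (auto simp: smult_minus_one subset_iff)

lemma is_subspaceD:
  assumes "is_subspace V N"
  shows "N \<subseteq> carrier V" "\<zero> \<in> N"
    and "\<And>x y. x \<in> N \<Longrightarrow> y \<in> N \<Longrightarrow> x \<oplus> y \<in> N"
    and "\<And>a x. x \<in> N \<Longrightarrow> a \<odot> x \<in> N"
    and "\<And>x y. x \<in> N \<Longrightarrow> y \<in> N \<Longrightarrow> x \<ominus> y \<in> N"
    and "\<And>x. x \<in> N \<Longrightarrow> \<ominus> x \<in> N"
proof -
  show *: "N \<subseteq> carrier V" and add: "\<And>x y. x \<in> N \<Longrightarrow> y \<in> N \<Longrightarrow> x \<oplus> y \<in> N"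
    and "\<And>a x. x \<in> N \<Longrightarrow> a \<odot> x \<in> N" and neg: "\<And>x. x \<in> N \<Longrightarrow> \<ominus> x \<in> N"
    using submoduleE[OF assms] by auto
  show "\<zero> \<in> N"
    using subgroup.one_closed[OF submodule.axioms(1)[OF assms]] by simp
  show "\<And>x y. x \<in> N \<Longrightarrow> y \<in> N \<Longrightarrow> x \<ominus> y \<in> N"
    using add neg by (simp add: M.minus_eq)
qed

lemma is_subspace_carrier: "is_subspace V (carrier V)"
  by (rule is_subspaceI) auto

lemma is_subspace_Inter:
  assumes "\<And>N. N \<in> F \<Longrightarrow> is_subspace V N" "F \<noteq> {}"
  shows "is_subspace V (\<Inter>F)"
proof -
  have *: "N \<in> F \<Longrightarrow> N \<subseteq> carrier V" for N using is_subspaceD(1)[OF assms(1)] .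
  show ?thesis
    by (rule is_subspaceI) (use * assms(2) in \<open>auto intro: is_subspaceD[OF assms(1)]\<close>)
qed

lemma subspace_finsum_closed:
  assumes "is_subspace V N" "\<And>i. i \<in> A \<Longrightarrow> f i \<in> N"
  shows "(\<Oplus>i\<in>A. f i) \<in> N"
  using assms(2)
proof (induction A rule: infinite_finite_induct)
  case (insert i A)
  then have "f \<in> A \<rightarrow> carrier V" "f i \<in> carrier V" using is_subspaceD(1)[OF assms(1)] by auto
  with insert show ?case by (simp add: is_subspaceD(3)[OF assms(1)])
qed (auto simp: is_subspaceD(2)[OF assms(1)] M.finsum_infinite)

lemma is_subspace_lin_span: "S \<subseteq> carrier V \<Longrightarrow> is_subspace V (lin_span V S)"
  unfolding lin_span_def hull_def using is_subspace_carrier by (intro is_subspace_Inter) auto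

lemma lin_span_superset: "S \<subseteq> lin_span V S"
  unfolding lin_span_def by (rule hull_subset)

lemma lin_span_minimal: "S \<subseteq> N \<Longrightarrow> is_subspace V N \<Longrightarrow> lin_span V S \<subseteq> N"
  unfolding lin_span_def by (rule hull_minimal)

subsection \<open>Sums with finite support\<close>

lemma fsum_eq_finsum:
  assumes "finite A" "\<And>i. i \<notin> A \<Longrightarrow> f i = \<zero>" "\<And>i. i \<in> A \<Longrightarrow> f i \<in> carrier V"
  shows "fsum V f = (\<Oplus>i\<in>A. f i)"
  unfolding fsum_def
  by (rule M.add.finprod_mono_neutral_cong_left) (use assms in auto)

lemma fsum_in_subspace:
  assumes "is_subspace V N" "\<And>i. f i \<in> N"
  shows "fsum V f \<in> N"
  unfolding fsum_def using assms by (intro subspace_finsum_closed) auto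

lemma fsum_closed [simp]: "(\<And>i. f i \<in> carrier V) \<Longrightarrow> fsum V f \<in> carrier V"
  by (rule fsum_in_subspace) (auto intro: is_subspace_carrier)

lemma fsum_single:
  assumes "\<And>i. i \<noteq> j \<Longrightarrow> f i = \<zero>" "f j \<in> carrier V"
  shows "fsum V f = f j"
  using fsum_eq_finsum[of "{j}" f] assms by auto

lemma fsum_zero: "(\<And>i. f i = \<zero>) \<Longrightarrow> fsum V f = \<zero>"
  using fsum_eq_finsum[of "{}" f] by auto

lemma fsum_add:
  assumes "finite {i. f i \<noteq> \<zero>}" "finite {i. g i \<noteq> \<zero>}" "\<And>i. f i \<in> carrier V" "\<And>i. g i \<in> carrier V"
  shows "fsum V (\<lambda>i. f i \<oplus> g i) = fsum V f \<oplus> fsum V g"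
proof -
  define A where "A = {i. f i \<noteq> \<zero>} \<union> {i. g i \<noteq> \<zero>}"
  have "finite A" using assms by (simp add: A_def)
  then have "fsum V (\<lambda>i. f i \<oplus> g i) = (\<Oplus>i\<in>A. f i \<oplus> g i)" "fsum V f = (\<Oplus>i\<in>A. f i)" "fsum V g = (\<Oplus>i\<in>A. g i)"
    by (intro fsum_eq_finsum; use assms in \<open>auto simp: A_def\<close>)+
  then show ?thesis using assms by (simp add: M.finsum_addf)
qed

end

subsection \<open>Linear maps\<close>

locale vlinear = V: vspace V + W: vspace W
  for V :: "('k::field, 'v, 'y) module_scheme" (structure)
    and W :: "('k, 'w, 'z) module_scheme" +
  fixes h :: "'v \<Rightarrow> 'w"
  assumes map_closed [simp]: "x \<in> carrier V \<Longrightarrow> h x \<in> carrier W"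
    and map_add: "x \<in> carrier V \<Longrightarrow> y \<in> carrier V \<Longrightarrow> h (x \<oplus> y) = h x \<oplus>\<^bsub>W\<^esub> h y"
    and map_smult: "x \<in> carrier V \<Longrightarrow> h (a \<odot> x) = a \<odot>\<^bsub>W\<^esub> h x"
begin

lemma map_zero [simp]: "h \<zero> = \<zero>\<^bsub>W\<^esub>"
  using map_smult[of "\<zero>" 0] by simp

lemma map_diff: "x \<in> carrier V \<Longrightarrow> y \<in> carrier V \<Longrightarrow> h (x \<ominus> y) = h x \<ominus>\<^bsub>W\<^esub> h y"
  using map_add[of x "\<ominus> y"] map_smult[of y "- 1"]
  by (simp add: V.M.minus_eq W.M.minus_eq V.smult_minus_one W.smult_minus_one)

lemma map_finsum:
  assumes "\<And>i. i \<in> A \<Longrightarrow> f i \<in> carrier V"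
  shows "h (\<Oplus>i\<in>A. f i) = (\<Oplus>\<^bsub>W\<^esub>i\<in>A. h (f i))"
  using assms
proof (induction A rule: infinite_finite_induct)
  case (insert i A)
  then have "f \<in> A \<rightarrow> carrier V" "(\<lambda>i. h (f i)) \<in> A \<rightarrow> carrier W" by auto
  with insert show ?case by (simp add: map_add)
qed (auto simp: V.M.finsum_infinite W.M.finsum_infinite)

lemma map_fsum:
  assumes "finite {i. f i \<noteq> \<zero>}" "\<And>i. f i \<in> carrier V"
  shows "h (fsum V f) = fsum W (\<lambda>i. h (f i))"
proof -
  have "h (fsum V f) = (\<Oplus>\<^bsub>W\<^esub>i\<in>{i. f i \<noteq> \<zero>}. h (f i))"
    unfolding fsum_def by (rule map_finsum) (use assms in auto)
  also have "\<dots> = fsum W (\<lambda>i. h (f i))"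
    using assms by (intro W.fsum_eq_finsum[symmetric]) auto
  finally show ?thesis .
qed

end

locale poly_functional = vspace V
  for V :: "('k::field, 'v, 'z) module_scheme" (structure) +
  fixes h :: "'v \<Rightarrow> 'k poly"
  assumes fun_add: "x \<in> carrier V \<Longrightarrow> y \<in> carrier V \<Longrightarrow> h (x \<oplus> y) = h x + h y"
    and fun_smult: "x \<in> carrier V \<Longrightarrow> h (a \<odot> x) = Polynomial.smult a (h x)"
begin

lemma fun_zero [simp]: "h \<zero> = 0"
  using fun_smult[of "\<zero>" 0] by simp

lemma fun_diff: "x \<in> carrier V \<Longrightarrow> y \<in> carrier V \<Longrightarrow> h (x \<ominus> y) = h x - h y"
  using fun_add[of x "\<ominus> y"] fun_smult[of y "- 1"]
  by (simp add: M.minus_eq smult_minus_one)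

lemma fun_finsum:
  assumes "\<And>i. i \<in> A \<Longrightarrow> f i \<in> carrier V"
  shows "h (\<Oplus>i\<in>A. f i) = (\<Sum>i\<in>A. h (f i))"
  using assms
proof (induction A rule: infinite_finite_induct)
  case (insert i A)
  then have "f \<in> A \<rightarrow> carrier V" by auto
  with insert show ?case by (simp add: fun_add)
qed (auto simp: M.finsum_infinite)

lemma fun_fsum:
  assumes "finite A" "\<And>i. i \<notin> A \<Longrightarrow> f i = \<zero>" "\<And>i. f i \<in> carrier V"
  shows "h (fsum V f) = (\<Sum>i\<in>A. h (f i))"
  using fsum_eq_finsum[OF assms(1,2)] fun_finsum[of A f] assms by auto

end

subsection \<open>Quotients\<close>

locale quotient_vspace = vspace A
  for A :: "('k::field, 'v, 'z) module_scheme" (structure) +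
  fixes N :: "'v set"
  assumes subspace: "is_subspace A N"
begin

lemma N_closed: "x \<in> N \<Longrightarrow> x \<in> carrier A"
  using is_subspaceD(1)[OF subspace] by auto

sublocale N: abelian_subgroup N A
  by (rule abelian_subgroupI3)
    (use subspace in \<open>auto simp: submodule_def additive_subgroup_def M.abelian_group_axioms\<close>)

abbreviation Q where "Q \<equiv> quot_algebra A N"

lemma coset_eq_iff:
  assumes "x \<in> carrier A" "y \<in> carrier A"
  shows "N +> x = N +> y \<longleftrightarrow> x \<ominus> y \<in> N"
  using assms N.a_rcos_module[of y x] N.a_rcos_self[of x] N.a_repr_independence'[of x y]
  by (auto simp: M.minus_eq)

lemma in_coset: "x \<in> carrier A \<Longrightarrow> z \<in> N +> x \<Longrightarrow> z \<in> carrier A \<and> N +> z = N +> x"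
  using N.a_elemrcos_carrier N.a_repr_independence' by blast

lemma in_coset_self: "x \<in> carrier A \<Longrightarrow> x \<in> N +> x"
  by (rule N.a_rcos_self)

lemma coset_zero_iff: "x \<in> carrier A \<Longrightarrow> N +> x = N \<longleftrightarrow> x \<in> N"
  by (metis N.a_rcos_const in_coset_self)

lemma Q_carrier: "carrier Q = (\<lambda>x. N +> x) ` carrier A"
  by (auto simp: quot_algebra_def ring.defs module.defs FactRing_def A_RCOSETS_def')

lemma Q_add: "x \<in> carrier A \<Longrightarrow> y \<in> carrier A \<Longrightarrow> (N +> x) \<oplus>\<^bsub>Q\<^esub> (N +> y) = N +> (x \<oplus> y)"
  by (simp add: quot_algebra_def ring.defs module.defs FactRing_def N.a_rcos_sum)

lemma Q_zero: "\<zero>\<^bsub>Q\<^esub> = N"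
  by (simp add: quot_algebra_def ring.defs module.defs FactRing_def)

lemma Q_one: "\<one>\<^bsub>Q\<^esub> = N +> \<one>"
  by (simp add: quot_algebra_def ring.defs module.defs FactRing_def)

lemma Q_mult: "C \<otimes>\<^bsub>Q\<^esub> D = (\<Union>a\<in>C. \<Union>b\<in>D. N +> (a \<otimes> b))"
  by (simp add: quot_algebra_def ring.defs module.defs FactRing_def rcoset_mult_def)

lemma Q_smult:
  assumes "x \<in> carrier A"
  shows "a \<odot>\<^bsub>Q\<^esub> (N +> x) = N +> (a \<odot> x)"
proof -
  have "N +> (a \<odot> z) = N +> (a \<odot> x)" if z: "z \<in> N +> x" for z
  proof -
    have zc: "z \<in> carrier A" and "z \<ominus> x \<in> N"
      using in_coset[OF assms z] assms coset_eq_iff by auto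
    then have "a \<odot> z \<ominus> a \<odot> x \<in> N"
      using is_subspaceD(4)[OF subspace, of "z \<ominus> x" a] assms by (simp add: smult_vdiff)
    then show ?thesis using assms zc by (simp add: coset_eq_iff)
  qed
  then have "(\<Union>z\<in>N +> x. N +> (a \<odot> z)) = (\<Union>z\<in>N +> x. N +> (a \<odot> x))"
    by (intro SUP_cong) auto
  also have "\<dots> = N +> (a \<odot> x)" using in_coset_self[OF assms] by blast
  finally show ?thesis by (simp add: quot_algebra_def ring.defs module.defs FactRing_def)
qed

lemma vspace_Q: "vspace Q"
proof (rule vspace.intro, rule moduleI)
  show "cring scalars" by (rule cring_scalars)
  show "abelian_group Q"
  proof (rule abelian_groupI)
    fix C assume "C \<in> carrier Q"
    then obtain x where x: "x \<in> carrier A" "C = N +> x" by (auto simp: Q_carrier)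
    then have "(N +> (\<ominus> x)) \<oplus>\<^bsub>Q\<^esub> C = \<zero>\<^bsub>Q\<^esub>"
      using Q_add[of "\<ominus> x" x] by (simp add: M.l_neg Q_zero coset_zero_iff is_subspaceD(2)[OF subspace])
    with x show "\<exists>y\<in>carrier Q. y \<oplus>\<^bsub>Q\<^esub> C = \<zero>\<^bsub>Q\<^esub>" by (auto simp: Q_carrier)
    show "\<zero>\<^bsub>Q\<^esub> \<oplus>\<^bsub>Q\<^esub> C = C"
      using x Q_add[of "\<zero>" x] coset_zero_iff[of "\<zero>"] is_subspaceD(2)[OF subspace] by (simp add: Q_zero)
  next
    show "\<zero>\<^bsub>Q\<^esub> \<in> carrier Q"
      using coset_zero_iff[of "\<zero>"] is_subspaceD(2)[OF subspace] by (force simp: Q_carrier Q_zero)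
  qed (auto simp: Q_carrier Q_add M.a_ac)
qed (auto simp: Q_carrier Q_smult Q_add smult_add smult_vadd smult_smult)

sublocale Q: vspace Q
  by (rule vspace_Q)

lemma vlinear_coset: "vlinear A Q ((+>) N)"
  by unfold_locales (auto simp: Q_carrier Q_add Q_smult)

lemma Q_diff: "x \<in> carrier A \<Longrightarrow> y \<in> carrier A \<Longrightarrow> (N +> x) \<ominus>\<^bsub>Q\<^esub> (N +> y) = N +> (x \<ominus> y)"
  by (rule vlinear.map_diff[OF vlinear_coset, symmetric])

end

section \<open>The tensor algebra\<close>

lemma T_simps [simp]:
  "carrier tensor_algebra = {f. finite {w. f w \<noteq> 0}}"
  "one tensor_algebra = (\<lambda>w. if w = [] then 1 else 0)"
  "zero tensor_algebra = (\<lambda>w. 0)"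
  "add tensor_algebra f g = (\<lambda>w. f w + g w)"
  "module.smult tensor_algebra a f = (\<lambda>w. a * f w)"
  by (simp_all add: tensor_algebra_def)

text \<open>Summing over factorizations instead of cut positions makes associativity a reindexing of
  triples.\<close>

lemma T_mult: "monoid.mult tensor_algebra f g w = (\<Sum>(u, v)\<in>{(u, v). u @ v = w}. f u * g v)"
proof -
  have "(\<Sum>i\<le>length w. f (take i w) * g (drop i w)) = (\<Sum>(u, v)\<in>{(u, v). u @ v = w}. f u * g v)"
    by (rule sum.reindex_bij_witness[of _ "\<lambda>(u, v). length u" "\<lambda>i. (take i w, drop i w)"]) auto
  then show ?thesis by (simp add: tensor_algebra_def)
qed

lemma finite_splits [simp]: "finite {(u, v). u @ v = w}"
proof (rule finite_subset)
  show "{(u, v). u @ v = w} \<subseteq> (\<lambda>i. (take i w, drop i w)) ` {..length w}"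
  proof
    fix p assume "p \<in> {(u, v). u @ v = w}"
    then have "p = (take (length (fst p)) w, drop (length (fst p)) w)" "length (fst p) \<le> length w"
      by auto
    then show "p \<in> (\<lambda>i. (take i w, drop i w)) ` {..length w}" by blast
  qed
qed simp

lemma finite_splits' [simp]: "finite {p. fst p @ snd p = w}"
  using finite_splits[of w] by (simp add: case_prod_unfold)

lemma T_mult_support:
  "{w. monoid.mult tensor_algebra f g w \<noteq> 0} \<subseteq> (\<lambda>(u, v). u @ v) ` ({w. f w \<noteq> 0} \<times> {w. g w \<noteq> 0})"
proof
  fix w assume "w \<in> {w. monoid.mult tensor_algebra f g w \<noteq> 0}"
  then obtain u v where "u @ v = w" "f u * g v \<noteq> 0"
    unfolding T_mult by (force elim: sum.not_neutral_contains_not_neutral)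
  then show "w \<in> (\<lambda>(u, v). u @ v) ` ({w. f w \<noteq> 0} \<times> {w. g w \<noteq> 0})"
    by (intro image_eqI[of _ _ "(u, v)"]) auto
qed

lemma T_mult_closed:
  "finite {w. f w \<noteq> 0} \<Longrightarrow> finite {w. g w \<noteq> 0} \<Longrightarrow> finite {w. monoid.mult tensor_algebra f g w \<noteq> 0}"
  by (rule finite_subset[OF T_mult_support]) auto

lemma T_mult_assoc:
  "monoid.mult tensor_algebra (monoid.mult tensor_algebra f g) h
    = monoid.mult tensor_algebra f (monoid.mult tensor_algebra g (h :: ('b, 'k::field) tensor))"
proof
  fix w :: "'b list"
  have "monoid.mult tensor_algebra (monoid.mult tensor_algebra f g) h w
     = (\<Sum>(s, v)\<in>{(s, v). s @ v = w}. \<Sum>(a, b)\<in>{(a, b). a @ b = s}. f a * g b * h v)"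
    by (simp add: T_mult sum_distrib_right case_prod_unfold)
  also have "\<dots> = (\<Sum>((s, v), (a, b))\<in>(SIGMA (s, v):{(s, v). s @ v = w}. {(a, b). a @ b = s}). f a * g b * h v)"
    by (subst sum.Sigma[symmetric]) (auto simp: case_prod_unfold intro!: sum.cong)
  also have "\<dots> = (\<Sum>((a, s), (b, v))\<in>(SIGMA (a, s):{(a, s). a @ s = w}. {(b, v). b @ v = s}). f a * (g b * h v))"
    by (rule sum.reindex_bij_witness[of _ "\<lambda>((a, s), (b, v)). ((a @ b, v), (a, b))" "\<lambda>((s, v), (a, b)). ((a, b @ v), (b, v))"])
      (auto simp: mult.assoc)
  also have "\<dots> = (\<Sum>(a, s)\<in>{(a, s). a @ s = w}. \<Sum>(b, v)\<in>{(b, v). b @ v = s}. f a * (g b * h v))"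
    by (subst sum.Sigma[symmetric]) (auto simp: case_prod_unfold intro!: sum.cong)
  also have "\<dots> = monoid.mult tensor_algebra f (monoid.mult tensor_algebra g h) w"
    by (simp add: T_mult sum_distrib_left case_prod_unfold)
  finally show "monoid.mult tensor_algebra (monoid.mult tensor_algebra f g) h w
    = monoid.mult tensor_algebra f (monoid.mult tensor_algebra g h) w" .
qed

lemma T_mult_1_left: "monoid.mult tensor_algebra (\<lambda>w. if w = [] then 1 else 0) f = f"
proof
  fix w
  have "monoid.mult tensor_algebra (\<lambda>w. if w = [] then 1 else 0) f w = (\<Sum>(u, v)\<in>{([], w)}. f v)"
    unfolding T_mult by (subst sum.remove[of _ "([], w)"]) (auto intro!: sum.neutral split: if_splits)
  then show "monoid.mult tensor_algebra (\<lambda>w. if w = [] then 1 else 0) f w = f w" by simp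
qed

lemma T_mult_1_right: "monoid.mult tensor_algebra f (\<lambda>w. if w = [] then 1 else 0) = f"
proof
  fix w
  have "monoid.mult tensor_algebra f (\<lambda>w. if w = [] then 1 else 0) w = (\<Sum>(u, v)\<in>{(w, [])}. f u)"
    unfolding T_mult by (subst sum.remove[of _ "(w, [])"]) (auto intro!: sum.neutral split: if_splits)
  then show "monoid.mult tensor_algebra f (\<lambda>w. if w = [] then 1 else 0) w = f w" by simp
qed

lemma T_distrib_left: "monoid.mult tensor_algebra f (\<lambda>w. g w + h w)
    = (\<lambda>w. monoid.mult tensor_algebra f g w + monoid.mult tensor_algebra f h w)"
  by (rule ext) (simp add: T_mult case_prod_unfold distrib_left sum.distrib)

lemma T_distrib_right: "monoid.mult tensor_algebra (\<lambda>w. g w + h w) f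
    = (\<lambda>w. monoid.mult tensor_algebra g f w + monoid.mult tensor_algebra h f w)"
  by (rule ext) (simp add: T_mult case_prod_unfold distrib_right sum.distrib)

lemma T_mult_smult_left: "monoid.mult tensor_algebra (\<lambda>w. a * g w) f
    = (\<lambda>w. a * monoid.mult tensor_algebra g f w)"
  by (rule ext) (simp add: T_mult case_prod_unfold sum_distrib_left mult.assoc)

lemma T_mult_smult_right: "monoid.mult tensor_algebra f (\<lambda>w. a * g w)
    = (\<lambda>w. a * monoid.mult tensor_algebra f g w)"
  by (rule ext) (simp add: T_mult case_prod_unfold sum_distrib_left mult.left_commute)

lemma finite_support_add:
  "finite {w. f w \<noteq> 0} \<Longrightarrow> finite {w. g w \<noteq> 0} \<Longrightarrow> finite {w. f w + g w \<noteq> (0 :: 'k::field)}"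
  by (rule finite_subset[of _ "{w. f w \<noteq> 0} \<union> {w. g w \<noteq> 0}"]) auto

lemma finite_support_smult: "finite {w. f w \<noteq> 0} \<Longrightarrow> finite {w. a * f w \<noteq> (0 :: 'k::field)}"
  by (rule finite_subset[of _ "{w. f w \<noteq> 0}"]) auto

lemma T_abelian_group: "abelian_group (tensor_algebra :: ('k::field, ('b, 'k) tensor) module)"
proof (rule abelian_groupI)
  fix f :: "('b, 'k) tensor" assume "f \<in> carrier tensor_algebra"
  then show "\<exists>g\<in>carrier tensor_algebra. g \<oplus>\<^bsub>tensor_algebra\<^esub> f = \<zero>\<^bsub>tensor_algebra\<^esub>"
    by (intro bexI[of _ "\<lambda>w. - f w"]) auto
qed (auto simp: finite_support_add add_ac)

lemma T_ring: "ring (tensor_algebra :: ('k::field, ('b, 'k) tensor) module)"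
proof (rule ringI)
  show "Group.monoid (tensor_algebra :: ('k::field, ('b, 'k) tensor) module)"
    by (rule monoidI) (auto simp: T_mult_closed T_mult_assoc T_mult_1_left T_mult_1_right)
qed (auto simp: T_abelian_group T_distrib_left T_distrib_right)

lemma T_vspace: "vspace (tensor_algebra :: ('k::field, ('b, 'k) tensor) module)"
  by (rule vspace.intro, rule moduleI)
    (auto simp: cring_scalars T_abelian_group finite_support_smult algebra_simps)

lemma T_uminus:
  assumes "finite {w. f w \<noteq> (0 :: 'k::field)}"
  shows "\<ominus>\<^bsub>tensor_algebra\<^esub> f = (\<lambda>w. - f w)"
proof -
  interpret vspace "tensor_algebra :: ('k::field, ('b, 'k) tensor) module" by (rule T_vspace)
  from assms smult_minus_one[of f] show ?thesis by simp
qed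

lemma T_minus:
  assumes "finite {w. f w \<noteq> 0}" "finite {w. g w \<noteq> (0 :: 'k::field)}"
  shows "f \<ominus>\<^bsub>tensor_algebra\<^esub> g = (\<lambda>w. f w - g w)"
  using T_uminus[of g] assms by (simp add: a_minus_def)

definition word_tensor :: "'b list \<Rightarrow> ('b, 'k::field) tensor"
  where "word_tensor w = (\<lambda>u. if u = w then 1 else 0)"

lemma word_tensor_closed [simp]: "finite {u. word_tensor w u \<noteq> (0 :: 'k::field)}"
  by (rule finite_subset[of _ "{w}"]) (auto simp: word_tensor_def)

lemma one_eq_word_tensor: "(\<lambda>w. if w = [] then 1 else 0) = word_tensor []"
  by (simp add: word_tensor_def)

lemma word_tensor_mult:
  "monoid.mult tensor_algebra (word_tensor u) (word_tensor v) = (word_tensor (u @ v) :: ('b, 'k::field) tensor)"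
proof
  fix w
  have *: "(case p of (u', v') \<Rightarrow> word_tensor u u' * word_tensor v v') = (if p = (u, v) then 1 else 0 :: 'k)" for p
    by (auto simp: word_tensor_def split: prod.split)
  show "monoid.mult tensor_algebra (word_tensor u) (word_tensor v) w = (word_tensor (u @ v) w :: 'k)"
    unfolding T_mult * by (subst sum.delta) (auto simp: word_tensor_def)
qed

lemma gen_tensor_eq: "gen_tensor b = word_tensor [b]"
  by (auto simp: gen_tensor_def lin_tensor_def word_tensor_def fun_eq_iff split: list.split)

subsection \<open>Linear extension from words\<close>

definition lin_ext :: "('b list \<Rightarrow> 'k::field poly) \<Rightarrow> ('b, 'k) tensor \<Rightarrow> 'k poly"
  where "lin_ext h f = (\<Sum>w | f w \<noteq> 0. Polynomial.smult (f w) (h w))"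

lemma smult_sum_right: "Polynomial.smult a (sum f A) = (\<Sum>i\<in>A. Polynomial.smult a (f i))"
  by (induction A rule: infinite_finite_induct) (auto simp: smult_add_right)

lemma lin_ext_superset:
  "finite S \<Longrightarrow> {w. f w \<noteq> 0} \<subseteq> S \<Longrightarrow> lin_ext h f = (\<Sum>w\<in>S. Polynomial.smult (f w) (h w))"
  unfolding lin_ext_def by (rule sum.mono_neutral_left) auto

lemma lin_ext_add:
  assumes "finite {w. f w \<noteq> 0}" "finite {w. g w \<noteq> 0}"
  shows "lin_ext h (\<lambda>w. f w + g w) = lin_ext h f + lin_ext h g"
  using assms
  by (subst (1 2 3) lin_ext_superset[of "{w. f w \<noteq> 0} \<union> {w. g w \<noteq> 0}"])
    (auto simp: smult_add_left sum.distrib)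

lemma lin_ext_smult:
  assumes "finite {w. f w \<noteq> 0}"
  shows "lin_ext h (\<lambda>w. a * f w) = Polynomial.smult a (lin_ext h f)"
  using assms by (subst (1 2) lin_ext_superset[of "{w. f w \<noteq> 0}"]) (auto simp: smult_sum_right)

lemma lin_ext_diff:
  assumes "finite {w. f w \<noteq> 0}" "finite {w. g w \<noteq> 0}"
  shows "lin_ext h (\<lambda>w. f w - g w) = lin_ext h f - lin_ext h g"
  using lin_ext_add[of f "\<lambda>w. (- 1) * g w" h] lin_ext_smult[of g h "- 1"]
    finite_support_smult[of g "- 1"] assms by simp

lemma lin_ext_word_tensor [simp]: "lin_ext h (word_tensor w) = h w"
  by (subst lin_ext_superset[of "{w}"]) (auto simp: word_tensor_def)

lemma lin_ext_mult:
  assumes "finite {w. f w \<noteq> 0}" "finite {w. g w \<noteq> 0}"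
  shows "lin_ext h (monoid.mult tensor_algebra f g)
    = lin_ext (\<lambda>u. lin_ext (\<lambda>v. h (u @ v)) g) f"
proof -
  define S where "S = {w. f w \<noteq> 0} \<times> {w. g w \<noteq> 0}"
  have S: "finite S" using assms by (simp add: S_def)
  have m: "monoid.mult tensor_algebra f g w = (\<Sum>(u, v)\<in>{x \<in> S. (case x of (u, v) \<Rightarrow> u @ v) = w}. f u * g v)" for w
    unfolding T_mult by (rule sum.mono_neutral_right) (auto simp: S_def)
  have "lin_ext h (monoid.mult tensor_algebra f g)
     = (\<Sum>w\<in>(\<lambda>(u, v). u @ v) ` S. Polynomial.smult (monoid.mult tensor_algebra f g w) (h w))"
    using S T_mult_support[of f g] by (intro lin_ext_superset) (auto simp: S_def)
  also have "\<dots> = (\<Sum>w\<in>(\<lambda>(u, v). u @ v) ` S. \<Sum>x\<in>{x \<in> S. (case x of (u, v) \<Rightarrow> u @ v) = w}.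
      case x of (u, v) \<Rightarrow> Polynomial.smult (f u * g v) (h (u @ v)))"
    unfolding m smult_sum by (intro sum.cong refl) (auto simp: case_prod_unfold)
  also have "\<dots> = (\<Sum>(u, v)\<in>S. Polynomial.smult (f u * g v) (h (u @ v)))"
    by (rule sum.image_gen[OF S, symmetric])
  also have "\<dots> = (\<Sum>u | f u \<noteq> 0. \<Sum>v | g v \<noteq> 0. Polynomial.smult (f u * g v) (h (u @ v)))"
    unfolding S_def by (rule sum.cartesian_product[symmetric])
  also have "\<dots> = lin_ext (\<lambda>u. lin_ext (\<lambda>v. h (u @ v)) g) f"
    by (simp add: lin_ext_def smult_sum_right)
  finally show ?thesis .
qed

lemma tensor_induct [consumes 1, case_names zero add]:
  assumes "finite {w. f w \<noteq> (0 :: 'k::field)}"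
    and zero: "P (\<lambda>w. 0)"
    and add: "\<And>f a w. finite {w. f w \<noteq> 0} \<Longrightarrow> P f \<Longrightarrow> P (\<lambda>u. a * word_tensor w u + f u)"
  shows "P f"
  using assms(1)
proof (induction "card {w. f w \<noteq> 0}" arbitrary: f)
  case 0
  then have "f = (\<lambda>w. 0)" by (auto simp: fun_eq_iff)
  then show ?case using zero by simp
next
  case (Suc n)
  then obtain w where w: "f w \<noteq> 0" by (metis (mono_tags) card.empty empty_Collect_eq nat.distinct(1))
  define g where "g = f(w := 0)"
  have g: "{w. g w \<noteq> 0} = {w. f w \<noteq> 0} - {w}" by (auto simp: g_def)
  with Suc w have "P g" by (intro Suc.hyps) (auto)
  moreover have "f = (\<lambda>u. f w * word_tensor w u + g u)" by (auto simp: g_def word_tensor_def fun_eq_iff)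
  moreover have "finite {w. g w \<noteq> 0}" using Suc.prems g by simp
  ultimately show ?case using add by metis
qed

section \<open>The Virasoro module\<close>

locale vir_construction =
  fixes c :: "'k::field"
begin

abbreviation TT :: "('k, (vir_basis, 'k) tensor) module" where "TT \<equiv> tensor_algebra"
abbreviation II :: "(vir_basis, 'k) tensor set" where "II \<equiv> env_ideal vir_bracket"
abbreviation UU :: "('k, (vir_basis, 'k) tensor set) module" where "UU \<equiv> env_algebra vir_bracket"
abbreviation RR :: "(vir_basis, 'k) tensor set set" where "RR \<equiv> induced_relations vir_bracket vir_sub (vir_char c)"
abbreviation MM :: "('k, 'k vir_vec) module" where "MM \<equiv> vir_module c"

definition env_relators :: "(vir_basis, 'k) tensor set"
  where "env_relators = {gen_tensor x \<otimes>\<^bsub>TT\<^esub> gen_tensor y \<ominus>\<^bsub>TT\<^esub> gen_tensor y \<otimes>\<^bsub>TT\<^esub> gen_tensor x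
            \<ominus>\<^bsub>TT\<^esub> lin_tensor (vir_bracket x y) | x y. True}"

lemma lin_tensor_bracket:
  "lin_tensor (vir_bracket x y) = (case (x, y) of
    (Vir_L m, Vir_L n) \<Rightarrow> (\<lambda>w. of_int (m - n) * word_tensor [Vir_L (m + n)] w + vir_cocycle m n * word_tensor [Vir_c] w)
    | _ \<Rightarrow> (\<lambda>w. 0 :: 'k))"
proof -
  have br: "vir_bracket (Vir_L m) (Vir_L n) b
      = (case b of Vir_L k \<Rightarrow> if k = m + n then of_int (m - n) else 0 | Vir_c \<Rightarrow> (vir_cocycle m n :: 'k))" for m n b
    by (cases b) (auto simp: vir_cocycle_def)
  show ?thesis
  proof (cases "x = Vir_c \<or> y = Vir_c")
    case True
    then have "vir_bracket x y = (\<lambda>b. 0 :: 'k)" by (cases x; cases y; auto simp: fun_eq_iff)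
    with True show ?thesis by (cases x; cases y) (auto simp: lin_tensor_def fun_eq_iff split: list.split)
  next
    case False
    then obtain m n where [simp]: "x = Vir_L m" "y = Vir_L n" by (metis vir_basis.exhaust)
    show ?thesis
      by (rule ext) (simp add: lin_tensor_def word_tensor_def br del: vir_bracket.simps split: list.split vir_basis.split)
  qed
qed

lemma finite_lin_tensor_bracket: "finite {w. lin_tensor (vir_bracket x y) w \<noteq> (0 :: 'k)}"
proof (cases "x = Vir_c \<or> y = Vir_c")
  case True
  then show ?thesis unfolding lin_tensor_bracket by (cases x; cases y) simp_all
next
  case False
  then obtain m n where xy: "x = Vir_L m" "y = Vir_L n" by (metis vir_basis.exhaust)
  show ?thesis unfolding lin_tensor_bracket xy prod.case vir_basis.case
    by (intro finite_support_add finite_support_smult word_tensor_closed)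
qed

lemma finite_support_diff:
  "finite {w. f w \<noteq> 0} \<Longrightarrow> finite {w. g w \<noteq> 0} \<Longrightarrow> finite {w. f w - g w \<noteq> (0 :: 'b::field)}"
  by (rule finite_subset[of _ "{w. f w \<noteq> 0} \<union> {w. g w \<noteq> 0}"]) auto

lemma env_relators_eq: "gen_tensor x \<otimes>\<^bsub>TT\<^esub> gen_tensor y \<ominus>\<^bsub>TT\<^esub> gen_tensor y \<otimes>\<^bsub>TT\<^esub> gen_tensor x
            \<ominus>\<^bsub>TT\<^esub> lin_tensor (vir_bracket x y)
   = (\<lambda>w. word_tensor [x, y] w - word_tensor [y, x] w - lin_tensor (vir_bracket x y) w)"
proof -
  have 1: "word_tensor [x, y] \<ominus>\<^bsub>TT\<^esub> word_tensor [y, x] = (\<lambda>w. word_tensor [x, y] w - word_tensor [y, x] w)"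
    by (rule T_minus) (rule word_tensor_closed)+
  have 2: "(\<lambda>w. word_tensor [x, y] w - word_tensor [y, x] w) \<ominus>\<^bsub>TT\<^esub> lin_tensor (vir_bracket x y)
    = (\<lambda>w. word_tensor [x, y] w - word_tensor [y, x] w - lin_tensor (vir_bracket x y) w)"
    by (rule T_minus) (rule finite_support_diff word_tensor_closed finite_lin_tensor_bracket)+
  show ?thesis unfolding gen_tensor_eq word_tensor_mult append_Cons append_Nil 1 2 ..
qed

lemma env_relators_closed: "env_relators \<subseteq> carrier TT"
proof
  fix f assume "f \<in> env_relators"
  then obtain x y where f: "f = (\<lambda>w. word_tensor [x, y] w - word_tensor [y, x] w - lin_tensor (vir_bracket x y) w)"
    unfolding env_relators_def env_relators_eq by blast
  have "finite {w. f w \<noteq> 0}"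
    unfolding f by (rule finite_support_diff word_tensor_closed finite_lin_tensor_bracket)+
  then show "f \<in> carrier TT" by simp
qed

lemma II_eq: "II = Idl\<^bsub>TT\<^esub> env_relators"
  by (simp add: env_ideal_def env_relators_def Let_def)

lemma II_ideal: "ideal II TT"
  unfolding II_eq by (rule ring.genideal_ideal[OF T_ring env_relators_closed])

lemma II_subspace: "is_subspace TT II"
proof -
  interpret T: vspace TT by (rule T_vspace)
  interpret I: ideal II TT by (rule II_ideal)
  have "(\<lambda>w. a * f w) \<in> II" if "f \<in> II" for a f
  proof -
    \<comment> \<open>A scalar acts as left multiplication by a multiple of the unit, so a ring
      ideal is a subspace.\<close>
    have "(\<lambda>w. a * word_tensor [] w) \<otimes>\<^bsub>TT\<^esub> f \<in> II"
      using that finite_support_smult[OF word_tensor_closed] by (intro I.I_l_closed) auto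
    then show ?thesis by (simp only: T_mult_smult_left one_eq_word_tensor[symmetric] T_mult_1_left)
  qed
  then show ?thesis
    using I.a_subset I.a_closed I.zero_closed by (intro T.is_subspaceI) auto
qed

lemma UU_eq: "UU = quot_algebra TT II"
  by (simp add: env_algebra_def)

sublocale U: quotient_vspace TT II
  by (intro quotient_vspace.intro quotient_vspace_axioms.intro T_vspace II_subspace)

sublocale I: ideal II TT
  by (rule II_ideal)

abbreviation cls :: "(vir_basis, 'k) tensor \<Rightarrow> (vir_basis, 'k) tensor set"
  where "cls f \<equiv> II +>\<^bsub>TT\<^esub> f"

lemma UU_vspace: "vspace UU"
  unfolding UU_eq by (rule U.vspace_Q)

lemma UU_carrier: "carrier UU = cls ` carrier TT"
  unfolding UU_eq by (rule U.Q_carrier)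

lemma UU_mult: "f \<in> carrier TT \<Longrightarrow> g \<in> carrier TT \<Longrightarrow> cls f \<otimes>\<^bsub>UU\<^esub> cls g = cls (f \<otimes>\<^bsub>TT\<^esub> g)"
  using I.rcoset_mult_add unfolding UU_eq U.Q_mult rcoset_mult_def .

lemma env_gen_eq: "env_gen vir_bracket x = cls (word_tensor [x])"
  by (simp add: env_gen_def gen_tensor_eq)

lemma UU_mult_env_gen: "f \<in> carrier TT \<Longrightarrow> env_gen vir_bracket x \<otimes>\<^bsub>UU\<^esub> cls f = cls (word_tensor [x] \<otimes>\<^bsub>TT\<^esub> f)"
  unfolding env_gen_eq by (rule UU_mult) auto

definition relations :: "(vir_basis, 'k) tensor set set"
  where "relations = {u \<otimes>\<^bsub>UU\<^esub> env_gen vir_bracket x \<ominus>\<^bsub>UU\<^esub> vir_char c x \<odot>\<^bsub>UU\<^esub> u | u x. u \<in> carrier UU \<and> x \<in> vir_sub}"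

definition trel :: "(vir_basis, 'k) tensor \<Rightarrow> vir_basis \<Rightarrow> (vir_basis, 'k) tensor"
  where "trel f x = (\<lambda>w. (f \<otimes>\<^bsub>TT\<^esub> word_tensor [x]) w - vir_char c x * f w)"

lemma T_mult_closed': "f \<in> carrier TT \<Longrightarrow> g \<in> carrier TT \<Longrightarrow> f \<otimes>\<^bsub>TT\<^esub> g \<in> carrier TT"
  by (simp add: T_mult_closed)

lemma trel_closed: "f \<in> carrier TT \<Longrightarrow> trel f x \<in> carrier TT"
proof -
  assume "f \<in> carrier TT"
  then have "finite {w. (f \<otimes>\<^bsub>TT\<^esub> word_tensor [x]) w + (- vir_char c x) * f w \<noteq> 0}"
    by (intro finite_support_add finite_support_smult T_mult_closed word_tensor_closed) auto
  then show ?thesis by (simp add: trel_def)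
qed

lemma relations_eq: "relations = {cls (trel f x) | f x. f \<in> carrier TT \<and> x \<in> vir_sub}"
proof -
  have "cls f \<otimes>\<^bsub>UU\<^esub> env_gen vir_bracket x \<ominus>\<^bsub>UU\<^esub> vir_char c x \<odot>\<^bsub>UU\<^esub> cls f = cls (trel f x)"
    if f: "f \<in> carrier TT" for f x
  proof -
    have 1: "cls f \<otimes>\<^bsub>UU\<^esub> env_gen vir_bracket x = cls (f \<otimes>\<^bsub>TT\<^esub> word_tensor [x])"
      unfolding env_gen_eq using f by (intro UU_mult) auto
    have 2: "vir_char c x \<odot>\<^bsub>UU\<^esub> cls f = cls (vir_char c x \<odot>\<^bsub>TT\<^esub> f)"
      unfolding UU_eq by (rule U.Q_smult[OF f])
    have 3: "f \<otimes>\<^bsub>TT\<^esub> word_tensor [x] \<in> carrier TT" "vir_char c x \<odot>\<^bsub>TT\<^esub> f \<in> carrier TT"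
      using f by (auto simp: T_mult_closed finite_support_smult)
    have "f \<otimes>\<^bsub>TT\<^esub> word_tensor [x] \<ominus>\<^bsub>TT\<^esub> vir_char c x \<odot>\<^bsub>TT\<^esub> f = trel f x"
      unfolding trel_def using 3 by (subst T_minus) simp_all
    with U.Q_diff[OF 3] show ?thesis unfolding 1 2 unfolding UU_eq by simp
  qed
  note * = this
  show ?thesis
  proof (intro equalityI subsetI)
    fix z assume "z \<in> relations"
    then obtain u x where z: "z = u \<otimes>\<^bsub>UU\<^esub> env_gen vir_bracket x \<ominus>\<^bsub>UU\<^esub> vir_char c x \<odot>\<^bsub>UU\<^esub> u" "u \<in> carrier UU" "x \<in> vir_sub"
      unfolding relations_def by blast
    then obtain f where f: "f \<in> carrier TT" "u = cls f" unfolding UU_carrier by blast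
    show "z \<in> {cls (trel f x) | f x. f \<in> carrier TT \<and> x \<in> vir_sub}"
      using z(1,3) f *[OF f(1)] by blast
  next
    fix z assume "z \<in> {cls (trel f x) | f x. f \<in> carrier TT \<and> x \<in> vir_sub}"
    then obtain f x where f: "z = cls (trel f x)" "f \<in> carrier TT" "x \<in> vir_sub" by blast
    then show "z \<in> relations" unfolding relations_def f(1) *[OF f(2), symmetric] UU_carrier by blast
  qed
qed

lemma RR_eq: "RR = lin_span UU relations"
  by (simp add: induced_relations_def relations_def Let_def)

lemma relations_closed: "relations \<subseteq> carrier UU"
  using trel_closed unfolding relations_eq UU_carrier by blast

lemma RR_subspace: "is_subspace UU RR"
  unfolding RR_eq by (rule vspace.is_subspace_lin_span[OF UU_vspace relations_closed])

lemma MM_eq: "MM = quot_algebra UU RR"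
  by (simp add: vir_module_def induced_module_def)

sublocale M: quotient_vspace UU RR
  by (intro quotient_vspace.intro quotient_vspace_axioms.intro UU_vspace RR_subspace)

definition can :: "(vir_basis, 'k) tensor \<Rightarrow> 'k vir_vec"
  where "can f = RR +>\<^bsub>UU\<^esub> cls f"

lemma MM_vspace: "vspace MM"
  unfolding MM_eq by (rule M.vspace_Q)

lemma MM_carrier: "carrier MM = can ` carrier TT"
  unfolding MM_eq M.Q_carrier UU_carrier can_def by auto

lemma cls_closed: "f \<in> carrier TT \<Longrightarrow> cls f \<in> carrier UU"
  unfolding UU_carrier by blast

lemma cls_add: "f \<in> carrier TT \<Longrightarrow> g \<in> carrier TT \<Longrightarrow> cls (f \<oplus>\<^bsub>TT\<^esub> g) = cls f \<oplus>\<^bsub>UU\<^esub> cls g"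
  unfolding UU_eq by (rule U.Q_add[symmetric])

lemma cls_smult: "f \<in> carrier TT \<Longrightarrow> cls (a \<odot>\<^bsub>TT\<^esub> f) = a \<odot>\<^bsub>UU\<^esub> cls f"
  unfolding UU_eq by (rule U.Q_smult[symmetric])

lemma can_linear: "vlinear TT MM can"
proof -
  interpret M': vspace MM by (rule MM_vspace)
  show ?thesis
  proof (unfold_locales, goal_cases)
    case (1 f)
    then show ?case unfolding MM_carrier by blast
  next
    case (2 f g)
    then show ?case unfolding can_def MM_eq cls_add[OF 2] by (intro M.Q_add[symmetric] cls_closed)
  next
    case (3 f a)
    then show ?case unfolding can_def MM_eq cls_smult[OF 3] by (intro M.Q_smult[symmetric] cls_closed)
  qed
qed

lemma can_eq_0: "f \<in> II \<Longrightarrow> can f = \<zero>\<^bsub>MM\<^esub>"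
proof -
  assume f: "f \<in> II"
  then have "cls f = \<zero>\<^bsub>UU\<^esub>" using U.N_closed[OF f] U.coset_zero_iff[of f] by (simp add: UU_eq U.Q_zero)
  then have "cls f \<in> RR" using vspace.is_subspaceD(2)[OF UU_vspace RR_subspace] by simp
  then show ?thesis
    unfolding can_def MM_eq M.Q_zero using M.coset_zero_iff M.N_closed by blast
qed

lemma can_trel_eq_0: "f \<in> carrier TT \<Longrightarrow> x \<in> vir_sub \<Longrightarrow> can (trel f x) = \<zero>\<^bsub>MM\<^esub>"
proof -
  assume "f \<in> carrier TT" "x \<in> vir_sub"
  then have "cls (trel f x) \<in> relations" unfolding relations_eq by blast
  then have "cls (trel f x) \<in> RR" unfolding RR_eq using vspace.lin_span_superset[OF UU_vspace] by blast
  then show ?thesis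
    unfolding can_def MM_eq M.Q_zero using M.coset_zero_iff M.N_closed by blast
qed

lemma UU_left_mult_linear: "vlinear UU UU (\<lambda>u. env_gen vir_bracket x \<otimes>\<^bsub>UU\<^esub> u)"
proof -
  interpret U': vspace UU by (rule UU_vspace)
  have m: "word_tensor [x] \<otimes>\<^bsub>TT\<^esub> f \<in> carrier TT" if "f \<in> carrier TT" for f
    using that by (intro T_mult_closed') auto
  show ?thesis
  proof (unfold_locales, goal_cases)
    case (1 u)
    then obtain f where f: "f \<in> carrier TT" "u = cls f" unfolding UU_carrier by blast
    then show ?case using m cls_closed by (simp only: UU_mult_env_gen)
  next
    case (2 u v)
    then obtain f g where f: "f \<in> carrier TT" "u = cls f" and g: "g \<in> carrier TT" "v = cls g"
      unfolding UU_carrier by blast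
    have fg: "f \<oplus>\<^bsub>TT\<^esub> g \<in> carrier TT" using f g by (simp add: finite_support_add)
    have "word_tensor [x] \<otimes>\<^bsub>TT\<^esub> (f \<oplus>\<^bsub>TT\<^esub> g) = word_tensor [x] \<otimes>\<^bsub>TT\<^esub> f \<oplus>\<^bsub>TT\<^esub> word_tensor [x] \<otimes>\<^bsub>TT\<^esub> g"
      by (simp add: T_distrib_left)
    then show ?case
      unfolding f(2) g(2) cls_add[OF f(1) g(1), symmetric] UU_mult_env_gen[OF fg]
        UU_mult_env_gen[OF f(1)] UU_mult_env_gen[OF g(1)]
      using cls_add[OF m[OF f(1)] m[OF g(1)]] by simp
  next
    case (3 u a)
    then obtain f where f: "f \<in> carrier TT" "u = cls f" unfolding UU_carrier by blast
    have af: "a \<odot>\<^bsub>TT\<^esub> f \<in> carrier TT" using f by (simp add: finite_support_smult)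
    have "word_tensor [x] \<otimes>\<^bsub>TT\<^esub> (a \<odot>\<^bsub>TT\<^esub> f) = a \<odot>\<^bsub>TT\<^esub> (word_tensor [x] \<otimes>\<^bsub>TT\<^esub> f)"
      by (simp add: T_mult_smult_right)
    then show ?case
      unfolding f(2) cls_smult[OF f(1), symmetric] UU_mult_env_gen[OF af] UU_mult_env_gen[OF f(1)]
      using cls_smult[OF m[OF f(1)]] by simp
  qed
qed

text \<open>The relations multiply by elements of the subalgebra on the right, so left
  multiplication maps them to relations of the same kind. This makes the action on the quotient well
  defined.\<close>

lemma RR_left_closed: "u \<in> RR \<Longrightarrow> env_gen vir_bracket x \<otimes>\<^bsub>UU\<^esub> u \<in> RR"
proof -
  interpret vlinear UU UU "\<lambda>u. env_gen vir_bracket x \<otimes>\<^bsub>UU\<^esub> u" by (rule UU_left_mult_linear)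
  note R = M.is_subspaceD[OF RR_subspace]
  have "is_subspace UU {u \<in> carrier UU. env_gen vir_bracket x \<otimes>\<^bsub>UU\<^esub> u \<in> RR}"
    by (rule M.is_subspaceI) (auto simp: map_add map_smult R(2-4))
  moreover have "relations \<subseteq> {u \<in> carrier UU. env_gen vir_bracket x \<otimes>\<^bsub>UU\<^esub> u \<in> RR}"
  proof
    fix z assume z: "z \<in> relations"
    then obtain f y where f: "z = cls (trel f y)" "f \<in> carrier TT" "y \<in> vir_sub" unfolding relations_eq by blast
    have "word_tensor [x] \<otimes>\<^bsub>TT\<^esub> trel f y = trel (word_tensor [x] \<otimes>\<^bsub>TT\<^esub> f) y"
      using T_distrib_left[of "word_tensor [x]" "f \<otimes>\<^bsub>TT\<^esub> word_tensor [y]" "\<lambda>w. (- vir_char c y) * f w"]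
        T_mult_smult_right[of "word_tensor [x]" "- vir_char c y" f]
      by (simp add: trel_def T_mult_assoc)
    then have "env_gen vir_bracket x \<otimes>\<^bsub>UU\<^esub> z \<in> relations"
      unfolding f(1) UU_mult_env_gen[OF trel_closed[OF f(2)]]
      using f T_mult_closed'[of "word_tensor [x]" f] unfolding relations_eq by auto
    then show "z \<in> {u \<in> carrier UU. env_gen vir_bracket x \<otimes>\<^bsub>UU\<^esub> u \<in> RR}"
      using z relations_closed M.lin_span_superset[of relations] unfolding RR_eq by auto
  qed
  ultimately have "RR \<subseteq> {u \<in> carrier UU. env_gen vir_bracket x \<otimes>\<^bsub>UU\<^esub> u \<in> RR}"
    unfolding RR_eq by (intro M.lin_span_minimal)
  then show "u \<in> RR \<Longrightarrow> env_gen vir_bracket x \<otimes>\<^bsub>UU\<^esub> u \<in> RR" by blast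
qed

lemma action_can:
  assumes f: "f \<in> carrier TT"
  shows "induced_action vir_bracket vir_sub (vir_char c) x (can f) = can (word_tensor [x] \<otimes>\<^bsub>TT\<^esub> f)"
proof -
  interpret vlinear UU UU "\<lambda>u. env_gen vir_bracket x \<otimes>\<^bsub>UU\<^esub> u" by (rule UU_left_mult_linear)
  have eq: "RR +>\<^bsub>UU\<^esub> (env_gen vir_bracket x \<otimes>\<^bsub>UU\<^esub> u) = can (word_tensor [x] \<otimes>\<^bsub>TT\<^esub> f)"
    if u: "u \<in> can f" for u
  proof -
    have uc: "u \<in> carrier UU" and "u \<ominus>\<^bsub>UU\<^esub> cls f \<in> RR"
      using M.in_coset[of "cls f" u] u M.coset_eq_iff cls_closed[OF f] unfolding can_def by auto
    then have "env_gen vir_bracket x \<otimes>\<^bsub>UU\<^esub> u \<ominus>\<^bsub>UU\<^esub> env_gen vir_bracket x \<otimes>\<^bsub>UU\<^esub> cls f \<in> RR"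
      using RR_left_closed[of "u \<ominus>\<^bsub>UU\<^esub> cls f" x] map_diff[OF uc cls_closed[OF f]] by simp
    then show ?thesis
      unfolding can_def UU_mult_env_gen[OF f, symmetric]
      using M.coset_eq_iff map_closed uc cls_closed[OF f] by blast
  qed
  have "cls f \<in> can f" unfolding can_def by (rule M.in_coset_self[OF cls_closed[OF f]])
  then show ?thesis using eq unfolding induced_action_def Let_def by blast
qed

end

context vir_construction
begin

subsection \<open>Consequences for the action\<close>

abbreviation act :: "vir_basis \<Rightarrow> 'k vir_vec \<Rightarrow> 'k vir_vec"
  where "act x \<equiv> induced_action vir_bracket vir_sub (vir_char c) x"

abbreviation vac0 where "vac0 \<equiv> vir_vac c"

sublocale C: vlinear TT MM can
  by (rule can_linear)

lemma word_tensor_carrier [simp]: "word_tensor w \<in> carrier TT"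
  by simp

lemma vac0_eq: "vac0 = can (word_tensor [])"
proof -
  have "\<one>\<^bsub>UU\<^esub> = cls (word_tensor [])"
    by (simp add: UU_eq U.Q_one one_eq_word_tensor)
  then show ?thesis by (simp add: vir_vac_def MM_eq M.Q_one can_def)
qed

lemma left_mult_carrier: "f \<in> carrier TT \<Longrightarrow> word_tensor w \<otimes>\<^bsub>TT\<^esub> f \<in> carrier TT"
  by (intro T_mult_closed' word_tensor_carrier)

lemma act_linear: "vlinear MM MM (act x)"
proof (intro vlinear.intro vlinear_axioms.intro MM_vspace)
  fix v assume "v \<in> carrier MM"
  then obtain f where f: "f \<in> carrier TT" "v = can f" unfolding MM_carrier by blast
  then show "act x v \<in> carrier MM"
    using left_mult_carrier[OF f(1)] unfolding f(2) action_can[OF f(1)] MM_carrier by blast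
  fix a
  have af: "a \<odot>\<^bsub>TT\<^esub> f \<in> carrier TT" using f by (simp add: finite_support_smult)
  have "word_tensor [x] \<otimes>\<^bsub>TT\<^esub> (a \<odot>\<^bsub>TT\<^esub> f) = a \<odot>\<^bsub>TT\<^esub> (word_tensor [x] \<otimes>\<^bsub>TT\<^esub> f)"
    by (simp add: T_mult_smult_right)
  then show "act x (a \<odot>\<^bsub>MM\<^esub> v) = a \<odot>\<^bsub>MM\<^esub> act x v"
    unfolding f(2) C.map_smult[OF f(1), symmetric] action_can[OF af] action_can[OF f(1)]
    using C.map_smult[OF left_mult_carrier[OF f(1)]] by simp
next
  fix v u assume "v \<in> carrier MM" "u \<in> carrier MM"
  then obtain f g where f: "f \<in> carrier TT" "v = can f" and g: "g \<in> carrier TT" "u = can g"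
    unfolding MM_carrier by blast
  have fg: "f \<oplus>\<^bsub>TT\<^esub> g \<in> carrier TT" using f g by (simp add: finite_support_add)
  have "word_tensor [x] \<otimes>\<^bsub>TT\<^esub> (f \<oplus>\<^bsub>TT\<^esub> g) = word_tensor [x] \<otimes>\<^bsub>TT\<^esub> f \<oplus>\<^bsub>TT\<^esub> word_tensor [x] \<otimes>\<^bsub>TT\<^esub> g"
    by (simp add: T_distrib_left)
  then show "act x (v \<oplus>\<^bsub>MM\<^esub> u) = act x v \<oplus>\<^bsub>MM\<^esub> act x u"
    unfolding f(2) g(2) C.map_add[OF f(1) g(1), symmetric] action_can[OF fg] action_can[OF f(1)] action_can[OF g(1)]
    using C.map_add[OF left_mult_carrier[OF f(1)] left_mult_carrier[OF g(1)]] by simp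
qed

lemma act_word_tensor: "act x (can (word_tensor w)) = can (word_tensor (x # w))"
  by (simp only: action_can[OF word_tensor_carrier] word_tensor_mult append_Cons append_Nil)

lemma MM_induct [consumes 1, case_names vac add smult act]:
  assumes v: "v \<in> carrier MM"
    and vac: "P vac0"
    and add: "\<And>u v. u \<in> carrier MM \<Longrightarrow> v \<in> carrier MM \<Longrightarrow> P u \<Longrightarrow> P v \<Longrightarrow> P (u \<oplus>\<^bsub>MM\<^esub> v)"
    and smult: "\<And>a v. v \<in> carrier MM \<Longrightarrow> P v \<Longrightarrow> P (a \<odot>\<^bsub>MM\<^esub> v)"
    and act: "\<And>x v. v \<in> carrier MM \<Longrightarrow> P v \<Longrightarrow> P (act x v)"
  shows "P v"
proof -
  have zero: "P \<zero>\<^bsub>MM\<^esub>"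
    using smult[OF C.map_closed[OF word_tensor_carrier[of "[]"]], of 0] vac by (simp add: vac0_eq)
  have w: "P (can (word_tensor w))" for w
  proof (induction w)
    case Nil
    then show ?case using vac by (simp add: vac0_eq)
  next
    case (Cons x w)
    then show ?case using act[of "can (word_tensor w)" x] by (simp add: act_word_tensor del: T_simps)
  qed
  obtain f where f: "f \<in> carrier TT" "v = can f" using v unfolding MM_carrier by blast
  then have "finite {w. f w \<noteq> 0}" by simp
  then have "P (can f)"
  proof (induction f rule: tensor_induct)
    case zero
    have "can (\<lambda>w. 0) = \<zero>\<^bsub>MM\<^esub>" using C.map_zero by simp
    with \<open>P \<zero>\<^bsub>MM\<^esub>\<close> show ?case by simp
  next
    case (add f a w)
    then have f: "f \<in> carrier TT" by simp
    have "(\<lambda>u. a * word_tensor w u + f u) = (a \<odot>\<^bsub>TT\<^esub> word_tensor w) \<oplus>\<^bsub>TT\<^esub> f" by simp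
    moreover have "can ((a \<odot>\<^bsub>TT\<^esub> word_tensor w) \<oplus>\<^bsub>TT\<^esub> f) = a \<odot>\<^bsub>MM\<^esub> can (word_tensor w) \<oplus>\<^bsub>MM\<^esub> can f"
      by (simp only: C.map_add C.map_smult U.smult_closed' f word_tensor_carrier)
    ultimately show ?case
      using w[of w] \<open>P (can f)\<close> smult \<open>\<And>u v. u \<in> carrier MM \<Longrightarrow> v \<in> carrier MM \<Longrightarrow> P u \<Longrightarrow> P v \<Longrightarrow> P (u \<oplus>\<^bsub>MM\<^esub> v)\<close>
        C.map_closed[OF f] C.map_closed[OF word_tensor_carrier[of w]] C.W.smult_closed'
      by (simp del: T_simps)
  qed
  then show ?thesis by (simp add: f)
qed

lemma act_bracket:
  assumes "v \<in> carrier MM"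
  shows "act x (act y v) \<ominus>\<^bsub>MM\<^esub> act y (act x v) =
    (case (x, y) of (Vir_L m, Vir_L n) \<Rightarrow> of_int (m - n) \<odot>\<^bsub>MM\<^esub> act (Vir_L (m + n)) v
        \<oplus>\<^bsub>MM\<^esub> vir_cocycle m n \<odot>\<^bsub>MM\<^esub> act Vir_c v | _ \<Rightarrow> \<zero>\<^bsub>MM\<^esub>)"
proof -
  obtain f where f: "f \<in> carrier TT" "v = can f" using assms unfolding MM_carrier by blast
  define l where "l = (lin_tensor (vir_bracket x y) :: (vir_basis, 'k) tensor)"
  define r where "r = (\<lambda>w. word_tensor [x, y] w - word_tensor [y, x] w - l w)"
  have l: "l \<in> carrier TT" using finite_lin_tensor_bracket by (simp add: l_def)
  have "r \<in> env_relators" unfolding r_def l_def env_relators_def env_relators_eq by blast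
  then have "r \<in> II" unfolding II_eq using ring.genideal_self[OF T_ring env_relators_closed] by blast
  then have z: "can (r \<otimes>\<^bsub>TT\<^esub> f) = \<zero>\<^bsub>MM\<^esub>" using f by (intro can_eq_0 I.I_r_closed)
  have r: "r \<otimes>\<^bsub>TT\<^esub> f = ((word_tensor [x, y] \<otimes>\<^bsub>TT\<^esub> f) \<ominus>\<^bsub>TT\<^esub> (word_tensor [y, x] \<otimes>\<^bsub>TT\<^esub> f)) \<ominus>\<^bsub>TT\<^esub> (l \<otimes>\<^bsub>TT\<^esub> f)"
  proof -
    have d: "(\<lambda>w. g w - h w) \<otimes>\<^bsub>TT\<^esub> f = (g \<otimes>\<^bsub>TT\<^esub> f) \<ominus>\<^bsub>TT\<^esub> (h \<otimes>\<^bsub>TT\<^esub> f)"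
      if "g \<in> carrier TT" "h \<in> carrier TT" for g h
    proof -
      have "(\<lambda>w. g w - h w) \<otimes>\<^bsub>TT\<^esub> f = (\<lambda>w. (g \<otimes>\<^bsub>TT\<^esub> f) w - (h \<otimes>\<^bsub>TT\<^esub> f) w)"
        using T_distrib_right[of g "\<lambda>w. (- 1) * h w" f] T_mult_smult_left[of "- 1" h f] by simp
      also have "\<dots> = (g \<otimes>\<^bsub>TT\<^esub> f) \<ominus>\<^bsub>TT\<^esub> (h \<otimes>\<^bsub>TT\<^esub> f)"
        using that f T_mult_closed' by (intro T_minus[symmetric]) (auto simp: T_mult_closed)
      finally show ?thesis .
    qed
    have "(\<lambda>w. word_tensor [x, y] w - word_tensor [y, x] w) \<in> carrier TT"
      unfolding T_simps by (rule CollectI, rule finite_support_diff[OF word_tensor_closed word_tensor_closed])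
    from d[OF this l] d[of "word_tensor [x, y]" "word_tensor [y, x]"] show ?thesis by (simp add: r_def del: T_simps)
  qed
  have w: "can (word_tensor [x, y] \<otimes>\<^bsub>TT\<^esub> f) = act x (act y v)" for x y
    unfolding f(2) action_can[OF f(1)] action_can[OF left_mult_carrier[OF f(1)]]
    by (simp only: T_mult_assoc[symmetric] word_tensor_mult append_Cons append_Nil)
  have lf: "l \<otimes>\<^bsub>TT\<^esub> f \<in> carrier TT" by (rule T_mult_closed'[OF l f(1)])
  have e: "can (r \<otimes>\<^bsub>TT\<^esub> f) = (act x (act y v) \<ominus>\<^bsub>MM\<^esub> act y (act x v)) \<ominus>\<^bsub>MM\<^esub> can (l \<otimes>\<^bsub>TT\<^esub> f)"
    unfolding r w[symmetric] using left_mult_carrier[OF f(1)] lf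
    by (simp only: C.map_diff U.M.minus_closed)
  have d: "act x (act y v) \<ominus>\<^bsub>MM\<^esub> act y (act x v) \<in> carrier MM"
    unfolding w[symmetric] using left_mult_carrier[OF f(1)] by (intro C.W.M.minus_closed C.map_closed)
  have *: "act x (act y v) \<ominus>\<^bsub>MM\<^esub> act y (act x v) = can (l \<otimes>\<^bsub>TT\<^esub> f)"
    by (rule C.W.diff_eq_zeroD[OF _ d C.map_closed[OF lf]]) (simp only: e[symmetric] z)
  show ?thesis
  proof (cases "x = Vir_c \<or> y = Vir_c")
    case True
    then have "l = (\<lambda>w. 0)" unfolding l_def lin_tensor_bracket by (cases x; cases y) simp_all
    then have "l \<otimes>\<^bsub>TT\<^esub> f = (\<lambda>w. 0)" by (simp add: T_mult fun_eq_iff)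
    then have "can (l \<otimes>\<^bsub>TT\<^esub> f) = \<zero>\<^bsub>MM\<^esub>" using C.map_zero by simp
    with True show ?thesis unfolding * by (cases x; cases y) simp_all
  next
    case False
    then obtain m n where xy: "x = Vir_L m" "y = Vir_L n" by (metis vir_basis.exhaust)
    have lf_eq: "l \<otimes>\<^bsub>TT\<^esub> f = (of_int (m - n) \<odot>\<^bsub>TT\<^esub> (word_tensor [Vir_L (m + n)] \<otimes>\<^bsub>TT\<^esub> f))
        \<oplus>\<^bsub>TT\<^esub> (vir_cocycle m n \<odot>\<^bsub>TT\<^esub> (word_tensor [Vir_c] \<otimes>\<^bsub>TT\<^esub> f))"
      unfolding l_def lin_tensor_bracket xy prod.case vir_basis.case T_distrib_right T_mult_smult_left
      by simp
    have actv: "act z v = can (word_tensor [z] \<otimes>\<^bsub>TT\<^esub> f)" for z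
      unfolding f(2) by (rule action_can[OF f(1)])
    show ?thesis
      unfolding * lf_eq unfolding xy prod.case vir_basis.case actv
      by (simp only: C.map_add C.map_smult U.smult_closed' left_mult_carrier[OF f(1)])
  qed
qed

lemma act_c: "v \<in> carrier MM \<Longrightarrow> act Vir_c v = c \<odot>\<^bsub>MM\<^esub> v"
proof (induction v rule: MM_induct)
  case vac
  have t: "trel (word_tensor []) Vir_c = word_tensor [Vir_c] \<ominus>\<^bsub>TT\<^esub> c \<odot>\<^bsub>TT\<^esub> word_tensor []"
    by (subst T_minus) (simp_all add: trel_def word_tensor_mult vir_char_def finite_support_smult)
  have 1: "can (trel (word_tensor []) Vir_c) = \<zero>\<^bsub>MM\<^esub>"
    by (rule can_trel_eq_0) (auto simp: vir_sub_def)
  have 2: "can (trel (word_tensor []) Vir_c) = can (word_tensor [Vir_c]) \<ominus>\<^bsub>MM\<^esub> c \<odot>\<^bsub>MM\<^esub> can (word_tensor [])"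
    unfolding t by (simp only: C.map_diff C.map_smult U.smult_closed' word_tensor_carrier)
  show ?case
    unfolding vac0_eq act_word_tensor
    by (rule C.W.diff_eq_zeroD) (simp only: 1 2[symmetric], (intro C.map_closed C.W.smult_closed' word_tensor_carrier)+)
next
  case (add u v)
  interpret A: vlinear MM MM "act Vir_c" by (rule act_linear)
  from add show ?case by (simp add: A.map_add C.W.smult_vadd)
next
  case (smult a v)
  interpret A: vlinear MM MM "act Vir_c" by (rule act_linear)
  from smult show ?case by (simp add: A.map_smult C.W.smult_smult mult.commute)
next
  case (act x v)
  interpret A: vlinear MM MM "act x" by (rule act_linear)
  interpret B: vlinear MM MM "act Vir_c" by (rule act_linear)
  have "act Vir_c (act x v) \<ominus>\<^bsub>MM\<^esub> act x (act Vir_c v) = \<zero>\<^bsub>MM\<^esub>"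
    using act_bracket[OF act(1), of Vir_c x] by (cases x) simp_all
  then have "act Vir_c (act x v) = act x (act Vir_c v)"
    by (rule C.W.diff_eq_zeroD) (intro A.map_closed B.map_closed act(1))+
  with act show ?case by (simp add: A.map_smult)
qed

subsection \<open>The functional induced by \<open>corr\<close>\<close>

lemma lin_ext_swap:
  assumes "finite {w. f w \<noteq> 0}" "finite {w. g w \<noteq> 0}"
  shows "lin_ext (\<lambda>u. lin_ext (\<lambda>v. h u v) g) f = lin_ext (\<lambda>v. lin_ext (\<lambda>u. h u v) f) (g :: (vir_basis, 'k) tensor)"
  unfolding lin_ext_def smult_sum_right by (subst sum.swap) (simp add: mult.commute)

lemma lin_ext_zero: "(\<And>w. h w = 0) \<Longrightarrow> lin_ext h f = 0"
  by (simp add: lin_ext_def)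

lemma lin_ext_bracket:
  fixes h :: "vir_basis list \<Rightarrow> 'k poly"
  shows "lin_ext h (lin_tensor (vir_bracket x y)) = bracket_sum x y (\<lambda>b. h [b])"
proof (cases "x = Vir_c \<or> y = Vir_c")
  case True
  then have "lin_tensor (vir_bracket x y) = (\<lambda>w. 0 :: 'k)"
    unfolding lin_tensor_bracket by (cases x; cases y) simp_all
  moreover have "bracket_sum x y (\<lambda>b. h [b]) = 0" using True by (cases x; cases y) simp_all
  ultimately show ?thesis by (simp add: lin_ext_def)
next
  case False
  then obtain m n where xy: "x = Vir_L m" "y = Vir_L n" by (metis vir_basis.exhaust)
  show ?thesis
    unfolding lin_tensor_bracket xy prod.case vir_basis.case bracket_sum.simps
    by (subst lin_ext_add) (rule finite_support_smult word_tensor_closed | simp only: lin_ext_smult word_tensor_closed lin_ext_word_tensor)+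
qed

lemma lin_ext_corr_relator:
  "lin_ext (\<lambda>w. corr c (u @ w @ v)) (\<lambda>w. word_tensor [x, y] w - word_tensor [y, x] w - lin_tensor (vir_bracket x y) w) = 0"
proof -
  have "lin_ext h (\<lambda>w. word_tensor [x, y] w - word_tensor [y, x] w - lin_tensor (vir_bracket x y) w)
     = h [x, y] - h [y, x] - bracket_sum x y (\<lambda>b. h [b])" for h :: "vir_basis list \<Rightarrow> 'k poly"
    by (subst lin_ext_diff, rule finite_support_diff[OF word_tensor_closed word_tensor_closed],
        rule finite_lin_tensor_bracket, subst lin_ext_diff, rule word_tensor_closed, rule word_tensor_closed)
      (simp only: lin_ext_word_tensor lin_ext_bracket)
  then show ?thesis using corr_rel_eq_0[of c x y u v] by (simp add: corr_rel_def)
qed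

text \<open>The largest two-sided ideal in the kernel of the functional. The contexts
  \<open>u\<close> and \<open>v\<close> are what makes it an ideal.\<close>

definition corr_ideal :: "(vir_basis, 'k) tensor set"
  where "corr_ideal = {f \<in> carrier TT. \<forall>u v. lin_ext (\<lambda>w. corr c (u @ w @ v)) f = 0}"

lemma corr_ideal: "ideal corr_ideal TT"
proof (rule idealI[OF T_ring])
  show "subgroup corr_ideal (add_monoid TT)"
  proof (rule group.subgroupI)
    show "group (add_monoid TT)" by (rule U.M.a_group)
    have "(\<lambda>w. 0) \<in> corr_ideal" by (simp add: corr_ideal_def lin_ext_def)
    then show "corr_ideal \<noteq> {}" by blast
  next
    fix f assume f: "f \<in> corr_ideal"
    then have fin: "finite {w. f w \<noteq> 0}" by (simp add: corr_ideal_def)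
    have "inv\<^bsub>add_monoid TT\<^esub> f = (\<lambda>w. (- 1) * f w)"
      using T_uminus[OF fin] by (simp add: a_inv_def)
    moreover have "(\<lambda>w. (- 1) * f w) \<in> corr_ideal"
      using f fin finite_support_smult[OF fin, of "- 1"] unfolding corr_ideal_def
      by (auto simp: lin_ext_smult[OF fin, of _ "- 1", simplified])
    ultimately show "inv\<^bsub>add_monoid TT\<^esub> f \<in> corr_ideal" by simp
  qed (auto simp: corr_ideal_def lin_ext_add finite_support_add)
next
  fix f g assume f: "f \<in> corr_ideal" and g: "g \<in> carrier TT"
  then have fin: "finite {w. f w \<noteq> 0}" "finite {w. g w \<noteq> 0}" by (auto simp: corr_ideal_def)
  have f0: "lin_ext (\<lambda>w. corr c (u @ w @ v)) f = 0" for u v using f by (simp add: corr_ideal_def)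
  have "lin_ext (\<lambda>w. corr c (u @ w @ v)) (g \<otimes>\<^bsub>TT\<^esub> f) = 0" for u v
    unfolding lin_ext_mult[OF fin(2,1)]
  proof (rule lin_ext_zero)
    fix a show "lin_ext (\<lambda>b. corr c (u @ (a @ b) @ v)) f = 0" using f0[of "u @ a" v] by simp
  qed
  moreover have "lin_ext (\<lambda>w. corr c (u @ w @ v)) (f \<otimes>\<^bsub>TT\<^esub> g) = 0" for u v
    unfolding lin_ext_mult[OF fin] lin_ext_swap[OF fin]
  proof (rule lin_ext_zero)
    fix b show "lin_ext (\<lambda>a. corr c (u @ (a @ b) @ v)) f = 0" using f0[of u "b @ v"] by simp
  qed
  ultimately show "g \<otimes>\<^bsub>TT\<^esub> f \<in> corr_ideal" "f \<otimes>\<^bsub>TT\<^esub> g \<in> corr_ideal"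
    using fin by (auto simp: corr_ideal_def T_mult_closed)
qed

lemma corr_II: "f \<in> II \<Longrightarrow> lin_ext (corr c) f = 0"
proof -
  have "env_relators \<subseteq> corr_ideal"
    using lin_ext_corr_relator env_relators_closed
    unfolding env_relators_def env_relators_eq corr_ideal_def by blast
  then have "II \<subseteq> corr_ideal" unfolding II_eq by (rule ring.genideal_minimal[OF T_ring corr_ideal])
  then show "f \<in> II \<Longrightarrow> lin_ext (corr c) f = 0"
    unfolding corr_ideal_def by (auto dest!: subsetD elim!: allE[of _ "[]"])
qed

lemma corr_trel:
  assumes f: "f \<in> carrier TT" and x: "x \<in> vir_sub"
  shows "lin_ext (corr c) (trel f x) = 0"
proof -
  have fin: "finite {w. f w \<noteq> 0}" using f by simp
  have "lin_ext (corr c) (trel f x) = lin_ext (corr c) (f \<otimes>\<^bsub>TT\<^esub> word_tensor [x]) - Polynomial.smult (vir_char c x) (lin_ext (corr c) f)"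
    unfolding trel_def
    by (simp only: lin_ext_diff[OF T_mult_closed[OF fin word_tensor_closed] finite_support_smult[OF fin]] lin_ext_smult[OF fin])
  also have "lin_ext (corr c) (f \<otimes>\<^bsub>TT\<^esub> word_tensor [x]) = lin_ext (\<lambda>u. corr c (u @ [x])) f"
    by (simp only: lin_ext_mult[OF fin word_tensor_closed] lin_ext_word_tensor)
  also have "(\<lambda>u. corr c (u @ [x])) = (\<lambda>u. Polynomial.smult (vir_char c x) (corr c u))"
    using x by (auto simp: vir_sub_def vir_char_def corr_vacuum corr_vacuum_c)
  also have "lin_ext \<dots> f = Polynomial.smult (vir_char c x) (lin_ext (corr c) f)"
    by (simp add: lin_ext_def smult_sum_right mult.commute)
  finally show ?thesis by simp
qed

text \<open>The functional must pass through two quotients. \<open>K\<close> is the image of its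
  kernel in the enveloping algebra; it contains the induced relations, and lifting back from
  \<open>K\<close> costs only an element of the ideal, on which the functional vanishes too.\<close>

lemma can_eq_imp_corr_eq:
  assumes f: "f \<in> carrier TT" and g: "g \<in> carrier TT" and eq: "can f = can g"
  shows "lin_ext (corr c) f = lin_ext (corr c) g"
proof -
  define K where "K = cls ` {f \<in> carrier TT. lin_ext (corr c) f = 0}"
  have K: "is_subspace UU K"
  proof (rule M.is_subspaceI)
    show "K \<subseteq> carrier UU" unfolding K_def UU_carrier by blast
    have "cls \<zero>\<^bsub>TT\<^esub> = \<zero>\<^bsub>UU\<^esub>"
      unfolding UU_eq by (rule vlinear.map_zero[OF U.vlinear_coset])
    moreover have "cls \<zero>\<^bsub>TT\<^esub> \<in> K" unfolding K_def by (rule imageI) (simp add: lin_ext_def)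
    ultimately show "\<zero>\<^bsub>UU\<^esub> \<in> K" by simp
  next
    fix u v assume "u \<in> K" "v \<in> K"
    then obtain f g where f: "f \<in> carrier TT" "lin_ext (corr c) f = 0" "u = cls f"
      and g: "g \<in> carrier TT" "lin_ext (corr c) g = 0" "v = cls g" unfolding K_def by blast
    show "u \<oplus>\<^bsub>UU\<^esub> v \<in> K"
      unfolding f(3) g(3) cls_add[OF f(1) g(1), symmetric] K_def
      by (rule imageI) (use f g in \<open>simp add: lin_ext_add finite_support_add\<close>)
  next
    fix a u assume "u \<in> K"
    then obtain f where f: "f \<in> carrier TT" "lin_ext (corr c) f = 0" "u = cls f" unfolding K_def by blast
    show "a \<odot>\<^bsub>UU\<^esub> u \<in> K"
      unfolding f(3) cls_smult[OF f(1), symmetric] K_def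
      by (rule imageI) (use f lin_ext_smult[of f "corr c" a] in \<open>simp add: finite_support_smult\<close>)
  qed
  have "relations \<subseteq> K"
    unfolding relations_eq K_def using corr_trel trel_closed by blast
  then have R: "RR \<subseteq> K" unfolding RR_eq by (rule M.lin_span_minimal[OF _ K])
  have fg: "f \<ominus>\<^bsub>TT\<^esub> g \<in> carrier TT" using f g by (rule U.M.minus_closed)
  have "cls f \<ominus>\<^bsub>UU\<^esub> cls g \<in> RR"
    using eq M.coset_eq_iff[OF cls_closed[OF f] cls_closed[OF g]] unfolding can_def by simp
  then have "cls (f \<ominus>\<^bsub>TT\<^esub> g) \<in> K" using R U.Q_diff[OF f g] unfolding UU_eq by auto
  then obtain h where h: "h \<in> carrier TT" "lin_ext (corr c) h = 0" "cls (f \<ominus>\<^bsub>TT\<^esub> g) = cls h"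
    unfolding K_def by blast
  then have "(f \<ominus>\<^bsub>TT\<^esub> g) \<ominus>\<^bsub>TT\<^esub> h \<in> II" using U.coset_eq_iff[OF fg h(1)] by simp
  then have "lin_ext (corr c) ((f \<ominus>\<^bsub>TT\<^esub> g) \<ominus>\<^bsub>TT\<^esub> h) = 0" by (rule corr_II)
  moreover have d: "lin_ext (corr c) (f' \<ominus>\<^bsub>TT\<^esub> g') = lin_ext (corr c) f' - lin_ext (corr c) g'"
    if "f' \<in> carrier TT" "g' \<in> carrier TT" for f' g'
    using that by (subst T_minus) (simp_all add: lin_ext_diff)
  ultimately show ?thesis using d[OF fg h(1)] d[OF f g] h(2) by simp
qed

definition corr_fun :: "'k vir_vec \<Rightarrow> 'k poly"
  where "corr_fun v = lin_ext (corr c) (SOME f. f \<in> carrier TT \<and> can f = v)"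

lemma corr_fun_can: "f \<in> carrier TT \<Longrightarrow> corr_fun (can f) = lin_ext (corr c) f"
  unfolding corr_fun_def
  by (rule someI2[of _ f]) (auto intro: can_eq_imp_corr_eq simp del: T_simps)

lemma corr_fun_functional: "poly_functional MM corr_fun"
proof (intro poly_functional.intro poly_functional_axioms.intro MM_vspace)
  fix v u assume "v \<in> carrier MM" "u \<in> carrier MM"
  then obtain f g where f: "f \<in> carrier TT" "v = can f" and g: "g \<in> carrier TT" "u = can g"
    unfolding MM_carrier by blast
  have fg: "f \<oplus>\<^bsub>TT\<^esub> g \<in> carrier TT" using f g by (simp add: finite_support_add)
  show "corr_fun (v \<oplus>\<^bsub>MM\<^esub> u) = corr_fun v + corr_fun u"
    unfolding f(2) g(2) C.map_add[OF f(1) g(1), symmetric] corr_fun_can[OF fg] corr_fun_can[OF f(1)] corr_fun_can[OF g(1)]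
    using f g by (simp add: lin_ext_add)
next
  fix a v assume "v \<in> carrier MM"
  then obtain f where f: "f \<in> carrier TT" "v = can f" unfolding MM_carrier by blast
  have af: "a \<odot>\<^bsub>TT\<^esub> f \<in> carrier TT" using f by (simp add: finite_support_smult)
  show "corr_fun (a \<odot>\<^bsub>MM\<^esub> v) = Polynomial.smult a (corr_fun v)"
    unfolding f(2) C.map_smult[OF f(1), symmetric] corr_fun_can[OF af] corr_fun_can[OF f(1)]
    using f by (simp add: lin_ext_smult)
qed

lemma corr_fun_vac: "corr_fun vac0 = 1"
  unfolding vac0_eq corr_fun_can[OF word_tensor_carrier] by simp

lemma corr_fun_act:
  assumes "v \<in> carrier MM" "n < -1"
  shows "corr_fun (act (Vir_L n) v)
    = (-1) ^ nat (- n) * (of_int (- n - 1) * [:0, 1:] * corr_fun v - corr_fun (act (Vir_L (-1)) v))"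
proof -
  obtain f where f: "f \<in> carrier TT" "v = can f" using assms(1) unfolding MM_carrier by blast
  have fin: "finite {w. f w \<noteq> 0}" using f by simp
  have *: "corr_fun (act x v) = lin_ext (\<lambda>w. corr c (x # w)) f" for x
    unfolding f(2) action_can[OF f(1)] corr_fun_can[OF left_mult_carrier[OF f(1)]]
      lin_ext_mult[OF word_tensor_closed fin] by simp
  have "lin_ext (\<lambda>w. a * (b * h w - k w)) f = a * (b * lin_ext h f - lin_ext k f)" for a b h k
    by (simp add: lin_ext_def sum_distrib_left right_diff_distrib smult_diff_right sum_subtractf)
  then show ?thesis
    unfolding * unfolding f(2) corr_fun_can[OF f(1)] by (simp only: corr_lt[OF assms(2)] corr_ge[of "-1", simplified])
qed

end

section \<open>Vertex algebras\<close>

sublocale vertex_algebra \<subseteq> vspace V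
  by (rule vspace.intro) (rule vector_space)

context vertex_algebra
begin

lemma vac_carrier [simp]: "vac V \<in> carrier V"
  by (rule vac_closed)

lemma nprod_carrier [simp, intro]: "u \<in> carrier V \<Longrightarrow> v \<in> carrier V \<Longrightarrow> nprod V u n v \<in> carrier V"
  by (rule nprod_closed)

lemma nprod_linear: "u \<in> carrier V \<Longrightarrow> vlinear V V (nprod V u n)"
  by unfold_locales (auto simp: nprod_add_right nprod_smult_right)

lemma nprod_linear_left: "v \<in> carrier V \<Longrightarrow> vlinear V V (\<lambda>u. nprod V u n v)"
  by unfold_locales (auto simp: nprod_add_left nprod_smult_left)

lemma nprod_zero [simp]: "u \<in> carrier V \<Longrightarrow> nprod V u n \<zero> = \<zero>"
  by (rule vlinear.map_zero[OF nprod_linear])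

lemma nprod_zero_left [simp]: "v \<in> carrier V \<Longrightarrow> nprod V \<zero> n v = \<zero>"
  by (rule vlinear.map_zero[OF nprod_linear_left])

lemma nprod_diff_right:
  "u \<in> carrier V \<Longrightarrow> v \<in> carrier V \<Longrightarrow> w \<in> carrier V \<Longrightarrow> nprod V u n (v \<ominus> w) = nprod V u n v \<ominus> nprod V u n w"
  by (rule vlinear.map_diff[OF nprod_linear])

lemma nprod_diff_left:
  "u \<in> carrier V \<Longrightarrow> v \<in> carrier V \<Longrightarrow> w \<in> carrier V \<Longrightarrow> nprod V (u \<ominus> v) n w = nprod V u n w \<ominus> nprod V v n w"
  by (rule vlinear.map_diff[OF nprod_linear_left])

text \<open>The Jacobi identity with \<open>m = 0\<close>; on its right-hand side only
  \<open>i = 0\<close> survives.\<close>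

lemma iterate:
  assumes "u \<in> carrier V" "v \<in> carrier V" "w \<in> carrier V"
  shows "nprod V (nprod V u l v) n w =
    fsum V (\<lambda>i. ((-1) ^ i * ibinom l i) \<odot> nprod V u (l - int i) (nprod V v (n + int i) w))
    \<ominus> fsum V (\<lambda>i. ((-1) powi l * (-1) ^ i * ibinom l i) \<odot> nprod V v (n + l - int i) (nprod V u (int i) w))"
proof -
  have "fsum V (\<lambda>i. ibinom 0 i \<odot> nprod V (nprod V u (l + int i) v) (0 + n - int i) w)
     = ibinom 0 0 \<odot> nprod V (nprod V u (l + int 0) v) (0 + n - int 0) w"
    by (rule fsum_single) (use assms in auto)
  then have "fsum V (\<lambda>i. ibinom 0 i \<odot> nprod V (nprod V u (l + int i) v) (0 + n - int i) w)
     = nprod V (nprod V u l v) n w" using assms by simp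
  with jacobi[OF assms, of l 0 n] show ?thesis by simp
qed

text \<open>The Jacobi identity with \<open>l = 0\<close>; each sum on its left-hand side reduces to
  one term.\<close>

lemma commutator:
  assumes "u \<in> carrier V" "v \<in> carrier V" "w \<in> carrier V"
  shows "nprod V u m (nprod V v n w) \<ominus> nprod V v n (nprod V u m w)
    = fsum V (\<lambda>i. ibinom m i \<odot> nprod V (nprod V u (int i) v) (m + n - int i) w)"
proof -
  have "fsum V (\<lambda>i. ((-1) ^ i * ibinom 0 i) \<odot> nprod V u (m + 0 - int i) (nprod V v (n + int i) w))
     = ((-1) ^ 0 * ibinom 0 0) \<odot> nprod V u (m + 0 - int 0) (nprod V v (n + int 0) w)"
    by (rule fsum_single) (use assms in auto)
  moreover have "fsum V (\<lambda>i. ((-1) powi 0 * (-1) ^ i * ibinom 0 i) \<odot> nprod V v (n + 0 - int i) (nprod V u (m + int i) w))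
     = ((-1) powi 0 * (-1) ^ 0 * ibinom 0 0) \<odot> nprod V v (n + 0 - int 0) (nprod V u (m + int 0) w)"
    by (rule fsum_single) (use assms in auto)
  ultimately show ?thesis using jacobi[OF assms, of 0 m n] assms by simp
qed

lemma iterate_vacuum:
  assumes "u \<in> carrier V" "v \<in> carrier V"
  shows "nprod V (nprod V u l v) n (vac V) =
    fsum V (\<lambda>i. ((-1) ^ i * ibinom l i) \<odot> nprod V u (l - int i) (nprod V v (n + int i) (vac V)))"
proof -
  have "fsum V (\<lambda>i. ((-1) powi l * (-1) ^ i * ibinom l i) \<odot> nprod V v (n + l - int i) (nprod V u (int i) (vac V))) = \<zero>"
    using assms by (intro fsum_zero) (simp add: creation(1))
  then show ?thesis unfolding iterate[OF assms vac_carrier]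
    using assms by (simp add: M.minus_eq)
qed

definition transl
  where "transl v = nprod V v (-2) (vac V)"

lemma transl_vac: "transl (vac V) = \<zero>"
  by (simp add: transl_def vacuum)

text \<open>In \<open>iterate_vacuum\<close> at index -2 the creation axiom leaves only
  \<open>i = 0\<close> and \<open>i = 1\<close>.\<close>

lemma transl_nprod:
  assumes "u \<in> carrier V" "v \<in> carrier V"
  shows "transl (nprod V u n v) = nprod V u n (transl v) \<ominus> of_int n \<odot> nprod V u (n - 1) v"
proof -
  define f where "f i = ((-1) ^ i * ibinom n i) \<odot> nprod V u (n - int i) (nprod V v (-2 + int i) (vac V))" for i
  have z: "nprod V v (-2 + int i) (vac V) = \<zero>" if "i \<notin> {0, 1}" for i
    using that assms by (intro creation(1)) auto
  have f: "f i \<in> carrier V" for i using assms by (simp add: f_def)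
  have "transl (nprod V u n v) = fsum V f"
    unfolding transl_def iterate_vacuum[OF assms] f_def ..
  also have "\<dots> = (\<Oplus>i\<in>{0, 1}. f i)"
    by (rule fsum_eq_finsum) (use z f assms in \<open>auto simp: f_def\<close>)
  also have "\<dots> = f 0 \<oplus> f 1" using f by (simp add: M.finsum_insert)
  also have "f 0 = nprod V u n (transl v)" using assms by (simp add: f_def transl_def)
  also have "f 1 = (- of_int n) \<odot> nprod V u (n - 1) v"
    using assms creation(2) by (simp add: f_def)
  finally show ?thesis using assms by (simp add: smult_uminus M.minus_eq)
qed

lemma finite_support_nprod:
  assumes "u \<in> carrier V" "v \<in> carrier V"
  shows "finite {i::nat. a i \<odot> nprod V u (int i - k) v \<noteq> \<zero>}"
proof -
  obtain N where N: "\<forall>n\<ge>N. nprod V u n v = \<zero>" using truncation[OF assms] by blast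
  have "{i::nat. a i \<odot> nprod V u (int i - k) v \<noteq> \<zero>} \<subseteq> {..nat (N + k)}"
  proof
    fix i assume "i \<in> {i::nat. a i \<odot> nprod V u (int i - k) v \<noteq> \<zero>}"
    then have "\<not> int i - k \<ge> N" using N by auto
    then show "i \<in> {..nat (N + k)}" by auto
  qed
  then show ?thesis by (rule finite_subset) simp
qed

lemma zhu_res_hom_carrier [simp]:
  "a \<in> carrier V \<Longrightarrow> b \<in> carrier V \<Longrightarrow> zhu_res_hom V d k a b \<in> carrier V"
  by (simp add: zhu_res_hom_def)

lemma zhu_res_hom_zero: "b \<in> carrier V \<Longrightarrow> zhu_res_hom V d k \<zero> b = \<zero>"
  unfolding zhu_res_hom_def by (rule fsum_zero) simp

end

subsection \<open>Homogeneous components\<close>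

context graded_vertex_algebra
begin

lemmas grading_subspaceD = is_subspaceD[OF grading_subspace]

lemma grading_carrier: "v \<in> grading V n \<Longrightarrow> v \<in> carrier V"
  using grading_subspaceD(1) by blast

lemma hom_decomp_hom_comp: "v \<in> carrier V \<Longrightarrow> hom_decomp V v (hom_comp V v)"
  unfolding hom_comp_def by (rule theI'[OF grading_direct])

lemma hom_comp_eqI: "v \<in> carrier V \<Longrightarrow> hom_decomp V v d \<Longrightarrow> hom_comp V v = d"
  using grading_direct hom_decomp_hom_comp by blast

lemma finite_hom_comp: "v \<in> carrier V \<Longrightarrow> finite {n. hom_comp V v n \<noteq> \<zero>}"
  using hom_decomp_hom_comp unfolding hom_decomp_def by blast

lemma hom_comp_grading: "v \<in> carrier V \<Longrightarrow> hom_comp V v n \<in> grading V n"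
  using hom_decomp_hom_comp unfolding hom_decomp_def by blast

lemma hom_comp_carrier [simp]: "v \<in> carrier V \<Longrightarrow> hom_comp V v n \<in> carrier V"
  using hom_comp_grading grading_carrier by blast

lemma fsum_hom_comp: "v \<in> carrier V \<Longrightarrow> fsum V (hom_comp V v) = v"
  using hom_decomp_hom_comp unfolding hom_decomp_def by simp

lemma hom_comp_fsum:
  assumes "finite {n. d n \<noteq> \<zero>}" "\<And>n. d n \<in> grading V n"
  shows "hom_comp V (fsum V d) = d"
  using assms grading_carrier by (intro hom_comp_eqI) (auto simp: hom_decomp_def intro!: fsum_closed)

lemma hom_comp_homogeneous:
  assumes "v \<in> grading V m"
  shows "hom_comp V v n = (if n = m then v else \<zero>)"
proof -
  have "fsum V (\<lambda>n. if n = m then v else \<zero>) = v"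
    using fsum_single[of m "\<lambda>n. if n = m then v else \<zero>"] assms grading_carrier by simp
  moreover have "hom_comp V (fsum V (\<lambda>n. if n = m then v else \<zero>)) = (\<lambda>n. if n = m then v else \<zero>)"
    by (rule hom_comp_fsum) (use assms in \<open>auto simp: grading_subspaceD(2)\<close>)
  ultimately show ?thesis by simp
qed

lemma fsum_shift:
  assumes "\<And>n. f n \<in> carrier V"
  shows "fsum V (\<lambda>n. f (n - s)) = fsum V (f :: int \<Rightarrow> _)"
proof -
  have "{n. f (n - s) \<noteq> \<zero>} = (\<lambda>n. n + s) ` {n. f n \<noteq> \<zero>}"
    by (auto intro!: image_eqI[of _ _ "_ - s"])
  then show ?thesis unfolding fsum_def
    using M.add.finprod_reindex[of "\<lambda>n. f (n - s)" "\<lambda>n. n + s" "{n. f n \<noteq> \<zero>}"] assms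
    by (simp add: inj_on_def)
qed

lemma hom_comp_map:
  assumes h: "vlinear V V h" and deg: "\<And>n v. v \<in> grading V n \<Longrightarrow> h v \<in> grading V (n + s)"
    and v: "v \<in> carrier V"
  shows "hom_comp V (h v) n = h (hom_comp V v (n - s))"
proof -
  interpret h: vlinear V V h by (rule h)
  define d where "d n = h (hom_comp V v (n - s))" for n
  have "{n. d n \<noteq> \<zero>} \<subseteq> (\<lambda>n. n + s) ` {n. hom_comp V v n \<noteq> \<zero>}"
    by (auto simp: d_def intro!: image_eqI[of _ _ "_ - s"])
  then have fin: "finite {n. d n \<noteq> \<zero>}" by (rule finite_subset) (simp add: finite_hom_comp v)
  have "d n \<in> grading V n" for n
    using deg[OF hom_comp_grading[OF v], of "n - s"] by (simp add: d_def)
  with fin have "hom_comp V (fsum V d) = d" by (rule hom_comp_fsum)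
  moreover have "fsum V d = fsum V (\<lambda>n. h (hom_comp V v n))"
    unfolding d_def using v by (intro fsum_shift) simp
  moreover have "\<dots> = h v"
    using h.map_fsum[of "hom_comp V v"] v by (simp add: finite_hom_comp fsum_hom_comp)
  ultimately show ?thesis by (simp add: d_def)
qed

lemma hom_comp_smult: "v \<in> carrier V \<Longrightarrow> hom_comp V (a \<odot> v) n = a \<odot> hom_comp V v n"
proof -
  have "vlinear V V ((\<odot>) a)"
    by unfold_locales (auto simp: smult_vadd smult_smult mult.commute)
  then show "v \<in> carrier V \<Longrightarrow> hom_comp V (a \<odot> v) n = a \<odot> hom_comp V v n"
    using hom_comp_map[of "(\<odot>) a" 0 v n] grading_subspaceD(4) by simp
qed

lemma hom_comp_add:
  assumes "u \<in> carrier V" "v \<in> carrier V"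
  shows "hom_comp V (u \<oplus> v) n = hom_comp V u n \<oplus> hom_comp V v n"
proof -
  have "finite {n. hom_comp V u n \<oplus> hom_comp V v n \<noteq> \<zero>}"
    by (rule finite_subset[of _ "{n. hom_comp V u n \<noteq> \<zero>} \<union> {n. hom_comp V v n \<noteq> \<zero>}"])
      (auto simp: finite_hom_comp assms)
  then have "hom_comp V (fsum V (\<lambda>n. hom_comp V u n \<oplus> hom_comp V v n)) = (\<lambda>n. hom_comp V u n \<oplus> hom_comp V v n)"
    by (rule hom_comp_fsum) (auto intro!: grading_subspaceD(3) hom_comp_grading assms)
  moreover have "fsum V (\<lambda>n. hom_comp V u n \<oplus> hom_comp V v n) = u \<oplus> v"
    by (subst fsum_add) (auto simp: finite_hom_comp assms fsum_hom_comp)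
  ultimately show ?thesis by simp
qed

lemma hom_comp_linear: "vlinear V V (\<lambda>v. hom_comp V v n)"
  by unfold_locales (auto simp: hom_comp_add hom_comp_smult)

lemma hom_comp_zero [simp]: "hom_comp V \<zero> n = \<zero>"
  by (rule vlinear.map_zero[OF hom_comp_linear])

lemma hom_comp_diff:
  "u \<in> carrier V \<Longrightarrow> v \<in> carrier V \<Longrightarrow> hom_comp V (u \<ominus> v) n = hom_comp V u n \<ominus> hom_comp V v n"
  by (rule vlinear.map_diff[OF hom_comp_linear])

lemma hom_comp_nprod:
  assumes "u \<in> grading V m" "v \<in> carrier V"
  shows "hom_comp V (nprod V u k v) n = nprod V u k (hom_comp V v (n - m + k + 1))"
proof -
  have "nprod V u k v' \<in> grading V (n' + (m - k - 1))" if "v' \<in> grading V n'" for n' v'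
    using nprod_degree[OF assms(1) that, of k] by (simp add: algebra_simps)
  from hom_comp_map[OF nprod_linear this assms(2)] show ?thesis
    using grading_carrier[OF assms(1)] by (simp add: algebra_simps)
qed

lemma zhu_res_homogeneous:
  assumes "a \<in> grading V d" "b \<in> carrier V"
  shows "zhu_res V k a b = zhu_res_hom V d k a b"
proof -
  have "zhu_res V k a b = zhu_res_hom V d k (hom_comp V a d) b"
    unfolding zhu_res_def
    by (rule fsum_single) (use assms grading_carrier[OF assms(1)] in \<open>auto simp: hom_comp_homogeneous[OF assms(1)] zhu_res_hom_zero\<close>)
  then show ?thesis by (simp add: hom_comp_homogeneous[OF assms(1)])
qed

lemma finite_zhu_res: "a \<in> carrier V \<Longrightarrow> b \<in> carrier V \<Longrightarrow> finite {d. zhu_res_hom V d k (hom_comp V a d) b \<noteq> \<zero>}"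
  by (rule finite_subset[OF _ finite_hom_comp[of a]]) (auto simp: zhu_res_hom_zero)

lemma zhu_res_carrier [simp]: "a \<in> carrier V \<Longrightarrow> b \<in> carrier V \<Longrightarrow> zhu_res V k a b \<in> carrier V"
  unfolding zhu_res_def by (rule fsum_closed) simp

end

section \<open>Quotients by graded ideals\<close>

lemma vspace_cong:
  fixes A :: "('k::field, 'v, 'y) module_scheme" and B :: "('k, 'v, 'z) module_scheme"
  assumes "vspace A" and [simp]: "carrier B = carrier A" "add B = add A" "zero B = zero A" "module.smult B = module.smult A"
  shows "vspace B"
proof -
  interpret A: vspace A by fact
  show ?thesis
  proof (rule vspace.intro, rule moduleI)
    show "abelian_group B"
    proof (rule abelian_groupI)
      fix x assume "x \<in> carrier B"
      then show "\<exists>y\<in>carrier B. y \<oplus>\<^bsub>B\<^esub> x = \<zero>\<^bsub>B\<^esub>"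
        by (intro bexI[of _ "\<ominus>\<^bsub>A\<^esub> x"]) (auto simp: A.M.l_neg)
    qed (auto simp: A.M.a_ac)
  qed (auto simp: cring_scalars A.smult_add A.smult_vadd A.smult_smult)
qed

locale graded_ideal = graded_vertex_algebra V
  for V :: "('k::field, 'v, 'z) vertex_alg_scheme" (structure) +
  fixes I :: "'v set"
  assumes I_subspace: "is_subspace V I"
    and I_left: "u \<in> carrier V \<Longrightarrow> w \<in> I \<Longrightarrow> nprod V u n w \<in> I"
    and I_right: "u \<in> carrier V \<Longrightarrow> w \<in> I \<Longrightarrow> nprod V w n u \<in> I"
    and I_hom_comp: "w \<in> I \<Longrightarrow> hom_comp V w n \<in> I"
begin

sublocale Q: quotient_vspace V I
  by (intro quotient_vspace.intro quotient_vspace_axioms.intro vspace_axioms I_subspace)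

abbreviation W where "W \<equiv> quot_vertex_alg V I"

lemma W_simps:
  "carrier W = carrier (quot_algebra V I)"
  "add W = add (quot_algebra V I)"
  "zero W = zero (quot_algebra V I)"
  "module.smult W = module.smult (quot_algebra V I)"
  "vac W = I +> vac V"
  "grading W n = (\<lambda>v. I +> v) ` grading V n"
  by (simp_all add: quot_vertex_alg_def module.defs vertex_alg.defs)

lemma W_carrier: "carrier W = (\<lambda>v. I +> v) ` carrier V"
  by (simp add: W_simps Q.Q_carrier)

sublocale W: vspace W
  by (rule vspace_cong[OF Q.vspace_Q]) (simp_all add: W_simps)

sublocale C: vlinear V W "\<lambda>v. I +> v"
  by unfold_locales (auto simp: W_carrier W_simps Q.Q_add Q.Q_smult)

lemma W_nprod:
  assumes a: "a \<in> carrier V" and b: "b \<in> carrier V"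
  shows "nprod W (I +> a) n (I +> b) = I +> nprod V a n b"
proof -
  have *: "I +> nprod V x n z = I +> nprod V a n b" if x: "x \<in> I +> a" and z: "z \<in> I +> b" for x z
  proof -
    have xc: "x \<in> carrier V" "x \<ominus> a \<in> I" and zc: "z \<in> carrier V" "z \<ominus> b \<in> I"
      using Q.in_coset[OF a x] Q.in_coset[OF b z] Q.coset_eq_iff a b by auto
    have "nprod V (x \<ominus> a) n z \<in> I" "nprod V a n (z \<ominus> b) \<in> I"
      using I_left I_right xc zc a by auto
    then have "I +> nprod V x n z = I +> nprod V a n z" "I +> nprod V a n z = I +> nprod V a n b"
      using xc zc a b by (simp_all add: Q.coset_eq_iff nprod_diff_left nprod_diff_right)
    then show ?thesis by simp
  qed
  have "nprod W (I +> a) n (I +> b) = (\<Union>x\<in>I +> a. \<Union>z\<in>I +> b. I +> nprod V x n z)"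
    by (simp add: quot_vertex_alg_def module.defs vertex_alg.defs)
  also have "\<dots> = (\<Union>x\<in>I +> a. \<Union>z\<in>I +> b. I +> nprod V a n b)"
    using * by (intro SUP_cong refl) simp
  also have "\<dots> = I +> nprod V a n b"
    using Q.in_coset_self[OF a] Q.in_coset_self[OF b] by blast
  finally show ?thesis .
qed

text \<open>\<open>zhu_res\<close> refers to the grading only through \<open>hom_comp\<close>, so
  this lemma takes the place of a proof that the quotient is again a graded vertex algebra.
  Uniqueness of the decomposition comes from \<open>I_hom_comp\<close>.\<close>

lemma hom_comp_W:
  assumes v: "v \<in> carrier V"
  shows "hom_comp W (I +> v) = (\<lambda>n. I +> hom_comp V v n)"
proof -
  let ?d = "\<lambda>n. I +> hom_comp V v n"
  have zero: "I +> \<zero> = \<zero>\<^bsub>W\<^esub>" by (rule C.map_zero)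
  have "finite {n. ?d n \<noteq> \<zero>\<^bsub>W\<^esub>}"
    by (rule finite_subset[OF _ finite_hom_comp[OF v]]) (auto simp: zero)
  moreover have "I +> v = fsum W ?d"
    using C.map_fsum[of "hom_comp V v"] v by (simp add: finite_hom_comp fsum_hom_comp)
  ultimately have d: "hom_decomp W (I +> v) ?d"
    using v by (auto simp: hom_decomp_def W_simps hom_comp_grading)
  have "d' = ?d" if d': "hom_decomp W (I +> v) d'" for d'
  proof
    fix n
    \<comment> \<open>Choosing the representative zero wherever the coset is zero keeps the lifted
      family finitely supported.\<close>
    have "\<forall>n. \<exists>x. x \<in> grading V n \<and> d' n = I +> x \<and> (d' n = \<zero>\<^bsub>W\<^esub> \<longrightarrow> x = \<zero>)"
    proof
      fix n
      have "d' n \<in> (\<lambda>v. I +> v) ` grading V n"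
        using d' unfolding hom_decomp_def W_simps by blast
      then obtain x where "x \<in> grading V n" "d' n = I +> x" by blast
      then show "\<exists>x. x \<in> grading V n \<and> d' n = I +> x \<and> (d' n = \<zero>\<^bsub>W\<^esub> \<longrightarrow> x = \<zero>)"
        using zero grading_subspaceD(2)[of n] by (cases "d' n = \<zero>\<^bsub>W\<^esub>") auto
    qed
    then obtain x where x: "\<And>n. x n \<in> grading V n" "\<And>n. d' n = I +> x n" "\<And>n. d' n = \<zero>\<^bsub>W\<^esub> \<Longrightarrow> x n = \<zero>"
      by metis
    have xc: "x n \<in> carrier V" for n using x(1) grading_carrier by blast
    have fin: "finite {n. x n \<noteq> \<zero>}"
      using d' x(3) unfolding hom_decomp_def by (auto elim: rev_finite_subset)
    have "d' = (\<lambda>n. I +> x n)" using x(2) by blast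
    then have "I +> v = fsum W (\<lambda>n. I +> x n)" using d' unfolding hom_decomp_def by blast
    then have "I +> v = I +> fsum V x" by (simp only: C.map_fsum[OF fin xc])
    then have "v \<ominus> fsum V x \<in> I" using v xc by (simp add: Q.coset_eq_iff)
    then have "hom_comp V v n \<ominus> x n \<in> I"
      using I_hom_comp[of "v \<ominus> fsum V x" n] v xc by (simp add: hom_comp_diff hom_comp_fsum[OF fin x(1)])
    then show "d' n = ?d n" using v xc by (simp add: Q.coset_eq_iff x(2)) (metis Q.coset_eq_iff hom_comp_carrier)
  qed
  with d show ?thesis unfolding hom_comp_def by (rule the_equality)
qed

lemma zhu_res_W:
  assumes a: "a \<in> carrier V" and b: "b \<in> carrier V"
  shows "zhu_res W k (I +> a) (I +> b) = I +> zhu_res V k a b"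
proof -
  have *: "zhu_res_hom W d k (I +> a') (I +> b) = I +> zhu_res_hom V d k a' b" if a': "a' \<in> carrier V" for a' d
    unfolding zhu_res_hom_def
    using C.map_fsum[OF finite_support_nprod[OF a' b]] a' b by (simp add: W_nprod C.map_smult)
  show ?thesis
    unfolding zhu_res_def hom_comp_W[OF a]
    using C.map_fsum[OF finite_zhu_res[OF a b]] a b by (simp add: *)
qed

end

section \<open>Virasoro vertex algebras\<close>

text \<open>The interface between the construction of V and the arguments on Zhu algebras.
  \<open>generated\<close> stands in for a basis, and \<open>ev\<close> is known through its value
  at the vacuum and its recursion for n < -1.\<close>

locale virasoro = graded_vertex_algebra V
  for V :: "('k::field, 'v, 'z) vertex_alg_scheme" (structure) +
  fixes om :: 'v and L :: "int \<Rightarrow> 'v \<Rightarrow> 'v" and c :: 'k and ev :: "'v \<Rightarrow> 'k poly" and p :: nat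
  assumes om: "om \<in> grading V 2"
    and L_eq: "L n v = nprod V om (n + 1) v"
    and L_bracket: "v \<in> carrier V \<Longrightarrow> L m (L n v) \<ominus> L n (L m v)
      = of_int (m - n) \<odot> L (m + n) v \<oplus> (vir_cocycle m n * c) \<odot> v"
    and generated: "is_subspace V N \<Longrightarrow> vac V \<in> N \<Longrightarrow> (\<And>n v. v \<in> N \<Longrightarrow> L n v \<in> N) \<Longrightarrow> carrier V \<subseteq> N"
    and ev_functional: "poly_functional V ev"
    and ev_vac: "ev (vac V) = 1"
    and ev_L_lt: "v \<in> carrier V \<Longrightarrow> n < -1 \<Longrightarrow>
      ev (L n v) = (-1) ^ nat (- n) * (of_int (- n - 1) * [:0, 1:] * ev v - ev (L (-1) v))"
    and char_p: "CHAR('k) = p" and p_ge_3: "p \<ge> 3"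
begin

lemma p_prime: "prime p"
  using char_p p_ge_3 prime_CHAR_semidom[where 'a = 'k] by simp

lemma om_carrier [simp]: "om \<in> carrier V"
  by (rule grading_carrier[OF om])

lemma L_carrier [simp, intro]: "v \<in> carrier V \<Longrightarrow> L n v \<in> carrier V"
  by (simp add: L_eq)

lemma L_linear: "vlinear V V (L n)"
proof -
  have "L n = nprod V om (n + 1)" by (simp add: L_eq fun_eq_iff)
  then show ?thesis by (simp add: nprod_linear)
qed

lemmas L_add = vlinear.map_add[OF L_linear]
  and L_smult = vlinear.map_smult[OF L_linear]
  and L_zero [simp] = vlinear.map_zero[OF L_linear]

sublocale ev: poly_functional V ev
  by (rule ev_functional)

lemma L_vac: "n \<ge> -1 \<Longrightarrow> L n (vac V) = \<zero>"
  by (simp add: L_eq creation(1))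

lemma L_grading: "v \<in> grading V d \<Longrightarrow> L n v \<in> grading V (d - n)"
  using nprod_degree[OF om, of v d "n + 1"] by (simp add: L_eq algebra_simps)

lemma hom_comp_L: "v \<in> carrier V \<Longrightarrow> hom_comp V (L n v) d = L n (hom_comp V v (d + n))"
  using hom_comp_nprod[OF om, of v "n + 1" d] by (simp add: L_eq)

definition Lrem :: "int \<Rightarrow> int \<Rightarrow> 'v \<Rightarrow> 'v"
  where "Lrem m n v = of_int (m - n) \<odot> L (m + n) v \<oplus> (vir_cocycle m n * c) \<odot> v"

lemma Lrem_carrier [simp]: "v \<in> carrier V \<Longrightarrow> Lrem m n v \<in> carrier V"
  by (simp add: Lrem_def)

lemma L_commute: "v \<in> carrier V \<Longrightarrow> L m (L n v) = L n (L m v) \<oplus> Lrem m n v"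
  using eq_diff_iff[of "Lrem m n v" "L m (L n v)" "L n (L m v)"] L_bracket[of v m n]
  by (simp add: Lrem_def M.a_comm)

lemma Lrem_ne: "m + n \<noteq> 0 \<Longrightarrow> v \<in> carrier V \<Longrightarrow> Lrem m n v = of_int (m - n) \<odot> L (m + n) v"
  by (simp add: Lrem_def vir_cocycle_def)

definition vir_closed :: "'v set \<Rightarrow> bool"
  where "vir_closed N \<longleftrightarrow> is_subspace V N \<and> (\<forall>n. \<forall>v\<in>N. L n v \<in> N)"

lemma vir_closedD:
  assumes "vir_closed N"
  shows "is_subspace V N" "\<And>n v. v \<in> N \<Longrightarrow> L n v \<in> N"
  using assms by (auto simp: vir_closed_def)

lemma vir_closed_carrier: "vir_closed (carrier V)"
  by (simp add: vir_closed_def is_subspace_carrier)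

lemma vir_closed_hull: "G \<subseteq> carrier V \<Longrightarrow> vir_closed (vir_closed hull G)"
proof -
  assume G: "G \<subseteq> carrier V"
  have "is_subspace V (\<Inter>{t. vir_closed t \<and> G \<subseteq> t})"
    by (rule is_subspace_Inter) (use G vir_closed_carrier in \<open>auto simp: vir_closed_def\<close>)
  then show ?thesis by (auto simp: vir_closed_def hull_def)
qed

lemma vir_closed_vac: "vir_closed N \<Longrightarrow> vac V \<in> N \<Longrightarrow> N = carrier V"
  using generated[of N] vir_closedD[of N] is_subspaceD(1)[of N] by blast

subsection \<open>A complement of the stabiliser of the vacuum\<close>

text \<open>
  \<open>Top n v\<close> is \<open>\<omega> \<circ>\<^bsub>n-3\<^esub> v\<close>, and \<open>Xop v\<close> is \<open>\<omega> * v\<close> without the summand \<open>L\<^sub>-\<^sub>1 v + L\<^sub>0 v\<close>, which lies in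
  \<open>O(V)\<close>.
\<close>

definition Xop :: "'v \<Rightarrow> 'v"
  where "Xop v = L (-2) v \<oplus> L (-1) v"

definition Top :: "nat \<Rightarrow> 'v \<Rightarrow> 'v"
  where "Top n v = (L (- int n) v \<oplus> L (- int n + 1) v) \<oplus> (L (- int n + 1) v \<oplus> L (- int n + 2) v)"

lemma Xop_carrier [simp]: "v \<in> carrier V \<Longrightarrow> Xop v \<in> carrier V"
  and Top_carrier [simp]: "v \<in> carrier V \<Longrightarrow> Top n v \<in> carrier V"
  by (auto simp: Xop_def Top_def)

lemma Top_eq: "Top (m + 3) v = (L (- int (m + 3)) v \<oplus> L (- int (m + 2)) v)
    \<oplus> (L (- int (m + 2)) v \<oplus> L (- int (m + 1)) v)"
proof -
  have "- int (m + 3) + 1 = - int (m + 2)" "- int (m + 3) + 2 = - int (m + 1)" by auto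
  then show ?thesis by (simp only: Top_def)
qed

lemma Xop_linear: "vlinear V V Xop"
  by unfold_locales (auto simp: Xop_def L_add L_smult smult_vadd M.a_ac)

definition tx_closed :: "'v set \<Rightarrow> bool"
  where "tx_closed N \<longleftrightarrow> is_subspace V N \<and> (\<forall>v\<in>N. Xop v \<in> N \<and> (\<forall>n\<ge>3. Top n v \<in> N))"

lemma vir_closed_imp_tx_closed: "vir_closed N \<Longrightarrow> tx_closed N"
  by (auto simp: vir_closed_def tx_closed_def Xop_def Top_def intro!: is_subspaceD(3))

lemma tx_closed_hull: "G \<subseteq> carrier V \<Longrightarrow> tx_closed (tx_closed hull G)"
proof -
  assume G: "G \<subseteq> carrier V"
  have "is_subspace V (\<Inter>{t. tx_closed t \<and> G \<subseteq> t})"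
    by (rule is_subspace_Inter) (use G vir_closed_imp_tx_closed[OF vir_closed_carrier] in \<open>auto simp: tx_closed_def\<close>)
  then show ?thesis by (auto simp: tx_closed_def hull_def)
qed

text \<open>Let \<open>M\<close> consist of the vectors of \<open>N\<close> that all L(n) keep in
  \<open>N\<close>. Commutators of L(n) with \<open>Xop\<close> and \<open>Top\<close> are
  combinations of modes and scalars, so \<open>M\<close> is stable under both. For singular
  generators, modes with n \<ge> -1 vanish and the others are recovered from \<open>Xop\<close> and
  \<open>Top\<close> recursively; hence the generators lie in \<open>M\<close> and \<open>M\<close>
  is everything.\<close>

lemma tx_closed_hull_vir_closed:
  assumes G: "G \<subseteq> carrier V" and sing: "\<And>g n. g \<in> G \<Longrightarrow> n \<ge> -1 \<Longrightarrow> L n g = \<zero>"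
  shows "vir_closed (tx_closed hull G)"
proof -
  define N where "N = tx_closed hull G"
  have N: "tx_closed N" unfolding N_def by (rule tx_closed_hull[OF G])
  then have sub: "is_subspace V N" and X: "\<And>v. v \<in> N \<Longrightarrow> Xop v \<in> N" and T: "\<And>v n. v \<in> N \<Longrightarrow> n \<ge> 3 \<Longrightarrow> Top n v \<in> N"
    by (auto simp: tx_closed_def)
  note subD = is_subspaceD[OF sub]
  have NV: "v \<in> carrier V" if "v \<in> N" for v using subD(1) that by blast
  define M where "M = {v \<in> N. \<forall>n. L n v \<in> N}"
  have GN: "G \<subseteq> N" unfolding N_def by (rule hull_subset)
  have Msub: "is_subspace V M"
    unfolding M_def by (rule is_subspaceI) (use subD NV in \<open>auto simp: L_add L_smult\<close>)
  have rem: "Lrem m n v \<in> N" if "v \<in> M" for m n v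
    using that unfolding M_def Lrem_def by (auto intro!: subD(3,4))
  have MX: "Xop v \<in> M" if v: "v \<in> M" for v
  proof -
    have vN: "v \<in> N" "L n v \<in> N" for n using v by (auto simp: M_def)
    have "L n (Xop v) = Xop (L n v) \<oplus> (Lrem n (-2) v \<oplus> Lrem n (-1) v)" for n
      using NV[OF vN(1)] L_commute[of v n "-2"] L_commute[of v n "-1"] by (simp add: Xop_def L_add M.a_ac)
    then show ?thesis using X vN v rem by (auto simp: M_def intro!: subD(3))
  qed
  have MT: "Top m v \<in> M" if v: "v \<in> M" and m: "m \<ge> 3" for v m
  proof -
    have vN: "v \<in> N" "L n v \<in> N" for n using v by (auto simp: M_def)
    have "L n (Top m v) = Top m (L n v) \<oplus> ((Lrem n (- int m) v \<oplus> Lrem n (- int m + 1) v)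
        \<oplus> (Lrem n (- int m + 1) v \<oplus> Lrem n (- int m + 2) v))" for n
      using NV[OF vN(1)] L_commute[of v n "- int m"] L_commute[of v n "- int m + 1"] L_commute[of v n "- int m + 2"]
      by (simp add: Top_def L_add M.a_ac)
    then show ?thesis using T[OF _ m] vN rem[OF v] by (auto simp: M_def intro!: subD(3))
  qed
  have "G \<subseteq> M"
  proof
    fix g assume g: "g \<in> G"
    then have gN: "g \<in> N" using GN by blast
    have gV: "g \<in> carrier V" using g G by blast
    have pos: "L n g \<in> N" if "n \<ge> -1" for n using sing[OF g that] subD(2) by simp
    have neg: "L (- int m) g \<in> N" for m
    proof (induction m rule: less_induct)
      case (less m)
      consider "m \<le> 1" | "m = 2" | "m \<ge> 3" by linarith
      then show ?case
      proof cases
        case 1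
        then show ?thesis using pos[of "- int m"] by simp
      next
        case 2
        have "Xop g \<ominus> L (-1) g = L (-2) g"
          using gV by (simp add: Xop_def M.minus_eq M.a_assoc M.r_neg)
        then show ?thesis using subD(5)[OF X[OF gN] pos[of "-1"]] 2 by simp
      next
        case 3
        define a b d where "a = L (- int m) g" "b = L (- int m + 1) g" "d = L (- int m + 2) g"
        have "L (- int (m - 1)) g \<in> N" "L (- int (m - 2)) g \<in> N" by (rule less, use 3 in simp)+
        moreover have "- int (m - 1) = - int m + 1" "- int (m - 2) = - int m + 2" using 3 by auto
        ultimately have bd: "b \<in> N" "d \<in> N" by (simp_all only: a_b_d_def)
        have ca: "a \<in> carrier V" "b \<in> carrier V" "d \<in> carrier V" using gV by (simp_all add: a_b_d_def)
        have "Top m g = (a \<oplus> b) \<oplus> (b \<oplus> d)" unfolding Top_def a_b_d_def ..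
        then have "Top m g \<ominus> (b \<oplus> (b \<oplus> d)) = a" using ca by (simp add: M.minus_eq M.a_assoc M.r_neg)
        then show ?thesis using subD(5)[OF T[OF gN 3], of "b \<oplus> (b \<oplus> d)"] bd subD(3) by (simp add: a_b_d_def)
      qed
    qed
    have "L n g \<in> N" for n
      using pos[of n] neg[of "nat (- n)"] by (cases "n \<ge> -1") auto
    then show "g \<in> M" using gN by (simp add: M_def)
  qed
  moreover have "tx_closed M" using Msub MX MT by (auto simp: tx_closed_def)
  ultimately have "N \<subseteq> M" unfolding N_def by (rule hull_minimal)
  then show ?thesis unfolding N_def[symmetric] vir_closed_def using sub by (auto simp: M_def)
qed

lemma tx_closed_vac:
  assumes "tx_closed N" "vac V \<in> N"
  shows "N = carrier V"
proof -
  have "vir_closed (tx_closed hull {vac V})"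
    by (rule tx_closed_hull_vir_closed) (auto simp: L_vac)
  moreover have "vac V \<in> tx_closed hull {vac V}" using hull_subset[of "{vac V}" tx_closed] by blast
  ultimately have "tx_closed hull {vac V} = carrier V" by (rule vir_closed_vac)
  moreover have "tx_closed hull {vac V} \<subseteq> N" using assms by (intro hull_minimal) auto
  ultimately show ?thesis using assms is_subspaceD(1)[of N] by (auto simp: tx_closed_def)
qed

subsection \<open>The functional\<close>

definition xx :: "'k poly" where "xx = [:0, 1:]"

lemma ev_L_neg:
  assumes "v \<in> carrier V" "n \<ge> 1"
  shows "ev (L (- int n) v) = (-1) ^ n * (of_int (int n - 1) * xx * ev v - ev (L (-1) v))"
proof (cases "n = 1")
  case False
  then show ?thesis using ev_L_lt[OF assms(1), of "- int n", folded xx_def] assms(2) by simp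
qed simp

lemma ev_Xop: "v \<in> carrier V \<Longrightarrow> ev (Xop v) = xx * ev v"
  using ev_L_neg[of v 2] by (simp add: Xop_def ev.fun_add)

text \<open>(1 + shift)^2 kills a sequence of the form (-1)^n times an affine function of n.\<close>

lemma ev_Top:
  assumes "v \<in> carrier V" "n \<ge> 3"
  shows "ev (Top n v) = 0"
proof -
  obtain m where n: "n = m + 3" using assms(2) by (metis add.commute le_Suc_ex)
  have "(-1) ^ (m + 3) * (of_int (int (m + 3) - 1) * x * e - f) + (-1) ^ (m + 2) * (of_int (int (m + 2) - 1) * x * e - f)
    + ((-1) ^ (m + 2) * (of_int (int (m + 2) - 1) * x * e - f) + (-1) ^ (m + 1) * (of_int (int (m + 1) - 1) * x * e - f)) = 0"
    for x e f :: "'k poly"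
    by (simp add: algebra_simps power_add)
  moreover have "ev (L (- int (m + k)) v) = (-1) ^ (m + k) * (of_int (int (m + k) - 1) * xx * ev v - ev (L (-1) v))"
    if "k \<ge> 1" for k
    using that by (intro ev_L_neg[OF assms(1)]) simp
  ultimately show ?thesis
    unfolding n Top_eq using assms(1) by (simp only: ev.fun_add L_carrier M.a_closed one_le_numeral order.refl)
qed

lemma ev_Lrem_ne: "m + n \<noteq> 0 \<Longrightarrow> v \<in> carrier V \<Longrightarrow> ev (Lrem m n v) = of_int (m - n) * ev (L (m + n) v)"
  by (simp add: Lrem_ne ev.fun_smult of_int_poly)

lemma ev_commute:
  "m + n \<noteq> 0 \<Longrightarrow> v \<in> carrier V \<Longrightarrow> ev (L m (L n v)) = ev (L n (L m v)) + of_int (m - n) * ev (L (m + n) v)"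
  by (subst L_commute) (simp_all add: ev.fun_add ev_Lrem_ne)

text \<open>In a Zhu algebra L(-1) + L(0) acts as zero. For \<open>ev\<close> this is proved along
  \<open>Xop\<close> and \<open>Top\<close>: it holds at the vacuum, and the commutators with both
  operators contribute nothing new under \<open>ev\<close>.\<close>

lemma ev_L_minus_one:
  assumes "v \<in> carrier V"
  shows "ev (L (-1) v) = - ev (L 0 v)"
proof -
  define N where "N = {v \<in> carrier V. ev (L (-1) v) + ev (L 0 v) = 0}"
  have sub: "is_subspace V N"
    unfolding N_def
    by (rule is_subspaceI)
      (auto simp: L_add L_smult ev.fun_add ev.fun_smult add_eq_0_iff smult_add_right[symmetric] minus_add_distrib)
  moreover have "Xop v \<in> N" if v: "v \<in> N" for v
  proof -
    have vc: "v \<in> carrier V" and v0: "ev (L (-1) v) + ev (L 0 v) = 0" using v by (auto simp: N_def)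
    have 1: "ev (L (-1) (L (-2) v)) = ev (L (-2) (L (-1) v)) + ev (L (-3) v)"
      "ev (L 0 (L (-2) v)) = ev (L (-2) (L 0 v)) + 2 * ev (L (-2) v)"
      "ev (L 0 (L (-1) v)) = ev (L (-1) (L 0 v)) + ev (L (-1) v)"
      using ev_commute[OF _ vc, of "-1" "-2"] ev_commute[OF _ vc, of 0 "-2"] ev_commute[OF _ vc, of 0 "-1"]
      by simp_all
    have 2: "ev (L (-2) u) = xx * ev u - ev (L (-1) u)" if "u \<in> carrier V" for u
      using ev_L_neg[OF that, of 2] by simp
    have 3: "ev (L (-3) v) = - (2 * xx * ev v - ev (L (-1) v))" using ev_L_neg[OF vc, of 3] by simp
    have "ev (L (-1) (Xop v)) + ev (L 0 (Xop v)) = xx * (ev (L (-1) v) + ev (L 0 v))"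
      using vc by (simp add: Xop_def L_add ev.fun_add 1 2 3 algebra_simps)
    then show ?thesis using vc v0 by (simp add: N_def)
  qed
  moreover have "Top n v \<in> N" if v: "v \<in> N" and n: "n \<ge> 3" for v n
  proof -
    have vc: "v \<in> carrier V" using v by (auto simp: N_def)
    obtain m where m: "n = m + 3" using n by (metis add.commute le_Suc_ex)
    define A B D where "A k = ev (L (- int k) v)" and "B k = ev (L (- int k) (L (-1) v))"
      and "D k = ev (L (- int k) (L 0 v))" for k
    have c: "ev (L (-1) (L (- int k) v)) = B k + of_int (int k - 1) * A (k + 1)"
      "ev (L 0 (L (- int k) v)) = D k + of_nat k * A k" if "k \<ge> 1" for k
    proof -
      have "-1 + - int k = - int (k + 1)" "-1 - - int k = int k - 1" by auto
      then show "ev (L (-1) (L (- int k) v)) = B k + of_int (int k - 1) * A (k + 1)"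
        using ev_commute[OF _ vc, of "-1" "- int k"] that unfolding A_def B_def by simp
      show "ev (L 0 (L (- int k) v)) = D k + of_nat k * A k"
        using ev_commute[OF _ vc, of 0 "- int k"] that unfolding A_def D_def by simp
    qed
    have e: "ev (L k (Top n w)) = (ev (L k (L (- int (m + 3)) w)) + ev (L k (L (- int (m + 2)) w)))
         + (ev (L k (L (- int (m + 2)) w)) + ev (L k (L (- int (m + 1)) w)))" if "w \<in> carrier V" for k w
      unfolding m Top_eq using that by (simp only: L_add ev.fun_add L_carrier M.a_closed)
    have e': "ev (Top n w) = (ev (L (- int (m + 3)) w) + ev (L (- int (m + 2)) w))
       + (ev (L (- int (m + 2)) w) + ev (L (- int (m + 1)) w))" if "w \<in> carrier V" for w
      unfolding m Top_eq using that by (simp only: ev.fun_add L_carrier M.a_closed)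
    \<comment> \<open>The last two lines are the commutator of L(-1) + L(0) with
      \<open>Top n\<close>, which is (n - 1) \<open>Top (n + 1)\<close> + (n - 2)
      \<open>Top n\<close>, with n = m + 3.\<close>
    have "ev (L (-1) (Top n v)) + ev (L 0 (Top n v))
      = ((B (m + 3) + B (m + 2)) + (B (m + 2) + B (m + 1))) + ((D (m + 3) + D (m + 2)) + (D (m + 2) + D (m + 1)))
      + of_nat (m + 2) * ((A (m + 4) + A (m + 3)) + (A (m + 3) + A (m + 2)))
      + of_nat (m + 1) * ((A (m + 3) + A (m + 2)) + (A (m + 2) + A (m + 1)))"
      unfolding e[OF vc]
      using c[of "m + 3"] c[of "m + 2"] c[of "m + 1"]
      by (simp add: algebra_simps numeral_3_eq_3 numeral_eq_Suc)
    moreover have "(B (m + 3) + B (m + 2)) + (B (m + 2) + B (m + 1)) = 0"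
      "(D (m + 3) + D (m + 2)) + (D (m + 2) + D (m + 1)) = 0"
      "(A (m + 3) + A (m + 2)) + (A (m + 2) + A (m + 1)) = 0"
      using e'[of "L (-1) v"] e'[of "L 0 v"] e'[of v] ev_Top[OF _ n] vc unfolding A_def B_def D_def by simp_all
    moreover have "(A (m + 4) + A (m + 3)) + (A (m + 3) + A (m + 2)) = 0"
    proof -
      have "ev (Top ((m + 1) + 3) v) = (A (m + 1 + 3) + A (m + 1 + 2)) + (A (m + 1 + 2) + A (m + 1 + 1))"
        unfolding Top_eq A_def using vc by (simp only: ev.fun_add L_carrier M.a_closed)
      then show ?thesis using ev_Top[OF vc, of "(m + 1) + 3"] by (simp add: numeral_eq_Suc)
    qed
    ultimately have "ev (L (-1) (Top n v)) + ev (L 0 (Top n v)) = 0" by simp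
    then show ?thesis using vc by (simp add: N_def)
  qed
  ultimately have "tx_closed N" by (auto simp: tx_closed_def)
  moreover have "vac V \<in> N" by (simp add: N_def L_vac)
  ultimately have "N = carrier V" by (rule tx_closed_vac)
  then show ?thesis using assms by (auto simp: N_def eq_neg_iff_add_eq_0)
qed

end

context virasoro
begin

subsection \<open>The action of the free algebra\<close>

lemma neg_zero [simp]: "\<ominus> \<zero> = \<zero>"
  by (rule M.minus_equality) auto

definition wact :: "mode_word \<Rightarrow> 'v \<Rightarrow> 'v"
  where "wact w v = foldr L (modes w) v"

lemma foldr_L_carrier: "v \<in> carrier V \<Longrightarrow> foldr L ns v \<in> carrier V"
  by (induction ns) auto

lemma wact_carrier [simp]: "v \<in> carrier V \<Longrightarrow> wact w v \<in> carrier V"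
  by (simp add: wact_def foldr_L_carrier)

lemma wact_plus: "wact (u + w) v = wact u (wact w v)"
  by (simp add: wact_def)

lemma wact_linear: "vlinear V V (wact w)"
proof -
  have "vlinear V V (foldr L ns)" for ns
  proof (induction ns)
    case Nil
    show ?case by unfold_locales auto
  next
    case (Cons n ns)
    interpret A: vlinear V V "foldr L ns" by (rule Cons)
    show ?case by unfold_locales (auto simp: A.map_add A.map_smult L_add L_smult)
  qed
  then show ?thesis by (simp add: wact_def[abs_def])
qed

definition mact :: "'k mode_alg \<Rightarrow> 'v \<Rightarrow> 'v"
  where "mact f v = (\<Oplus>w\<in>Poly_Mapping.keys f. Poly_Mapping.lookup f w \<odot> wact w v)"

lemma mact_superset:
  assumes "finite S" "Poly_Mapping.keys f \<subseteq> S" "v \<in> carrier V"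
  shows "mact f v = (\<Oplus>w\<in>S. Poly_Mapping.lookup f w \<odot> wact w v)"
  unfolding mact_def
  by (rule M.add.finprod_mono_neutral_cong_left) (use assms in \<open>auto simp: in_keys_iff\<close>)

lemma mact_carrier [simp]: "v \<in> carrier V \<Longrightarrow> mact f v \<in> carrier V"
  unfolding mact_def by (rule M.finsum_closed) auto

lemma mact_0 [simp]: "mact 0 v = \<zero>"
  by (simp add: mact_def)

lemma mact_add: "v \<in> carrier V \<Longrightarrow> mact (f + g) v = mact f v \<oplus> mact g v"
proof -
  assume v: "v \<in> carrier V"
  let ?S = "Poly_Mapping.keys f \<union> Poly_Mapping.keys g"
  have "mact (f + g) v = (\<Oplus>w\<in>?S. Poly_Mapping.lookup f w \<odot> wact w v \<oplus> Poly_Mapping.lookup g w \<odot> wact w v)"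
    using mact_superset[of ?S "f + g" v] v keys_add[of f g] by (simp add: lookup_add smult_add)
  also have "\<dots> = mact f v \<oplus> mact g v"
    using mact_superset[of ?S f v] mact_superset[of ?S g v] v by (simp add: M.finsum_addf)
  finally show ?thesis .
qed

lemma mact_single: "v \<in> carrier V \<Longrightarrow> mact (Poly_Mapping.single w a) v = a \<odot> wact w v"
  using mact_superset[of "{w}" "Poly_Mapping.single w a" v] by (simp add: lookup_single)

lemma mode_alg_induct [case_names zero add]:
  assumes "P 0" "\<And>f w a. P f \<Longrightarrow> P (f + Poly_Mapping.single w a)"
  shows "P (f :: 'k mode_alg)"
proof (induction f rule: update_induct)
  case const
  then show ?case using assms(1) by simp
next
  case (update f w b)
  have "Poly_Mapping.update w b f = f + Poly_Mapping.single w b"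
    by (rule poly_mapping_eqI) (use update in \<open>auto simp: lookup_update lookup_add lookup_single when_def in_keys_iff\<close>)
  with update assms(2) show ?case by simp
qed

lemma mact_linear: "vlinear V V (mact f)"
proof (induction f rule: mode_alg_induct)
  case zero
  show ?case by unfold_locales auto
next
  case (add f w a)
  interpret A: vlinear V V "mact f" by (rule add)
  interpret B: vlinear V V "wact w" by (rule wact_linear)
  show ?case
    by unfold_locales
      (auto simp: mact_add mact_single A.map_add A.map_smult B.map_add B.map_smult smult_vadd smult_smult M.a_ac mult.commute)
qed

lemma mact_mult_single:
  assumes v: "v \<in> carrier V"
  shows "mact (f * Poly_Mapping.single w b) v = mact f (mact (Poly_Mapping.single w b) v)"
proof (induction f rule: mode_alg_induct)
  case (add f u a)
  interpret B: vlinear V V "wact u" by (rule wact_linear)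
  from add show ?case
    using v by (simp add: distrib_right mact_add mact_single mult_single wact_plus B.map_smult smult_smult)
qed simp

lemma mact_mult:
  assumes v: "v \<in> carrier V"
  shows "mact (f * g) v = mact f (mact g v)"
proof (induction g rule: mode_alg_induct)
  case zero
  show ?case using vlinear.map_zero[OF mact_linear] by simp
next
  case (add g w b)
  then show ?case
    using v vlinear.map_add[OF mact_linear[of f], of "mact g v" "mact (Poly_Mapping.single w b) v"]
    by (simp add: distrib_left mact_add mact_mult_single)
qed

lemma mact_mode: "v \<in> carrier V \<Longrightarrow> mact (mode n) v = L n v"
  by (simp add: mode_def mact_single wact_def)

lemma mact_mconst: "v \<in> carrier V \<Longrightarrow> mact (mconst a) v = a \<odot> v"
  by (simp add: mconst_def mact_single wact_def)

lemma of_int_eq_mconst: "(of_int k :: 'k mode_alg) = mconst (of_int k)"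
  by (simp add: mconst_def)

lemma mact_uminus: "v \<in> carrier V \<Longrightarrow> mact (- f) v = \<ominus> mact f v"
proof -
  assume v: "v \<in> carrier V"
  have "mact (- f) v \<oplus> mact f v = \<zero>" using mact_add[OF v, of "- f" f] by simp
  then show ?thesis using v by (simp add: M.minus_equality)
qed

lemma mact_diff: "v \<in> carrier V \<Longrightarrow> mact (f - g) v = mact f v \<ominus> mact g v"
  using mact_add[of v f "- g"] by (simp add: mact_uminus M.minus_eq)

lemma mact_1: "v \<in> carrier V \<Longrightarrow> mact 1 v = v"
  using mact_mconst[of v 1] by (simp add: mconst_def)

lemma mact_power: "v \<in> carrier V \<Longrightarrow> mact (f ^ n) v = (mact f ^^ n) v"
  by (induction n) (auto simp: mact_1 mact_mult)

lemma mact_of_int_mult: "v \<in> carrier V \<Longrightarrow> mact (of_int k * f) v = of_int k \<odot> mact f v"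
  by (simp add: mact_mult of_int_eq_mconst mact_mconst)

text \<open>The kernel of the representation of the free algebra on V. Operator identities are
  stated as membership of a difference, so that they can be combined with ring identities in the
  free algebra.\<close>

definition ann :: "'k mode_alg set"
  where "ann = {f. \<forall>v\<in>carrier V. mact f v = \<zero>}"

lemma ann_zero: "0 \<in> ann"
  by (simp add: ann_def)

lemma ann_add: "f \<in> ann \<Longrightarrow> g \<in> ann \<Longrightarrow> f + g \<in> ann"
  by (simp add: ann_def mact_add)

lemma ann_diff: "f \<in> ann \<Longrightarrow> g \<in> ann \<Longrightarrow> f - g \<in> ann"
  by (simp add: ann_def mact_diff)

lemma ann_mult_left: "f \<in> ann \<Longrightarrow> g * f \<in> ann"
  by (auto simp: ann_def mact_mult vlinear.map_zero[OF mact_linear])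

lemma ann_mult_right: "f \<in> ann \<Longrightarrow> f * g \<in> ann"
  by (simp add: ann_def mact_mult)

lemma annD: "f - g \<in> ann \<Longrightarrow> v \<in> carrier V \<Longrightarrow> mact f v = mact g v"
  by (rule diff_eq_zeroD) (auto simp: ann_def mact_diff)

definition mrel :: "int \<Rightarrow> int \<Rightarrow> 'k mode_alg"
  where "mrel m n = mode m * mode n - mode n * mode m - of_int (m - n) * mode (m + n)
    - mconst (vir_cocycle m n * c)"

lemma add_diff_diff: "s \<in> carrier V \<Longrightarrow> t \<in> carrier V \<Longrightarrow> ((s \<oplus> t) \<ominus> s) \<ominus> t = \<zero>"
  by (simp add: M.a_comm[of s t] M.minus_eq M.a_assoc M.r_neg)

lemma mrel_ann: "mrel m n \<in> ann"
  unfolding ann_def mrel_def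
proof (intro CollectI ballI)
  fix v assume v: "v \<in> carrier V"
  have mm: "mact (mode a * mode b) v = L a (L b v)" for a b
    using v by (simp add: mact_mult mact_mode)
  show "mact (mode m * mode n - mode n * mode m - of_int (m - n) * mode (m + n) - mconst (vir_cocycle m n * c)) v = \<zero>"
    unfolding mact_diff[OF v] mm mact_of_int_mult[OF v] mact_mode[OF v] mact_mconst[OF v] L_bracket[OF v]
    by (rule add_diff_diff) (use v in auto)
qed

lemma mrel_ne: "m + n \<noteq> 0 \<Longrightarrow> mode m * mode n - mode n * mode m - of_int (m - n) * mode (m + n) \<in> ann"
  using mrel_ann[of m n] by (simp add: mrel_def vir_cocycle_def mconst_def)

subsection \<open>The kernel of the functional\<close>

definition ker_span :: "'v set"
  where "ker_span = lin_span V {Top n v | n v. n \<ge> 3 \<and> v \<in> carrier V}"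

lemma ker_span_subspace: "is_subspace V ker_span"
  unfolding ker_span_def by (rule is_subspace_lin_span) auto

lemma Top_in_ker_span: "n \<ge> 3 \<Longrightarrow> v \<in> carrier V \<Longrightarrow> Top n v \<in> ker_span"
  unfolding ker_span_def using lin_span_superset[of "{Top n v | n v. n \<ge> 3 \<and> v \<in> carrier V}"] by blast

text \<open>Read u = L(-2), w = L(-1), a = L(-n), b = L(-n+1), d = L(-n+2), e1 = L(-n-2), e2 =
  L(-n-1), h = n. The right-hand side is a sum of eight Virasoro relators.\<close>

lemma bracket_expansion:
  fixes u w a b d e1 e2 h :: "'r::ring_1"
  shows "(u + w) * ((a + b) + (b + d)) - ((a + b) + (b + d)) * (u + w)
      - ((h - 1 - 1) * ((e1 + e2) + (e2 + a)) + (h - 1 - 1 - 1) * ((e2 + a) + (a + b)))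
    = ((u * a - a * u - (h - 1 - 1) * e1) + (u * b - b * u - (h - 1 - 1 - 1) * e2))
    + ((u * b - b * u - (h - 1 - 1 - 1) * e2) + (u * d - d * u - (h - 1 - 1 - 1 - 1) * a))
    + (((w * a - a * w - (h - 1) * e2) + (w * b - b * w - (h - 1 - 1) * a))
    + ((w * b - b * w - (h - 1 - 1) * a) + (w * d - d * w - (h - 1 - 1 - 1) * b)))"
  by (simp only: distrib_left distrib_right left_diff_distrib right_diff_distrib mult_1_left) simp

text \<open>The commutator of \<open>Xop\<close> with \<open>Top n\<close> is again made of
  \<open>Top\<close> operators. This is why \<open>ker_span\<close> is stable under
  \<open>Xop\<close>.\<close>

lemma Xop_Top:
  assumes v: "v \<in> carrier V" and n: "n \<ge> 3"
  shows "Xop (Top n v) = Top n (Xop v) \<oplus> (of_int (int n - 2) \<odot> Top (n + 2) v \<oplus> of_int (int n - 3) \<odot> Top (n + 1) v)"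
proof -
  define Z :: "'k mode_alg" where "Z = mode (-2) + mode (-1)"
  define k where "k = int n"
  define h where "h = (of_int k :: 'k mode_alg)"
  define t where "t = (mode (- k) + mode (- k + 1)) + (mode (- k + 1) + (mode (- k + 2) :: 'k mode_alg))"
  define t1 where "t1 = (mode (- k - 1) + mode (- k)) + (mode (- k) + (mode (- k + 1) :: 'k mode_alg))"
  define t2 where "t2 = (mode (- k - 2) + mode (- k - 1)) + (mode (- k - 1) + (mode (- k) :: 'k mode_alg))"
  have k: "k \<ge> 3" using n by (simp add: k_def)
  have Z: "mact Z w = Xop w" if "w \<in> carrier V" for w
    using that by (simp only: Z_def Xop_def mact_add mact_mode)
  have t: "mact t w = Top n w" if "w \<in> carrier V" for w
    using that by (simp only: t_def Top_def mact_add mact_mode k_def)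
  have t1: "mact t1 w = Top (n + 1) w" if "w \<in> carrier V" for w
  proof -
    have "- int (n + 1) = - k - 1" "- k - 1 + 1 = - k" "- k - 1 + 2 = - k + 1" by (simp_all add: k_def)
    with that show ?thesis by (simp only: t1_def Top_def mact_add mact_mode)
  qed
  have t2: "mact t2 w = Top (n + 2) w" if "w \<in> carrier V" for w
  proof -
    have "- int (n + 2) = - k - 2" "- k - 2 + 1 = - k - 1" "- k - 2 + 2 = - k" by (simp_all add: k_def)
    with that show ?thesis by (simp only: t2_def Top_def mact_add mact_mode)
  qed
  have r: "mode a * mode b - mode b * mode a - q * mode s \<in> ann" if "a + b = s" "s \<noteq> 0" "of_int (a - b) = q" for a b s q
    using mrel_ne[of a b] that by simp
  have "Z * t - t * Z - ((h - 1 - 1) * t2 + (h - 1 - 1 - 1) * t1) \<in> ann"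
    unfolding Z_def t_def t1_def t2_def bracket_expansion
    by (intro ann_add r; (use k in \<open>simp add: h_def\<close>))
  moreover have "of_int (k - 2) = h - 1 - 1" "of_int (k - 3) = h - 1 - 1 - 1" by (simp_all add: h_def)
  ultimately have "Z * t - (t * Z + (of_int (k - 2) * t2 + of_int (k - 3) * t1)) \<in> ann"
    by (simp only: diff_diff_eq)
  from annD[OF this v] show ?thesis
    unfolding mact_mult[OF v] mact_add[OF v] mact_of_int_mult[OF v] t[OF v] t1[OF v] t2[OF v] Z[OF v]
    using v by (simp only: Z t Top_carrier Xop_carrier k_def of_int_eq_mconst mact_mconst)
qed

lemma Xop_ker_span: "v \<in> ker_span \<Longrightarrow> Xop v \<in> ker_span"
proof -
  note D = is_subspaceD[OF ker_span_subspace]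
  define N where "N = {v \<in> carrier V. Xop v \<in> ker_span}"
  have "is_subspace V N"
    unfolding N_def
    by (rule is_subspaceI) (use D(2-4) in \<open>auto simp: vlinear.map_zero[OF Xop_linear] vlinear.map_add[OF Xop_linear] vlinear.map_smult[OF Xop_linear]\<close>)
  moreover have "{Top n v | n v. n \<ge> 3 \<and> v \<in> carrier V} \<subseteq> N"
    unfolding N_def using Top_in_ker_span by (auto simp: Xop_Top intro!: D(3,4))
  ultimately have "ker_span \<subseteq> N"
    unfolding ker_span_def by (intro lin_span_minimal)
  then show "v \<in> ker_span \<Longrightarrow> Xop v \<in> ker_span" by (auto simp: N_def)
qed

text \<open>\<open>xpoly w f\<close> is \<open>f(X) w\<close>.\<close>

definition xpoly :: "'v \<Rightarrow> 'k poly \<Rightarrow> 'v"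
  where "xpoly w f = fold_coeffs (\<lambda>a v. a \<odot> w \<oplus> Xop v) f \<zero>"

lemma xpoly_0 [simp]: "xpoly w 0 = \<zero>"
  by (simp add: xpoly_def)

lemma xpoly_pCons: "w \<in> carrier V \<Longrightarrow> xpoly w (pCons a f) = a \<odot> w \<oplus> Xop (xpoly w f)"
  using vlinear.map_zero[OF Xop_linear]
  by (cases "a = 0 \<and> f = 0") (auto simp: xpoly_def)

lemma xpoly_in:
  assumes "is_subspace V N" "\<And>v. v \<in> N \<Longrightarrow> Xop v \<in> N" "w \<in> N"
  shows "xpoly w f \<in> N"
  using assms is_subspaceD[OF assms(1)] by (induction f) (auto simp: xpoly_pCons subset_iff)

lemma xpoly_carrier [simp]: "w \<in> carrier V \<Longrightarrow> xpoly w f \<in> carrier V"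
  by (rule xpoly_in[OF is_subspace_carrier]) auto

lemma xpoly_add: "w \<in> carrier V \<Longrightarrow> xpoly w (f + g) = xpoly w f \<oplus> xpoly w g"
proof (induction f arbitrary: g)
  case (pCons a f)
  obtain b g' where g: "g = pCons b g'" by (cases g)
  from pCons show ?case
    by (simp add: g xpoly_pCons vlinear.map_add[OF Xop_linear] smult_add M.a_ac)
qed simp

lemma xpoly_smult: "w \<in> carrier V \<Longrightarrow> xpoly w (Polynomial.smult a f) = a \<odot> xpoly w f"
  by (induction f) (simp_all add: xpoly_pCons vlinear.map_smult[OF Xop_linear] smult_vadd smult_smult)

lemma ev_xpoly: "w \<in> carrier V \<Longrightarrow> ev (xpoly w f) = f * ev w"
  by (induction f) (simp_all add: xpoly_pCons ev.fun_add ev.fun_smult ev_Xop xx_def)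

text \<open>\<open>Xop\<close> corresponds to multiplication by the indeterminate on both summands,
  and \<open>Top\<close> lands in \<open>ker_span\<close> while \<open>ev\<close> kills it. So the
  vectors with this property are closed under the two operators and contain the vacuum.\<close>

lemma diff_xpoly_ker_span:
  assumes "v \<in> carrier V"
  shows "v \<ominus> xpoly (vac V) (ev v) \<in> ker_span"
proof -
  note D = is_subspaceD[OF ker_span_subspace]
  define N where "N = {v \<in> carrier V. v \<ominus> xpoly (vac V) (ev v) \<in> ker_span}"
  have "is_subspace V N"
  proof (rule is_subspaceI)
    fix u v assume "u \<in> N" "v \<in> N"
    then have uv: "u \<in> carrier V" "v \<in> carrier V" and
      "(u \<ominus> xpoly (vac V) (ev u)) \<oplus> (v \<ominus> xpoly (vac V) (ev v)) \<in> ker_span"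
      using D(3) by (auto simp: N_def)
    moreover have "(u \<ominus> xpoly (vac V) (ev u)) \<oplus> (v \<ominus> xpoly (vac V) (ev v)) = (u \<oplus> v) \<ominus> xpoly (vac V) (ev (u \<oplus> v))"
      using uv by (simp add: ev.fun_add xpoly_add M.minus_eq M.minus_add M.a_ac)
    ultimately show "u \<oplus> v \<in> N" by (simp add: N_def)
  next
    fix a v assume "v \<in> N"
    then have v: "v \<in> carrier V" and "a \<odot> (v \<ominus> xpoly (vac V) (ev v)) \<in> ker_span"
      using D(4) by (auto simp: N_def)
    then show "a \<odot> v \<in> N" by (simp add: N_def smult_vdiff ev.fun_smult xpoly_smult)
  qed (auto simp: N_def D(2) M.minus_eq)
  moreover have "Xop v \<in> N" if "v \<in> N" for v
  proof -
    have v: "v \<in> carrier V" and "Xop (v \<ominus> xpoly (vac V) (ev v)) \<in> ker_span"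
      using that Xop_ker_span by (auto simp: N_def)
    then show ?thesis
      by (simp add: N_def vlinear.map_diff[OF Xop_linear] ev_Xop xx_def xpoly_pCons)
  qed
  moreover have "Top n v \<in> N" if "v \<in> N" "n \<ge> 3" for n v
    using that Top_in_ker_span[of n v] by (simp add: N_def ev_Top M.minus_eq)
  moreover have "vac V \<in> N"
    using xpoly_pCons[of "vac V" 1 0] vlinear.map_zero[OF Xop_linear]
    by (simp add: N_def ev_vac D(2) flip: one_pCons)
  ultimately have "N = carrier V" by (intro tx_closed_vac) (auto simp: tx_closed_def)
  with assms show ?thesis by (auto simp: N_def)
qed

lemma ker_ev: "v \<in> carrier V \<Longrightarrow> ev v = 0 \<Longrightarrow> v \<in> ker_span"
  using diff_xpoly_ker_span[of v] by (simp add: M.minus_eq)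

end

context virasoro
begin

subsection \<open>The central elements \<open>L\<^bsub>-n\<^esub>\<^sup>p - \<delta> L\<^bsub>-np\<^esub>\<close>\<close>

lemma of_int_mode_alg_eq_0: "int p dvd a \<Longrightarrow> (of_int a :: 'k mode_alg) = 0"
  using of_nat_mode_alg_eq_0[OF char_p] by (auto elim!: dvdE)

lemma of_int_k_eq_0_iff: "(of_int a :: 'k) = 0 \<longleftrightarrow> int p dvd a"
  using of_int_eq_0_iff_char_dvd[where 'a = 'k] char_p by simp

lemma of_int_power_p: "(of_int a :: 'k) ^ p = of_int a"
proof (cases "a \<ge> 0")
  case True
  then obtain n where "a = int n" by (metis nonneg_eq_int)
  then show ?thesis using of_nat_power_CHAR[OF char_p p_prime, of n] by simp
next
  case False
  then have "a = - int (nat (- a))" by simp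
  then obtain n where "a = - int n" by blast
  have "(- of_nat n :: 'k) ^ p = - (of_nat n ^ p)"
    by (rule minus_power_prime_CHAR) (use char_p p_prime in auto)
  then show ?thesis
    by (simp only: \<open>a = - int n\<close> of_int_minus of_int_of_nat_eq of_nat_power_CHAR[OF char_p p_prime])
qed

text \<open>Integer form of the product formula for y^p - y, read off at constant polynomials;
  Fermat's little theorem gives y^p = y.\<close>

lemma int_prod_shift: "int p dvd (\<Prod>j<p. y + int (j * n)) - (if p dvd n then y else 0)"
proof -
  define a where "a = (of_int y :: 'k)"
  have "(\<Prod>j<p. [:a:] + of_nat (j * n)) = [:a:] ^ p - (if p dvd n then 0 else [:a:])"
    by (rule prod_shift_multiples_char[OF char_p p_prime])
  moreover have "[:a:] ^ p = [:a:]" unfolding a_def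
    using of_int_power_p[of y] by (simp add: poly_const_pow)
  ultimately have "(\<Prod>j<p. [:a:] + of_nat (j * n)) = (if p dvd n then [:a:] else 0)" by simp
  then have "poly (\<Prod>j<p. [:a:] + of_nat (j * n)) 0 = poly (if p dvd n then [:a:] else 0) 0" by simp
  then have "(\<Prod>j<p. a + of_nat (j * n)) = (if p dvd n then a else 0)"
    by (simp add: poly_prod del: of_nat_mult)
  then have "(of_int ((\<Prod>j<p. y + int (j * n)) - (if p dvd n then y else 0)) :: 'k) = 0"
    by (simp add: a_def)
  then show ?thesis by (simp only: of_int_k_eq_0_iff)
qed

text \<open>The product of the structure constants of L(-n) with L(k - j n) for j < i.\<close>

definition adcoef :: "int \<Rightarrow> int \<Rightarrow> nat \<Rightarrow> int"
  where "adcoef n k i = (\<Prod>j<i. - (k + n) + int j * n)"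

text \<open>A scalar produced by one commutator is killed by the next, so \<open>e\<close> comes
  from the last step alone. The second conjunct records its value.\<close>

lemma ad_mode_power:
  "\<exists>e. (ad (mode (- n)) ^^ i) (mode k) - (of_int (adcoef n k i) * mode (k - int i * n) + mconst e) \<in> ann
    \<and> (\<forall>i'. i = Suc i' \<longrightarrow> e = of_int (adcoef n k i') * (vir_cocycle (- n) (k - int i' * n) * c))"
proof (induction i)
  case 0
  show ?case by (intro exI[of _ 0]) (simp add: adcoef_def mconst_def ann_zero)
next
  case (Suc i)
  define x :: "'k mode_alg" where "x = mode (- n)"
  define P where "P = adcoef n k i"
  define b where "b = k - int i * n"
  define z where "z = (ad x ^^ i) (mode k)"
  obtain e where e: "z - (of_int P * mode b + mconst e) \<in> ann"
    using Suc unfolding x_def P_def b_def z_def by blast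
  define e' where "e' = of_int P * (vir_cocycle (- n) b * c)"
  have "ad x z - ad x (of_int P * mode b + mconst e) \<in> ann"
    using ann_diff[OF ann_mult_left[OF e, of x] ann_mult_right[OF e, of x]]
    by (simp add: ad_def algebra_simps)
  moreover have "ad x (of_int P * mode b + mconst e) - (of_int (adcoef n k (Suc i)) * mode (k - int (Suc i) * n) + mconst e') \<in> ann"
  proof -
    have "ad x (of_int P * mode b + mconst e) = of_int P * (x * mode b - mode b * x)"
      using mconst_commute[of e x] mult_of_int_commute[of P x]
      by (simp add: ad_def algebra_simps) (simp flip: mult.assoc)
    also have "\<dots> = of_int P * mrel (- n) b + (of_int P * (of_int (- n - b) * mode (- n + b)) + of_int P * mconst (vir_cocycle (- n) b * c))"
      by (simp add: mrel_def x_def algebra_simps)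
    also have "of_int P * mconst (vir_cocycle (- n) b * c) = mconst e'"
      unfolding e'_def by (simp only: of_int_eq_mconst mconst_def mult_single add_0_left)
    also have "of_int P * (of_int (- n - b) * mode (- n + b)) = of_int (adcoef n k (Suc i)) * mode (k - int (Suc i) * n)"
    proof -
      have "P * (- n - b) = adcoef n k (Suc i)" "- n + b = k - int (Suc i) * n"
        by (simp_all add: P_def adcoef_def b_def algebra_simps)
      then show ?thesis by (metis mult.assoc of_int_mult)
    qed
    finally show ?thesis using ann_mult_left[OF mrel_ann[of "- n" b], of "of_int P"] by simp
  qed
  ultimately have "(ad x z - ad x (of_int P * mode b + mconst e)) + (ad x (of_int P * mode b + mconst e)
     - (of_int (adcoef n k (Suc i)) * mode (k - int (Suc i) * n) + mconst e')) \<in> ann"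
    by (rule ann_add)
  moreover have "(u1 - u2) + (u2 - u3) = u1 - u3" for u1 u2 u3 :: "'k mode_alg" by simp
  ultimately have "ad x z - (of_int (adcoef n k (Suc i)) * mode (k - int (Suc i) * n) + mconst e') \<in> ann"
    by (simp only:)
  then show ?case
    unfolding x_def z_def by (intro exI[of _ e']) (auto simp: e'_def P_def b_def)
qed

lemma mode_power_p_commutator:
  "mode (- int n) ^ p * mode k - mode k * mode (- int n) ^ p
    - (if p dvd n then of_int (- (k + int n)) * mode (k - int p * int n) else 0) \<in> ann"
proof -
  have p0: "(of_nat p :: 'k mode_alg) = 0" by (rule of_nat_mode_alg_eq_0[OF char_p])
  obtain e where e: "(ad (mode (- int n)) ^^ p) (mode k) - (of_int (adcoef (int n) k p) * mode (k - int p * int n) + mconst e) \<in> ann"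
    and e': "\<And>i'. p = Suc i' \<Longrightarrow> e = of_int (adcoef (int n) k i') * (vir_cocycle (- int n) (k - int i' * int n) * c)"
    using ad_mode_power[of p "int n" k] by blast
  obtain i' where i': "p = Suc i'" "i' \<ge> 2" using p_ge_3 by (cases p) auto
  have "e = 0"
  proof (cases "- int n + (k - int i' * int n) = 0")
    case True
    then have k: "k = int p * int n" using i' by (simp add: algebra_simps)
    \<comment> \<open>The cocycle can be nonzero only for k = p n; then the factor
      \<open>j = 1\<close> is - k, divisible by p. It occurs because p - 1 \<ge> 2.\<close>
    have "- (k + int n) + int 1 * int n dvd adcoef (int n) k i'"
      unfolding adcoef_def by (rule dvd_prodI) (use i' in auto)
    moreover have "int p dvd - (k + int n) + int 1 * int n" by (simp add: k)
    ultimately have "int p dvd adcoef (int n) k i'" by (rule dvd_trans[rotated])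
    then show ?thesis using e'[OF i'(1)] of_int_k_eq_0_iff by simp
  next
    case False
    then show ?thesis using e'[OF i'(1)] by (simp add: vir_cocycle_def)
  qed
  moreover have "of_int (adcoef (int n) k p) * mode (k - int p * int n)
     = (if p dvd n then of_int (- (k + int n)) * mode (k - int p * int n) else (0 :: 'k mode_alg))"
  proof -
    have "int p dvd adcoef (int n) k p - (if p dvd n then - (k + int n) else 0)"
      using int_prod_shift[of "- (k + int n)" n] by (simp add: adcoef_def)
    then have "of_int (adcoef (int n) k p - (if p dvd n then - (k + int n) else 0)) = (0 :: 'k mode_alg)"
      by (rule of_int_mode_alg_eq_0)
    then have "of_int (adcoef (int n) k p) = (if p dvd n then of_int (- (k + int n)) else (0 :: 'k mode_alg))"
      by (simp split: if_splits)
    then show ?thesis by (simp split: if_splits)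
  qed
  ultimately show ?thesis
    using e unfolding power_prime_commutator[OF p_prime p0] by (simp add: mconst_def)
qed

text \<open>This is x^p minus the image of x under the p-map of the restricted Virasoro algebra, at
  x = L(-n).\<close>

definition Cmode :: "nat \<Rightarrow> 'k mode_alg"
  where "Cmode n = mode (- int n) ^ p - (if p dvd n then mode (- int n * int p) else 0)"

lemma vir_cocycle_p: "p dvd n \<Longrightarrow> vir_cocycle (- int n * int p) k = (0 :: 'k)"
proof (cases "- int n * int p + k = 0")
  case True
  assume "p dvd n"
  then obtain t where n: "n = p * t" by blast
  define N where "N = int n * int p"
  have "6 * ichoose (1 - N) 3 = N * (1 - N * N) * 1"
    using six_ichoose_3[of "1 - N"] by (simp add: algebra_simps)
  \<comment> \<open>For p = 3 one factor p is used up by the 6, hence divisibility by the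
    square.\<close>
  moreover have "int p * int p dvd N" by (simp add: N_def n)
  ultimately have pp: "int p * int p dvd 6 * ichoose (1 - N) 3" by (metis dvd_mult2)
  have "int p dvd ichoose (1 - N) 3"
  proof (cases "p = 3")
    case True
    then have "3 dvd 2 * ichoose (1 - N) 3" using pp by presburger
    then show ?thesis using True by presburger
  next
    case False
    have "prime (int p)" using p_prime by simp
    moreover have "\<not> int p dvd 6"
    proof
      assume "int p dvd 6"
      then have "p dvd 2 * 3" by presburger
      then have "p dvd 2 \<or> p dvd 3" using p_prime prime_dvd_mult_iff by blast
      then show False using p_ge_3 False
        by (metis dvd_imp_le le_antisym less_le_trans nat_neq_iff not_less numeral_3_eq_3 numeral_2_eq_2 lessI zero_less_numeral)
    qed
    moreover have "int p dvd 6 * ichoose (1 - N) 3" using pp dvd_mult_left by blast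
    ultimately show ?thesis by (simp add: prime_dvd_mult_iff)
  qed
  then show ?thesis using of_int_k_eq_0_iff by (simp add: vir_cocycle_def ibinom_ichoose N_def)
qed (simp add: vir_cocycle_def)

lemma Cmode_commute: "Cmode n * mode k - mode k * Cmode n \<in> ann"
proof (cases "p dvd n")
  case False
  then show ?thesis using mode_power_p_commutator[of n k] by (simp add: Cmode_def)
next
  case True
  define q :: "'k mode_alg" where "q = mode (- int n) ^ p"
  define m where "m = - int n * int p"
  have 1: "q * mode k - mode k * q - of_int (- (k + int n)) * mode (k - int p * int n) \<in> ann"
    using mode_power_p_commutator[of n k] True by (simp add: q_def)
  have 2: "mode m * mode k - mode k * mode m - of_int (m - k) * mode (m + k) \<in> ann"
    using mrel_ann[of m k] vir_cocycle_p[OF True, of k] by (simp add: mrel_def m_def mconst_def)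
  have "int p dvd - (k + int n) - (m - k)"
    using True unfolding m_def by (simp add: algebra_simps)
  then have "of_int (- (k + int n) - (m - k)) = (0 :: 'k mode_alg)" by (rule of_int_mode_alg_eq_0)
  then have 3: "of_int (- (k + int n)) = (of_int (m - k) :: 'k mode_alg)" by (simp only: of_int_diff right_minus_eq)
  have 4: "k - int p * int n = m + k" by (simp add: m_def)
  have "(q - mode m) * mode k - mode k * (q - mode m) \<in> ann"
    using ann_diff[OF 1 2] unfolding 3 4 by (simp add: algebra_simps)
  then show ?thesis using True by (simp add: Cmode_def q_def m_def)
qed

definition sv :: "nat \<Rightarrow> 'v"
  where "sv n = mact (Cmode n) (vac V)"

lemma sv_eq: "sv n = (L (- int n) ^^ p) (vac V) \<ominus> (if p dvd n then L (- int n * int p) (vac V) else \<zero>)"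
proof -
  have "(mact (mode (- int n)) ^^ r) (vac V) = (L (- int n) ^^ r) (vac V) \<and> (L (- int n) ^^ r) (vac V) \<in> carrier V" for r
    by (induction r) (auto simp: mact_mode)
  then show ?thesis by (simp add: sv_def Cmode_def mact_diff mact_power mact_mode)
qed

lemma sv_carrier [simp]: "sv n \<in> carrier V"
  by (simp add: sv_def)

lemma mact_Cmode_L: "v \<in> carrier V \<Longrightarrow> mact (Cmode n) (L k v) = L k (mact (Cmode n) v)"
  using annD[OF Cmode_commute, of v n k] by (simp add: mact_mult mact_mode)

lemma L_sv: "k \<ge> -1 \<Longrightarrow> L k (sv n) = \<zero>"
  using mact_Cmode_L[of "vac V" n k] by (simp add: sv_def L_vac vlinear.map_zero[OF mact_linear])

lemma L_funpow_grading: "v \<in> grading V d \<Longrightarrow> (L k ^^ r) v \<in> grading V (d - int r * k)"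
proof (induction r)
  case (Suc r)
  have "d - int (Suc r) * k = d - int r * k - k" by (simp add: algebra_simps)
  moreover have "(L k ^^ Suc r) v = L k ((L k ^^ r) v)" by simp
  ultimately show ?case using L_grading[OF Suc.IH[OF Suc.prems], of k] by (simp only:)
qed simp

lemma sv_grading: "sv n \<in> grading V (int (n * p))"
  unfolding sv_eq using L_funpow_grading[OF vac_degree, of p "- int n"] L_grading[OF vac_degree, of "- int n * int p"]
    grading_subspaceD(2)[of "int (n * p)"]
  by (intro grading_subspaceD(5)) (auto simp: mult.commute)

lemma L0_hom_comp: "v \<in> carrier V \<Longrightarrow> L 0 (hom_comp V v d) = of_int d \<odot> hom_comp V v d"
proof -
  define N where "N = {v \<in> carrier V. \<forall>d. L 0 (hom_comp V v d) = of_int d \<odot> hom_comp V v d}"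
  have "is_subspace V N"
    unfolding N_def
    by (rule is_subspaceI) (auto simp: hom_comp_add hom_comp_smult L_add L_smult smult_vadd smult_smult mult.commute)
  moreover have "L n v \<in> N" if v: "v \<in> N" for n v
  proof -
    have vc: "v \<in> carrier V" and v0: "L 0 (hom_comp V v d) = of_int d \<odot> hom_comp V v d" for d
      using v by (auto simp: N_def)
    have "L 0 (L n (hom_comp V v (d + n))) = of_int d \<odot> L n (hom_comp V v (d + n))" for d
    proof (cases "n = 0")
      case True
      then show ?thesis using vc v0[of d] by (simp add: L_smult)
    next
      case False
      have "L 0 (L n (hom_comp V v (d + n))) = of_int (d + n) \<odot> L n (hom_comp V v (d + n)) \<oplus> of_int (0 - n) \<odot> L n (hom_comp V v (d + n))"
        using L_commute[of "hom_comp V v (d + n)" 0 n] Lrem_ne[of 0 n "hom_comp V v (d + n)"] False vc v0[of "d + n"]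
        by (simp add: L_smult)
      also have "\<dots> = of_int d \<odot> L n (hom_comp V v (d + n))"
      proof -
        have "of_int (d + n) + of_int (0 - n) = (of_int d :: 'k)" by simp
        then show ?thesis using vc by (simp only: smult_add[symmetric] L_carrier hom_comp_carrier)
      qed
      finally show ?thesis .
    qed
    then show ?thesis using vc by (simp add: N_def hom_comp_L)
  qed
  moreover have "vac V \<in> N"
    by (auto simp: N_def hom_comp_homogeneous[OF vac_degree] L_vac)
  ultimately have "N = carrier V" by (intro vir_closed_vac) (auto simp: vir_closed_def)
  then show "v \<in> carrier V \<Longrightarrow> L 0 (hom_comp V v d) = of_int d \<odot> hom_comp V v d" by (auto simp: N_def)
qed

lemma L0_grading: "v \<in> grading V d \<Longrightarrow> L 0 v = of_int d \<odot> v"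
  using L0_hom_comp[of v d] grading_carrier[of v d] by (simp add: hom_comp_homogeneous)

text \<open>Under \<open>ev\<close>, L(-1) is - L(0), and L(0) is the degree.\<close>

lemma ev_L_neg_grading:
  assumes "v \<in> grading V d" "n \<ge> 1"
  shows "ev (L (- int n) v) = (-1) ^ n * (of_int (int n - 1) * xx + of_int d) * ev v"
  using ev_L_neg[OF grading_carrier[OF assms(1)] assms(2)] ev_L_minus_one[OF grading_carrier[OF assms(1)]]
    L0_grading[OF assms(1)] grading_carrier[OF assms(1)]
  by (simp add: ev.fun_smult of_int_poly algebra_simps)

definition qq :: "'k poly" where "qq = xx ^ p - xx"

lemma ev_L_funpow: "n \<ge> 1 \<Longrightarrow> ev ((L (- int n) ^^ r) (vac V))
    = (-1) ^ (n * r) * (\<Prod>j<r. of_int (int n - 1) * xx + of_nat (j * n))"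
proof (induction r)
  case (Suc r)
  have "(L (- int n) ^^ r) (vac V) \<in> grading V (int (r * n))"
    using L_funpow_grading[OF vac_degree, of r "- int n"] by simp
  from ev_L_neg_grading[OF this Suc.prems] Suc show ?case
    by (simp add: power_add mult_ac)
qed (simp add: ev_vac)

text \<open>With y = (n - 1) x the product from \<open>ev_L_funpow\<close> is y^p - y or y^p,
  according to whether p divides n. In the second case the missing term comes from L(-n p), since n
  p - 1 and n - 1 agree modulo p.\<close>

lemma ev_sv:
  assumes "n \<ge> 1"
  shows "ev (sv n) = (-1) ^ (n * p) * of_int (int n - 1) * qq"
proof -
  define y where "y = of_int (int n - 1) * xx"
  have yp: "y ^ p = of_int (int n - 1) * xx ^ p"
  proof -
    have "(of_int (int n - 1) :: 'k poly) ^ p = of_int (int n - 1)"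
      using of_int_power_p[of "int n - 1"] by (simp add: of_int_poly poly_const_pow del: of_int_diff)
    then show ?thesis by (simp only: y_def power_mult_distrib)
  qed
  have 1: "ev ((L (- int n) ^^ p) (vac V)) = (-1) ^ (n * p) * (y ^ p - (if p dvd n then 0 else y))"
    unfolding ev_L_funpow[OF assms] prod_shift_multiples_char[OF char_p p_prime] y_def ..
  have cp: "(L (- int n) ^^ p) (vac V) \<in> carrier V"
    using L_funpow_grading[OF vac_degree] grading_carrier by blast
  show ?thesis
  proof (cases "p dvd n")
    case False
    then have "ev (sv n) = (-1) ^ (n * p) * (y ^ p - y)"
      unfolding sv_eq using 1 cp by (simp add: ev.fun_diff)
    then show ?thesis unfolding yp unfolding qq_def y_def by (simp add: algebra_simps)
  next
    case True
    have 2: "ev (L (- int (n * p)) (vac V)) = (-1) ^ (n * p) * (of_int (int (n * p) - 1) * xx)"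
      using ev_L_neg_grading[OF vac_degree, of "n * p"] assms p_ge_3 by (simp add: ev_vac)
    have "of_int (int (n * p) - int n) = (0 :: 'k poly)"
    proof -
      have "int p dvd int (n * p) - int n" using True by (intro dvd_diff) auto
      then have "(of_int (int (n * p) - int n) :: 'k) = 0" by (simp only: of_int_k_eq_0_iff)
      then show ?thesis by (simp only: of_int_poly pCons_0_0)
    qed
    then have 3: "of_int (int (n * p) - 1) = (of_int (int n - 1) :: 'k poly)" by (simp add: algebra_simps)
    have "- int n * int p = - int (n * p)" by simp
    then have "ev (sv n) = (-1) ^ (n * p) * y ^ p - (-1) ^ (n * p) * (of_int (int n - 1) * xx)"
      unfolding sv_eq using 1 2 3 cp True by (simp add: ev.fun_diff del: of_int_diff)
    then show ?thesis unfolding yp qq_def by (simp add: algebra_simps)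
  qed
qed

subsection \<open>The submodule \<open>I\<^sub>0\<close>\<close>

definition I0 :: "'v set"
  where "I0 = vir_closed hull {sv n | n. n \<ge> 2}"

lemma sv_set_carrier: "{sv n | n. n \<ge> 2} \<subseteq> carrier V"
  by auto

lemma I0_closed: "vir_closed I0"
  unfolding I0_def by (rule vir_closed_hull[OF sv_set_carrier])

lemmas I0_subspace = vir_closedD(1)[OF I0_closed]
  and I0_L = vir_closedD(2)[OF I0_closed]
  and I0_subspaceD = is_subspaceD[OF vir_closedD(1)[OF I0_closed]]

lemma sv_I0: "n \<ge> 2 \<Longrightarrow> sv n \<in> I0"
  unfolding I0_def using hull_subset[of "{sv n | n. n \<ge> 2}" vir_closed] by blast

lemma I0_minimal: "vir_closed N \<Longrightarrow> (\<And>n. n \<ge> 2 \<Longrightarrow> sv n \<in> N) \<Longrightarrow> I0 \<subseteq> N"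
  unfolding I0_def by (rule hull_minimal) auto

text \<open>The generators are singular, so closing them under \<open>Xop\<close> and
  \<open>Top\<close> already yields a Virasoro submodule. Under \<open>ev\<close> these operators
  are multiplication by the indeterminate and zero.\<close>

lemma I0_minimal_tx:
  assumes "tx_closed N" "\<And>n. n \<ge> 2 \<Longrightarrow> sv n \<in> N"
  shows "I0 \<subseteq> N"
proof -
  have "vir_closed (tx_closed hull {sv n | n. n \<ge> 2})"
    by (rule tx_closed_hull_vir_closed) (auto simp: L_sv)
  then have "I0 \<subseteq> tx_closed hull {sv n | n. n \<ge> 2}"
    by (rule I0_minimal) (use hull_subset[of "{sv n | n. n \<ge> 2}" tx_closed] in blast)
  also have "\<dots> \<subseteq> N" by (rule hull_minimal) (use assms in auto)
  finally show ?thesis .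
qed

lemma ev_I0: "v \<in> I0 \<Longrightarrow> qq dvd ev v"
proof -
  define N where "N = {v \<in> carrier V. qq dvd ev v}"
  have "tx_closed N"
    unfolding tx_closed_def N_def
    by (intro conjI is_subspaceI) (auto simp: ev.fun_add ev.fun_smult ev_Xop ev_Top dvd_smult)
  then have "I0 \<subseteq> N" by (rule I0_minimal_tx) (auto simp: N_def ev_sv)
  then show "v \<in> I0 \<Longrightarrow> qq dvd ev v" by (auto simp: N_def)
qed

lemma I0_ev_surj: "qq dvd f \<Longrightarrow> \<exists>v\<in>I0. ev v = f"
proof -
  assume "qq dvd f"
  then obtain g where g: "f = qq * g" by blast
  have "xpoly (sv 2) g \<in> I0"
    by (rule xpoly_in[OF I0_subspace]) (auto simp: sv_I0 Xop_def intro!: I0_subspaceD(3) I0_L)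
  moreover have "ev (xpoly (sv 2) g) = f"
  proof -
    have "(-1 :: 'k poly) ^ (2 * p) = 1" by simp
    then show ?thesis using ev_sv[of 2] by (simp add: ev_xpoly g mult.commute del: power_mult)
  qed
  ultimately show ?thesis by blast
qed

lemma I0_hom_comp: "v \<in> I0 \<Longrightarrow> hom_comp V v d \<in> I0"
proof -
  define N where "N = {v \<in> carrier V. \<forall>d. hom_comp V v d \<in> I0}"
  have "vir_closed N"
    unfolding vir_closed_def N_def
    by (intro conjI is_subspaceI) (auto simp: hom_comp_add hom_comp_smult hom_comp_L I0_subspaceD(2-4) I0_L)
  then have "I0 \<subseteq> N"
    by (rule I0_minimal) (auto simp: N_def hom_comp_homogeneous[OF sv_grading] sv_I0 I0_subspaceD(2))
  then show "v \<in> I0 \<Longrightarrow> hom_comp V v d \<in> I0" by (auto simp: N_def)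
qed

end

context virasoro
begin

subsection \<open>\<open>I\<^sub>0\<close> is an ideal\<close>

text \<open>The divided powers \<open>D\<^bsup>(j)\<^esup>\<close> of the translation operator.\<close>

definition hasse :: "int \<Rightarrow> 'v \<Rightarrow> 'v"
  where "hasse j v = nprod V v (- 1 - j) (vac V)"

lemma hasse_neg: "j < 0 \<Longrightarrow> v \<in> carrier V \<Longrightarrow> hasse j v = \<zero>"
  by (simp add: hasse_def creation(1))

lemma hasse_carrier [simp]: "v \<in> carrier V \<Longrightarrow> hasse j v \<in> carrier V"
  by (simp add: hasse_def)

lemma hasse_linear: "vlinear V V (hasse j)"
  unfolding hasse_def[abs_def] by (rule nprod_linear_left) simp

lemma hasse_L:
  "v \<in> carrier V \<Longrightarrow> hasse j (L k v) =
    fsum V (\<lambda>i. ((-1) ^ i * ibinom (k + 1) i) \<odot> L (k - int i) (hasse (j - int i) v))"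
  unfolding hasse_def L_eq using iterate_vacuum[of om v "k + 1" "- 1 - j"]
  by (simp add: algebra_simps)

lemma mact_sum: "v \<in> carrier V \<Longrightarrow> mact (\<Sum>i\<in>S. f i) v = (\<Oplus>i\<in>S. mact (f i) v)"
proof (induction S rule: infinite_finite_induct)
  case (insert i S)
  then have "(\<lambda>i. mact (f i) v) \<in> S \<rightarrow> carrier V" by auto
  with insert show ?case by (simp add: mact_add)
qed (auto simp: M.finsum_infinite)

text \<open>
  The truncation at \<open>i \<le> N\<close> of \<open>e\<^bsup>zD\<^esup> L\<^bsub>-n\<^esub> e\<^bsup>-zD\<^esup> = \<Sum>\<^sub>i (-1)\<^sup>i binom(1-n, i) z\<^sup>i L\<^bsub>-n-i\<^esub>\<close> at \<open>z = 1\<close>. The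
  powers of \<open>z\<close> are recovered from the grading.
\<close>

definition transl_coef :: "nat \<Rightarrow> nat \<Rightarrow> int"
  where "transl_coef n i = (-1) ^ i * ichoose (1 - int n) i"

definition transl_mode :: "nat \<Rightarrow> nat \<Rightarrow> 'k mode_alg"
  where "transl_mode n N = (\<Sum>i\<le>N. of_int (transl_coef n i) * mode (- int (n + i)))"

lemma mact_transl_mode:
  "v \<in> carrier V \<Longrightarrow> mact (transl_mode n N) v = (\<Oplus>i\<in>{..N}. of_int (transl_coef n i) \<odot> L (- int (n + i)) v)"
  unfolding transl_mode_def by (simp add: mact_sum mact_of_int_mult mact_mode)

lemma hom_comp_mact_transl_mode:
  assumes "v \<in> carrier V"
  shows "hom_comp V (mact (transl_mode n N) v) d
    = (\<Oplus>i\<in>{..N}. of_int (transl_coef n i) \<odot> L (- int (n + i)) (hom_comp V v (d - int (n + i))))"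
proof -
  have e: "hom_comp V (L (- int (n + i)) v) d = L (- int (n + i)) (hom_comp V v (d - int (n + i)))" for i
    using hom_comp_L[OF assms, of "- int (n + i)" d] by (simp only: add_uminus_conv_diff)
  have "hom_comp V (mact (transl_mode n N) v) d
    = (\<Oplus>i\<in>{..N}. hom_comp V (of_int (transl_coef n i) \<odot> L (- int (n + i)) v) d)"
    unfolding mact_transl_mode[OF assms] using assms by (intro vlinear.map_finsum[OF hom_comp_linear]) simp
  then show ?thesis using assms by (simp only: hom_comp_smult L_carrier e)
qed

text \<open>exp(zD) fixes the vacuum, so exp(zD) L(-n)^r 1 is the r-th power of the conjugated mode
  applied to 1. Its i-th summand carries z^i and raises the degree by n + i; hence the coefficient
  of z^j is the part of degree r n + j, and \<open>N \<ge> j\<close> loses nothing there.\<close>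

lemma hasse_L_funpow:
  "j \<le> int N \<Longrightarrow> hasse j ((L (- int n) ^^ r) (vac V))
    = hom_comp V (mact (transl_mode n N ^ r) (vac V)) (int (r * n) + j)"
proof (induction r arbitrary: j)
  case 0
  show ?case by (simp add: mact_1 hom_comp_homogeneous[OF vac_degree] hasse_def vacuum)
next
  case (Suc r)
  define u where "u = (L (- int n) ^^ r) (vac V)"
  define w where "w = mact (transl_mode n N ^ r) (vac V)"
  have u: "u \<in> carrier V" unfolding u_def using L_funpow_grading[OF vac_degree] grading_carrier by blast
  have w: "w \<in> carrier V" by (simp add: w_def)
  have IH: "hasse j' u = hom_comp V w (int (r * n) + j')" if "j' \<le> int N" for j'
    unfolding u_def w_def by (rule Suc.IH[OF that])
  have "hasse j (L (- int n) u) = fsum V (\<lambda>i. ((-1) ^ i * ibinom (- int n + 1) i) \<odot> L (- int n - int i) (hasse (j - int i) u))"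
    by (rule hasse_L[OF u])
  also have "\<dots> = (\<Oplus>i\<in>{..N}. ((-1) ^ i * ibinom (- int n + 1) i) \<odot> L (- int n - int i) (hasse (j - int i) u))"
    by (rule fsum_eq_finsum) (use u Suc.prems in \<open>auto simp: hasse_neg\<close>)
  also have "\<dots> = (\<Oplus>i\<in>{..N}. of_int (transl_coef n i) \<odot> L (- int (n + i)) (hom_comp V w (int (Suc r * n) + j - int (n + i))))"
  proof (rule M.finsum_cong')
    fix i assume "i \<in> {..N}"
    have 1: "- int n - int i = - int (n + i)" "int (r * n) + (j - int i) = int (Suc r * n) + j - int (n + i)"
      by (simp_all add: algebra_simps)
    have 2: "(-1) ^ i * ibinom (- int n + 1) i = (of_int (transl_coef n i) :: 'k)"
      by (simp add: ibinom_ichoose transl_coef_def)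
    have 3: "hasse (j - int i) u = hom_comp V w (int (r * n) + (j - int i))"
      using Suc.prems by (intro IH) simp
    show "((-1) ^ i * ibinom (- int n + 1) i) \<odot> L (- int n - int i) (hasse (j - int i) u)
      = of_int (transl_coef n i) \<odot> L (- int (n + i)) (hom_comp V w (int (Suc r * n) + j - int (n + i)))"
      unfolding 2 3 unfolding 1 ..
  qed (use w in auto)
  also have "\<dots> = hom_comp V (mact (transl_mode n N) w) (int (Suc r * n) + j)"
    by (rule hom_comp_mact_transl_mode[OF w, symmetric])
  finally show ?case by (simp add: u_def w_def mact_mult)
qed

text \<open>The additive group generated by the modes L(-i), i \<ge> 2, up to elements acting as
  zero. Closure under \<open>ann\<close> lets brackets be evaluated, and no two of these indices add
  up to 0, so central terms never occur. Integer coefficients suffice for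
  \<open>transl_mode\<close>.\<close>

inductive_set lie_modes :: "'k mode_alg set"
  where
    mode: "i \<ge> 2 \<Longrightarrow> mode (- int i) \<in> lie_modes"
  | zero: "0 \<in> lie_modes"
  | diff: "f \<in> lie_modes \<Longrightarrow> g \<in> lie_modes \<Longrightarrow> f - g \<in> lie_modes"
  | ann: "f \<in> lie_modes \<Longrightarrow> g - f \<in> ann \<Longrightarrow> g \<in> lie_modes"

lemma lie_modes_add: "f \<in> lie_modes \<Longrightarrow> g \<in> lie_modes \<Longrightarrow> f + g \<in> lie_modes"
  using lie_modes.diff[of f "0 - g"] lie_modes.diff[OF lie_modes.zero, of g] by simp

lemma lie_modes_of_int: "f \<in> lie_modes \<Longrightarrow> of_int k * f \<in> lie_modes"
proof -
  assume f: "f \<in> lie_modes"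
  have n: "of_nat n * f \<in> lie_modes" for n
    by (induction n) (auto simp: distrib_right lie_modes.zero intro!: lie_modes_add f)
  show ?thesis
  proof (cases "k \<ge> 0")
    case True
    then have "of_int k * f = of_nat (nat k) * f" by simp
    then show ?thesis using n by simp
  next
    case False
    then have "of_int k = (0 - of_nat (nat (- k)) :: 'k mode_alg)" by simp
    then have "of_int k * f = 0 - of_nat (nat (- k)) * f" by (simp only: left_diff_distrib mult_zero_left)
    then show ?thesis using lie_modes.diff[OF lie_modes.zero n] by simp
  qed
qed

lemma lie_modes_ad: "f \<in> lie_modes \<Longrightarrow> g \<in> lie_modes \<Longrightarrow> ad f g \<in> lie_modes"
proof (induction f rule: lie_modes.induct)
  case i: (mode i)
  from i(2) show ?case
  proof (induction g rule: lie_modes.induct)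
    case (mode j)
    have "- int i + - int j \<noteq> 0" using i by simp
    from mrel_ne[OF this] have "ad (mode (- int i)) (mode (- int j)) - of_int (- int i - - int j) * mode (- int i + - int j) \<in> ann"
      unfolding ad_def .
    moreover have "mode (- int i + - int j) \<in> lie_modes"
      using lie_modes.mode[of "i + j"] i(1) by simp
    ultimately show ?case using lie_modes.ann lie_modes_of_int by blast
  next
    case (diff g h)
    have "ad (mode (- int i)) (g - h) = ad (mode (- int i)) g - ad (mode (- int i)) h"
      by (simp add: ad_def algebra_simps)
    with diff show ?case by (simp add: lie_modes.diff)
  next
    case (ann g h)
    have "ad (mode (- int i)) h - ad (mode (- int i)) g = mode (- int i) * (h - g) - (h - g) * mode (- int i)"
      by (simp add: ad_def algebra_simps)
    then have "ad (mode (- int i)) h - ad (mode (- int i)) g \<in> ann"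
      using ann_diff[OF ann_mult_left[OF ann(2)] ann_mult_right[OF ann(2)]] by simp
    with ann show ?case using lie_modes.ann by blast
  qed (simp add: ad_def lie_modes.zero)
next
  case (diff f h)
  have "ad (f - h) g = ad f g - ad h g" by (simp add: ad_def algebra_simps)
  with diff show ?case by (simp add: lie_modes.diff)
next
  case (ann f h)
  have "ad h g - ad f g = (h - f) * g - g * (h - f)" by (simp add: ad_def algebra_simps)
  then have "ad h g - ad f g \<in> ann"
    using ann_diff[OF ann_mult_right[OF ann(2)] ann_mult_left[OF ann(2)]] by simp
  with ann show ?case using lie_modes.ann by blast
qed (simp add: ad_def lie_modes.zero)

lemma lie_subring_lie_modes: "lie_subring lie_modes"
  by unfold_locales (auto intro: lie_modes.zero lie_modes.diff lie_modes_ad)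

text \<open>
  The sum of the singular vectors of \<open>I\<^sub>0\<close> and the line through \<open>L\<^bsub>-m\<^esub> 1\<close>. By Jacobson's formula
  it contains the degree-\<open>m\<close> part of the divided powers of \<open>(L\<^bsub>-n\<^esub>\<^sup>p - \<delta> L\<^bsub>-np\<^esub>) 1\<close>.
\<close>

definition sing_part :: "nat \<Rightarrow> 'v set"
  where "sing_part m = {v. \<exists>s a. v = s \<oplus> a \<odot> L (- int m) (vac V) \<and> s \<in> I0 \<and> (\<forall>k\<ge>-1. L k s = \<zero>)}"

lemma sing_part_subspace: "is_subspace V (sing_part m)"
proof (rule is_subspaceI)
  show "sing_part m \<subseteq> carrier V" using I0_subspaceD(1) by (auto simp: sing_part_def)
  show "\<zero> \<in> sing_part m" unfolding sing_part_def
    using I0_subspaceD(2) by (intro CollectI exI[of _ "\<zero>"] exI[of _ 0]) simp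
next
  fix u v assume "u \<in> sing_part m" "v \<in> sing_part m"
  then obtain s a t b where u: "u = s \<oplus> a \<odot> L (- int m) (vac V)" "s \<in> I0" "\<forall>k\<ge>-1. L k s = \<zero>"
    and v: "v = t \<oplus> b \<odot> L (- int m) (vac V)" "t \<in> I0" "\<forall>k\<ge>-1. L k t = \<zero>"
    unfolding sing_part_def by blast
  have st: "s \<in> carrier V" "t \<in> carrier V" using u v I0_subspaceD(1) by auto
  have "u \<oplus> v = (s \<oplus> t) \<oplus> (a + b) \<odot> L (- int m) (vac V)"
    using st by (simp add: u(1) v(1) smult_add M.a_ac)
  moreover have "s \<oplus> t \<in> I0" "\<forall>k\<ge>-1. L k (s \<oplus> t) = \<zero>"
    using u v st by (auto simp: L_add intro: I0_subspaceD(3))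
  ultimately show "u \<oplus> v \<in> sing_part m" unfolding sing_part_def by blast
next
  fix x u assume "u \<in> sing_part m"
  then obtain s a where u: "u = s \<oplus> a \<odot> L (- int m) (vac V)" "s \<in> I0" "\<forall>k\<ge>-1. L k s = \<zero>"
    unfolding sing_part_def by blast
  have s: "s \<in> carrier V" using u I0_subspaceD(1) by auto
  have "x \<odot> u = x \<odot> s \<oplus> (x * a) \<odot> L (- int m) (vac V)"
    using s by (simp add: u(1) smult_vadd smult_smult)
  moreover have "x \<odot> s \<in> I0" "\<forall>k\<ge>-1. L k (x \<odot> s) = \<zero>"
    using u s by (auto simp: L_smult intro: I0_subspaceD(4))
  ultimately show "x \<odot> u \<in> sing_part m" unfolding sing_part_def by blast
qed

lemmas sing_part_subspaceD = is_subspaceD[OF sing_part_subspace]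

lemma L_vac_sing_part: "L (- int m) (vac V) \<in> sing_part m"
  unfolding sing_part_def
  using I0_subspaceD(2) by (intro CollectI exI[of _ "\<zero>"] exI[of _ 1]) simp

lemma sv_sing_part: "n \<ge> 2 \<Longrightarrow> sv n \<in> sing_part m"
  unfolding sing_part_def
  using sv_I0 L_sv by (intro CollectI exI[of _ "sv n"] exI[of _ 0]) simp

lemma lie_modes_sing_part: "f \<in> lie_modes \<Longrightarrow> hom_comp V (mact f (vac V)) (int m) \<in> sing_part m"
proof (induction f rule: lie_modes.induct)
  case (mode i)
  have "L (- int i) (vac V) \<in> grading V (int i)" using L_grading[OF vac_degree, of "- int i"] by simp
  then show ?case
    using L_vac_sing_part sing_part_subspaceD(2) by (auto simp: mact_mode hom_comp_homogeneous)
next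
  case (diff f g)
  then show ?case by (simp add: mact_diff hom_comp_diff sing_part_subspaceD(5))
next
  case (ann f g)
  then show ?case using annD[OF ann(2), of "vac V"] by simp
qed (simp add: sing_part_subspaceD(2))

lemma of_int_mult_power: "(of_int a * f) ^ r = of_int (a ^ r) * (f :: 'k mode_alg) ^ r"
proof (induction r)
  case (Suc r)
  have "f * (of_int (a ^ r) * f ^ r) = of_int (a ^ r) * (f * f ^ r)"
    using mult_of_int_commute[of "a ^ r" f] by (simp flip: mult.assoc)
  with Suc show ?case by (simp add: mult.assoc)
qed simp

text \<open>The p-th power splits into the central element, which yields \<open>sv n\<close>, and
  its p-map image, which is a single mode or zero.\<close>

lemma mode_power_sing_part:
  assumes "n \<ge> 2"
  shows "hom_comp V (mact (mode (- int n) ^ p) (vac V)) (int m) \<in> sing_part m"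
proof -
  have eq: "mode (- int n) ^ p = Cmode n + (if p dvd n then mode (- int n * int p) else 0)"
    by (simp add: Cmode_def)
  have "hom_comp V (sv n) (int m) \<in> sing_part m"
    using sv_sing_part[OF assms] sing_part_subspaceD(2) by (simp add: hom_comp_homogeneous[OF sv_grading])
  moreover have "hom_comp V (mact (if p dvd n then mode (- int n * int p) else 0) (vac V)) (int m) \<in> sing_part m"
  proof (rule lie_modes_sing_part)
    have "n * p \<ge> 2" using assms p_ge_3 mult_le_mono[of 2 n 1 p] by simp
    from lie_modes.mode[OF this] show "(if p dvd n then mode (- int n * int p) else 0) \<in> lie_modes"
      by (simp add: lie_modes.zero)
  qed
  ultimately show ?thesis
    unfolding eq by (simp only: mact_add vac_carrier hom_comp_add mact_carrier sv_def[symmetric] sv_carrier sing_part_subspaceD(3))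
qed

lemma transl_mode_term: "n \<ge> 2 \<Longrightarrow> of_int (transl_coef n i) * mode (- int (n + i)) \<in> lie_modes"
  by (intro lie_modes_of_int lie_modes.mode) simp

lemma transl_mode_lie: "n \<ge> 2 \<Longrightarrow> transl_mode n N \<in> lie_modes"
  unfolding transl_mode_def by (rule lie_subring.sum[OF lie_subring_lie_modes]) (rule transl_mode_term)

text \<open>The p-th power of the translated mode is the sum of the p-th powers of its terms plus an
  element of \<open>lie_modes\<close>. Both kinds of contribution lie in \<open>sing_part\<close>;
  the subtracted L(-n p) is the case of exponent 1.\<close>

lemma hasse_sv_sing_part:
  assumes n: "n \<ge> 2"
  shows "hasse (int j) (sv n) \<in> sing_part (n * p + j)"
proof -
  have p0: "(of_nat p :: 'k mode_alg) = 0" by (rule of_nat_mode_alg_eq_0[OF char_p])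
  define x where "x i = of_int (transl_coef n i) * (mode (- int (n + i)) :: 'k mode_alg)" for i
  define m where "m = n * p + j"
  have "transl_mode n j ^ p - (\<Sum>i\<le>j. x i ^ p) \<in> lie_modes"
    unfolding transl_mode_def x_def
    by (rule lie_subring.power_sum_prime[OF lie_subring_lie_modes p_prime p0]) (simp, rule transl_mode_term[OF n])
  then have "hom_comp V (mact (transl_mode n j ^ p - (\<Sum>i\<le>j. x i ^ p)) (vac V)) (int m) \<in> sing_part m"
    by (rule lie_modes_sing_part)
  moreover have "hom_comp V (mact (\<Sum>i\<le>j. x i ^ p) (vac V)) (int m) \<in> sing_part m"
  proof -
    have *: "hom_comp V (mact (x i ^ p) (vac V)) (int m) \<in> sing_part m" for i
      using mode_power_sing_part[of "n + i" m] n
      by (simp only: x_def of_int_mult_power mact_of_int_mult vac_carrier hom_comp_smult mact_carrier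
          sing_part_subspaceD(4) trans_le_add1)
    show ?thesis
      unfolding mact_sum[OF vac_carrier]
      by (subst vlinear.map_finsum[OF hom_comp_linear])
        (auto intro!: subspace_finsum_closed[OF sing_part_subspace] *)
  qed
  ultimately have "hom_comp V (mact (transl_mode n j ^ p) (vac V)) (int m) \<in> sing_part m"
  proof -
    define y where "y = (\<Sum>i\<le>j. x i ^ p)"
    have "mact (transl_mode n j ^ p) (vac V) = mact (transl_mode n j ^ p - y) (vac V) \<oplus> mact y (vac V)"
      using mact_add[of "vac V" "transl_mode n j ^ p - y" y] by simp
    moreover assume "hom_comp V (mact (transl_mode n j ^ p - (\<Sum>i\<le>j. x i ^ p)) (vac V)) (int m) \<in> sing_part m"
      "hom_comp V (mact (\<Sum>i\<le>j. x i ^ p) (vac V)) (int m) \<in> sing_part m"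
    ultimately show ?thesis by (simp add: hom_comp_add sing_part_subspaceD(3) flip: y_def)
  qed
  then have 1: "hasse (int j) ((L (- int n) ^^ p) (vac V)) \<in> sing_part m"
    using hasse_L_funpow[of "int j" j p n] by (simp add: m_def mult.commute)
  have 2: "hasse (int j) (if p dvd n then L (- int n * int p) (vac V) else \<zero>) \<in> sing_part m"
  proof -
    have "n * p \<ge> 2" using n p_ge_3 mult_le_mono[of 2 n 1 p] by simp
    then have "hasse (int j) (L (- int (n * p)) (vac V)) \<in> sing_part m"
      using hasse_L_funpow[of "int j" j 1 "n * p"] lie_modes_sing_part[OF transl_mode_lie, of "n * p" j m]
      by (simp add: m_def)
    then show ?thesis using sing_part_subspaceD(2) by (simp add: vlinear.map_zero[OF hasse_linear])
  qed
  have "(L (- int n) ^^ p) (vac V) \<in> carrier V" using L_funpow_grading[OF vac_degree] grading_carrier by blast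
  then show ?thesis
    using 1 2 sing_part_subspaceD(5) unfolding sv_eq m_def[symmetric]
    by (subst vlinear.map_diff[OF hasse_linear]) auto
qed

text \<open>All nonnegative modes of \<omega> annihilate the singular vector, so the commutator
  formula has no terms.\<close>

lemma L_nprod_sv: "b \<in> carrier V \<Longrightarrow> L k (nprod V (sv n) m b) = nprod V (sv n) m (L k b)"
proof -
  assume b: "b \<in> carrier V"
  have "nprod V om (int i) (sv n) = \<zero>" for i
    using L_sv[of "int i - 1" n] by (simp add: L_eq)
  then have "fsum V (\<lambda>i. ibinom (k + 1) i \<odot> nprod V (nprod V om (int i) (sv n)) (k + 1 + m - int i) b) = \<zero>"
    using b by (intro fsum_zero) simp
  with commutator[OF om_carrier sv_carrier[of n] b, of "k + 1" m]
  have "L k (nprod V (sv n) m b) \<ominus> nprod V (sv n) m (L k b) = \<zero>" by (simp add: L_eq)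
  then show ?thesis by (rule diff_eq_zeroD) (use b in auto)
qed

text \<open>The divided power is itself singular, hence so is the surplus multiple of L(-m) 1 in
  \<open>sing_part\<close>. Such a multiple must vanish: L(0) shows this if p does not divide m, and
  otherwise L(-1) followed by L(1) does.\<close>

lemma hasse_sv_I0:
  assumes n: "n \<ge> 2"
  shows "hasse (int j) (sv n) \<in> I0"
proof -
  define m where "m = n * p + j"
  have "hasse (int j) (sv n) \<in> sing_part m" unfolding m_def by (rule hasse_sv_sing_part[OF n])
  then obtain s a where s: "hasse (int j) (sv n) = s \<oplus> a \<odot> L (- int m) (vac V)" "s \<in> I0" "\<forall>k\<ge>-1. L k s = \<zero>"
    unfolding sing_part_def by blast
  have sc: "s \<in> carrier V" using s I0_subspaceD(1) by auto
  have m: "m \<ge> 2" using n p_ge_3 mult_le_mono[of 2 n 1 p] by (simp add: m_def)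
  have zero: "a \<odot> L k (L (- int m) (vac V)) = \<zero>" if "k \<ge> -1" for k
  proof -
    have "L k (hasse (int j) (sv n)) = \<zero>"
      unfolding hasse_def using L_nprod_sv[of "vac V" k n] that by (simp add: L_vac)
    then show ?thesis unfolding s(1) using s(3) that sc by (simp add: L_add L_smult)
  qed
  have com: "L k (L (- int r) (vac V)) = of_int (k + int r) \<odot> L (k - int r) (vac V)"
    if "k \<ge> -1" "k \<noteq> int r" for k r
    using L_commute[of "vac V" k "- int r"] Lrem_ne[of k "- int r" "vac V"] that by (simp add: L_vac)
  have "a \<odot> L (- int m) (vac V) = \<zero>"
  proof (cases "int p dvd int m")
    case False
    have "of_int (int m) \<odot> (a \<odot> L (- int m) (vac V)) = \<zero>"
      using zero[of 0] com[of 0 m] m by (simp add: smult_smult mult.commute)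
    then show ?thesis by (rule smult_eq_zeroD) (use False of_int_k_eq_0_iff[of "int m"] in auto)
  next
    case True
    have nz: "(of_int (int m - 1) :: 'k) \<noteq> 0" "(of_int (int m + 2) :: 'k) \<noteq> 0"
    proof -
      have "\<not> int p dvd int m - 1"
      proof
        assume "int p dvd int m - 1"
        with True have "int p dvd int m - (int m - 1)" by (rule dvd_diff)
        then show False using p_ge_3 by simp
      qed
      then show "(of_int (int m - 1) :: 'k) \<noteq> 0" using of_int_k_eq_0_iff by blast
      have "\<not> int p dvd int m + 2"
      proof
        assume "int p dvd int m + 2"
        then have "int p dvd (int m + 2) - int m" using True by (rule dvd_diff)
        then show False using p_ge_3 zdvd_imp_le[of "int p" 2] by simp
      qed
      then show "(of_int (int m + 2) :: 'k) \<noteq> 0" using of_int_k_eq_0_iff by blast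
    qed
    \<comment> \<open>L(-1) and then L(1) bring L(-m) 1 back to itself with the factors m - 1 and m
      + 2. Both are units when p divides m, because p \<ge> 3.\<close>
    have i: "-1 - int m = - int (m + 1)" "1 - int (m + 1) = - int m" "1 + int (m + 1) = int m + 2" "-1 + int m = int m - 1"
      by auto
    have "of_int (int m - 1) \<odot> (a \<odot> L (- int (m + 1)) (vac V)) = \<zero>"
      using zero[of "-1"] com[of "-1" m, unfolded i] by (simp add: smult_smult mult.commute del: of_int_diff)
    then have "a \<odot> L (- int (m + 1)) (vac V) = \<zero>"
      by (rule smult_eq_zeroD) (use nz in auto)
    then have "L 1 (a \<odot> L (- int (m + 1)) (vac V)) = \<zero>" by simp
    moreover have "L 1 (L (- int (m + 1)) (vac V)) = of_int (int m + 2) \<odot> L (- int m) (vac V)"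
      using com[of 1 "m + 1", unfolded i] m by simp
    ultimately have "of_int (int m + 2) \<odot> (a \<odot> L (- int m) (vac V)) = \<zero>"
      by (simp add: L_smult smult_smult mult.commute del: of_int_add)
    then show ?thesis by (rule smult_eq_zeroD) (use nz in auto)
  qed
  then show ?thesis using s sc by simp
qed

text \<open>Modes of \<open>sv n\<close> commute with every L(k), which reduces \<open>b\<close> to
  the vacuum. There nonnegative modes give zero and negative ones are the divided powers of
  translation.\<close>

lemma nprod_sv_I0:
  assumes n: "n \<ge> 2" and b: "b \<in> carrier V"
  shows "nprod V (sv n) m b \<in> I0"
proof -
  define N where "N = {b \<in> carrier V. \<forall>m. nprod V (sv n) m b \<in> I0}"
  have "vir_closed N"
    unfolding vir_closed_def N_def
    by (intro conjI is_subspaceI)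
      (auto simp: nprod_add_right nprod_smult_right I0_subspaceD(2-4) I0_L simp flip: L_nprod_sv)
  moreover have "vac V \<in> N"
  proof -
    have "nprod V (sv n) m (vac V) \<in> I0" for m
    proof (cases "m \<ge> 0")
      case True
      then show ?thesis by (simp add: creation(1) I0_subspaceD(2))
    next
      case False
      then show ?thesis using hasse_sv_I0[OF n, of "nat (- 1 - m)"] by (simp add: hasse_def)
    qed
    then show ?thesis by (simp add: N_def)
  qed
  ultimately have "N = carrier V" by (rule vir_closed_vac)
  with b show ?thesis by (auto simp: N_def)
qed

text \<open>By the iterate formula, the vectors whose modes map V into \<open>I0\<close> form a
  Virasoro submodule; it contains the generators.\<close>

lemma I0_right:
  assumes w: "w \<in> I0" and b: "b \<in> carrier V"
  shows "nprod V w m b \<in> I0"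
proof -
  define N where "N = {u \<in> carrier V. \<forall>m. \<forall>b\<in>carrier V. nprod V u m b \<in> I0}"
  have "L k u \<in> N" if u: "u \<in> N" for k u
  proof -
    have uc: "u \<in> carrier V" and u': "nprod V u m b \<in> I0" if "b \<in> carrier V" for m b
      using u that by (auto simp: N_def)
    have "nprod V (nprod V om (k + 1) u) m b \<in> I0" if b: "b \<in> carrier V" for m b
      unfolding iterate[OF om_carrier uc[OF b] b]
    proof (intro I0_subspaceD(5) fsum_in_subspace[OF I0_subspace] I0_subspaceD(4))
      fix i
      show "nprod V om (k + 1 - int i) (nprod V u (m + int i) b) \<in> I0"
        using I0_L[OF u'[OF b, of "m + int i"], of "k - int i"] by (simp add: L_eq algebra_simps)
      show "nprod V u (m + (k + 1) - int i) (nprod V om (int i) b) \<in> I0"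
        by (rule u') (simp add: b)
    qed
    then show ?thesis using u by (auto simp: N_def L_eq)
  qed
  then have "vir_closed N"
    unfolding vir_closed_def N_def
    by (intro conjI is_subspaceI) (auto simp: nprod_add_left nprod_smult_left I0_subspaceD(2-4))
  then have "I0 \<subseteq> N" by (rule I0_minimal) (auto simp: N_def nprod_sv_I0)
  with w b show ?thesis by (auto simp: N_def)
qed

lemma I0_left:
  assumes w: "w \<in> I0" and a: "a \<in> carrier V"
  shows "nprod V a m w \<in> I0"
proof -
  have I0V: "w \<in> carrier V" if "w \<in> I0" for w using that I0_subspaceD(1) by blast
  define N where "N = {u \<in> carrier V. \<forall>m. \<forall>w\<in>I0. nprod V u m w \<in> I0}"
  have "L k u \<in> N" if u: "u \<in> N" for k u
  proof -
    have uc: "u \<in> carrier V" and u': "\<And>m w. w \<in> I0 \<Longrightarrow> nprod V u m w \<in> I0"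
      using u by (auto simp: N_def)
    have om': "nprod V om m w \<in> I0" if "w \<in> I0" for m w
      using I0_L[OF that, of "m - 1"] by (simp add: L_eq)
    have "nprod V (nprod V om (k + 1) u) m w \<in> I0" if w: "w \<in> I0" for m w
      unfolding iterate[OF om_carrier uc I0V[OF w]]
      by (intro I0_subspaceD(5) fsum_in_subspace[OF I0_subspace] I0_subspaceD(4) om' u' w)
    then show ?thesis using u by (auto simp: N_def L_eq)
  qed
  then have "vir_closed N"
    unfolding vir_closed_def N_def
    by (intro conjI is_subspaceI) (auto simp: nprod_add_left nprod_smult_left I0_subspaceD(2-4) I0V)
  moreover have "vac V \<in> N" by (auto simp: N_def vacuum I0V I0_subspaceD(2))
  ultimately have "N = carrier V" by (rule vir_closed_vac)
  with w a show ?thesis by (auto simp: N_def)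
qed

lemma graded_ideal_I0: "graded_ideal V I0"
  by (intro graded_ideal.intro graded_ideal_axioms.intro graded_vertex_algebra_axioms I0_subspace I0_left I0_right I0_hom_comp)

end

section \<open>Iterated differences\<close>

text \<open>On the series with coefficient g(m) at z^(-m-1) this is multiplication by 1 + z, so
  \<open>sh ^^ d\<close> produces the factor (1 + z)^d of the Zhu products.\<close>

definition sh :: "(int \<Rightarrow> 'r::comm_ring_1) \<Rightarrow> int \<Rightarrow> 'r"
  where "sh g m = g m + g (m + 1)"

text \<open>On the same series this is d/dz; it describes how the modes of L(-1) a arise from those
  of a.\<close>

definition wt :: "(int \<Rightarrow> 'r::comm_ring_1) \<Rightarrow> int \<Rightarrow> 'r"
  where "wt g m = - of_int m * g (m - 1)"

lemma sh_pow_add: "(sh ^^ e) (\<lambda>m. g m + h m) = (\<lambda>m. (sh ^^ e) g m + (sh ^^ e) h m)"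
  by (induction e) (auto simp: sh_def fun_eq_iff)

lemma sh_pow_mult: "(sh ^^ e) (\<lambda>m. a * g m) = (\<lambda>m. a * (sh ^^ e) g m)"
  by (induction e) (auto simp: sh_def fun_eq_iff algebra_simps)

lemma sh_pow_diff: "(sh ^^ e) (\<lambda>m. g m - h m) = (\<lambda>m. (sh ^^ e) g m - (sh ^^ e) h m)"
  by (induction e) (auto simp: sh_def fun_eq_iff)

lemma sh_pow_0: "(sh ^^ e) (\<lambda>m. 0) = (\<lambda>m. 0)"
  by (induction e) (auto simp: sh_def fun_eq_iff)

lemma sh_pow_sum: "(sh ^^ e) (\<lambda>m. \<Sum>i\<in>A. g i m) = (\<lambda>m. \<Sum>i\<in>A. (sh ^^ e) (g i) m)"
  by (induction e) (auto simp: sh_def fun_eq_iff sum.distrib)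

lemma sh_pow_translate: "(sh ^^ e) (\<lambda>m. g (m + s)) = (\<lambda>m. (sh ^^ e) g (m + s))"
  by (induction e) (auto simp: sh_def fun_eq_iff algebra_simps)

lemma sh_pow_Suc: "(sh ^^ Suc e) g = sh ((sh ^^ e) g)"
  by simp

text \<open>The Leibniz rule (1 + z)^(e+1) G' = (1 + z) ((1 + z)^e G)' - e (1 + z)^e G.\<close>

lemma sh_pow_wt: "(sh ^^ Suc e) (wt g) m = sh (wt ((sh ^^ e) g)) m - of_nat e * (sh ^^ e) g m"
proof (induction e arbitrary: m)
  case (Suc e)
  define P where "P = (sh ^^ e) g"
  have IH: "(sh ^^ Suc e) (wt g) = (\<lambda>m. sh (wt P) m - of_nat e * P m)"
    using Suc by (simp add: P_def fun_eq_iff)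
  have "(sh ^^ Suc (Suc e)) (wt g) m = sh (\<lambda>m. sh (wt P) m - of_nat e * P m) m"
    using IH by simp
  also have "\<dots> = sh (wt (sh P)) m - of_nat (Suc e) * sh P m"
    by (simp add: sh_def wt_def algebra_simps)
  finally show ?case by (simp add: P_def)
qed simp

lemma sh_pow_binomial: "(sh ^^ e) g m = (\<Sum>i\<le>e. of_nat (e choose i) * g (m + int i))"
proof (induction e arbitrary: m)
  case (Suc e)
  have 1: "(\<Sum>i\<le>Suc e. of_nat (Suc e choose i) * g (m + int i))
    = g m + (\<Sum>i\<le>e. of_nat (e choose i) * g (m + 1 + int i)) + (\<Sum>i\<le>e. of_nat (e choose Suc i) * g (m + int (Suc i)))"
    unfolding sum.atMost_Suc_shift by (simp add: distrib_right sum.distrib add.assoc)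
  have "g m + (\<Sum>i\<le>e. of_nat (e choose Suc i) * g (m + int (Suc i))) = (\<Sum>i\<le>Suc e. of_nat (e choose i) * g (m + int i))"
    unfolding sum.atMost_Suc_shift by simp
  also have "(\<Sum>i\<le>Suc e. of_nat (e choose i) * g (m + int i)) = (\<Sum>i\<le>e. of_nat (e choose i) * g (m + int i))"
    by (simp add: binomial_eq_0)
  finally have 2: "g m + (\<Sum>i\<le>e. of_nat (e choose Suc i) * g (m + int (Suc i))) = (sh ^^ e) g m"
    using Suc by (simp add: binomial_eq_0)
  have "(\<Sum>i\<le>Suc e. of_nat (Suc e choose i) * g (m + int i))
    = (g m + (\<Sum>i\<le>e. of_nat (e choose Suc i) * g (m + int (Suc i)))) + (\<Sum>i\<le>e. of_nat (e choose i) * g (m + 1 + int i))"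
    unfolding 1 by (simp only: ac_simps)
  then show ?case unfolding 2 sh_pow_Suc sh_def[of "(sh ^^ e) g"] Suc[of "m + 1"] by (rule sym)
qed simp

text \<open>The sum \<open>h\<close> is a truncation of x (1 + z)^(-2) g - (1 + z)^(-1) k, so
  multiplying by (1 + z)^2 clears the denominators. The lengths N + 2, N + 1, N let all sums end at
  the same index, and the boundary terms cancel.\<close>

lemma alternating_second_difference:
  fixes x :: "'r::comm_ring_1" and g k :: "int \<Rightarrow> 'r"
  defines "h \<equiv> \<lambda>m N. \<Sum>i<N. (-1) ^ i * (of_nat (Suc i) * x * g (m + int i) - k (m + int i))"
  shows "h m (Suc (Suc N)) + h (m + 1) (Suc N) + (h (m + 1) (Suc N) + h (m + 2) N)
    = x * g m - k m - k (m + 1)"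
proof (induction N)
  case 0
  show ?case by (simp add: h_def algebra_simps)
next
  case (Suc N)
  define t where "t = (-1 :: 'r) ^ N"
  define G K where "G = g (m + int (Suc (Suc N)))" and "K = k (m + int (Suc (Suc N)))"
  have e: "m + 1 + int (Suc N) = m + int (Suc (Suc N))" "m + 2 + int N = m + int (Suc (Suc N))" by auto
  have "h m (Suc (Suc (Suc N))) = h m (Suc (Suc N)) + t * (of_nat (Suc (Suc (Suc N))) * x * G - K)"
    by (simp add: h_def G_def K_def t_def)
  moreover have "h (m + 1) (Suc (Suc N)) = h (m + 1) (Suc N) - t * (of_nat (Suc (Suc N)) * x * G - K)"
    unfolding h_def sum.lessThan_Suc[of _ "Suc N"] e by (simp add: G_def K_def t_def)
  moreover have "h (m + 2) (Suc N) = h (m + 2) N + t * (of_nat (Suc N) * x * G - K)"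
    unfolding h_def sum.lessThan_Suc e by (simp add: G_def K_def t_def)
  moreover have "(h1 + t * (of_nat (Suc (Suc (Suc N))) * x * G - K)) + (h2 - t * (of_nat (Suc (Suc N)) * x * G - K))
      + ((h2 - t * (of_nat (Suc (Suc N)) * x * G - K)) + (h3 + t * (of_nat (Suc N) * x * G - K)))
    = h1 + h2 + (h2 + h3)" for h1 h2 h3
    by (simp add: algebra_simps)
  ultimately show ?case using Suc by (simp only:)
qed

context virasoro
begin

subsection \<open>\<open>L\<^sub>-\<^sub>1\<close> and \<open>L\<^sub>-\<^sub>2\<close> generate\<close>

definition l12_closed :: "'v set \<Rightarrow> bool"
  where "l12_closed N \<longleftrightarrow> is_subspace V N \<and> vac V \<in> N \<and> (\<forall>v\<in>N. L (-1) v \<in> N \<and> L (-2) v \<in> N)"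

lemma l12_closed_hull: "l12_closed (l12_closed hull {})"
proof -
  have "l12_closed (carrier V)" by (simp add: l12_closed_def is_subspace_carrier)
  then have "{t. l12_closed t \<and> {} \<subseteq> t} \<noteq> {}" by blast
  then have "is_subspace V (\<Inter>{t. l12_closed t \<and> {} \<subseteq> t})"
    by (intro is_subspace_Inter) (auto simp: l12_closed_def)
  then show ?thesis by (auto simp: l12_closed_def hull_def)
qed

text \<open>The bracket of L(-1) with L(-(n-1)) is (n - 2) L(-n). If p divides n - 2, the bracket of
  L(-2) with L(-(n-2)) has coefficient n - 4, which is then a unit because p \<ge> 3. The remaining
  modes are brought in by commuting them to the vacuum.\<close>

lemma l12_closed_carrier:
  assumes "l12_closed A"
  shows "A = carrier V"
proof -
  define N where "N = l12_closed hull {}"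
  have "l12_closed N" unfolding N_def by (rule l12_closed_hull)
  then have sub: "is_subspace V N" and vac: "vac V \<in> N"
    and L1: "\<And>v. v \<in> N \<Longrightarrow> L (-1) v \<in> N" and L2: "\<And>v. v \<in> N \<Longrightarrow> L (-2) v \<in> N"
    by (auto simp: l12_closed_def)
  note D = is_subspaceD[OF sub]
  have NV: "v \<in> carrier V" if "v \<in> N" for v using D(1) that by blast
  have neg: "L (- int n) v \<in> N" if "n \<ge> 1" "v \<in> N" for n v
    using that
  proof (induction n arbitrary: v rule: less_induct)
    case (less n)
    have div: "L (- int n) v \<in> N"
      if l: "L (- int l) (L (- int k) v) \<in> N" "L (- int k) (L (- int l) v) \<in> N"
        and n: "n = l + k" and nz: "\<not> int p dvd int k - int l" for l k
    proof -
      have kl: "- int l + - int k = - int n" "- int l + - int k \<noteq> 0" "- int l - - int k = int k - int l"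
        using n less.prems by auto
      have co: "vir_cocycle (- int l) (- int k) = (0 :: 'k)"
        using kl(2) by (auto simp: vir_cocycle_def)
      have "of_int (int k - int l) \<odot> L (- int n) v = L (- int l) (L (- int k) v) \<ominus> L (- int k) (L (- int l) v)"
        using L_bracket[of v "- int l" "- int k"] NV[OF less.prems(2)] kl
        by (simp add: co kl(1,3) del: of_int_diff)
      then have "of_int (int k - int l) \<odot> L (- int n) v \<in> N" using D(5)[OF l] by simp
      then have "inverse (of_int (int k - int l)) \<odot> (of_int (int k - int l) \<odot> L (- int n) v) \<in> N"
        by (rule D(4))
      moreover have "(of_int (int k - int l) :: 'k) \<noteq> 0" using nz of_int_k_eq_0_iff by blast
      ultimately show ?thesis using NV[OF less.prems(2)] by (simp add: smult_smult del: of_int_diff)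
    qed
    consider "n = 1" | "n = 2" | "n \<ge> 3" "\<not> int p dvd int n - 2" | "n \<ge> 3" "int p dvd int n - 2"
      using less.prems by linarith
    then show ?case
    proof cases
      case 1
      then show ?thesis using L1 less.prems by simp
    next
      case 2
      then show ?thesis using L2 less.prems by simp
    next
      case 3
      have "int (n - 1) - int 1 = int n - 2" using 3 by auto
      moreover have "L (- int (n - 1)) w \<in> N" if "w \<in> N" for w
        by (rule less.IH) (use 3 that in auto)
      ultimately show ?thesis
        using div[of 1 "n - 1"] 3 less.prems L1 by simp
    next
      case 4
      have n5: "n \<ge> 5" using zdvd_imp_le[OF 4(2)] 4(1) p_ge_3 by auto
      have e: "int (n - 2) - int 2 = int n - 4" using n5 by auto
      have "\<not> int p dvd int n - 4"
      proof
        assume "int p dvd int n - 4"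
        with 4(2) have "int p dvd (int n - 2) - (int n - 4)" by (rule dvd_diff)
        then show False using p_ge_3 zdvd_imp_le[of "int p" 2] by simp
      qed
      moreover have "L (- int (n - 2)) w \<in> N" if "w \<in> N" for w
        by (rule less.IH) (use n5 that in auto)
      ultimately show ?thesis
        using div[of 2 "n - 2"] n5 less.prems L2 e by simp
    qed
  qed
  define M where "M = {v \<in> N. \<forall>k. L k v \<in> N}"
  have Msub: "is_subspace V M"
    unfolding M_def by (rule is_subspaceI) (use D NV in \<open>auto simp: L_add L_smult\<close>)
  have vacM: "vac V \<in> M"
  proof -
    have "L k (vac V) \<in> N" for k
      using neg[of "nat (- k)" "vac V"] vac D(2) L_vac[of k] by (cases "k \<ge> -1") auto
    then show ?thesis using vac by (simp add: M_def)
  qed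
  have step: "L j v \<in> M" if v: "v \<in> M" and j: "\<And>w. w \<in> N \<Longrightarrow> L j w \<in> N" for j v
  proof -
    have vN: "v \<in> N" and LN: "L k v \<in> N" for k using v by (auto simp: M_def)
    have "L k (L j v) \<in> N" for k
      unfolding L_commute[OF NV[OF vN], of k j] Lrem_def by (intro D(3,4) j LN vN)
    then show ?thesis using j[OF vN] by (simp add: M_def)
  qed
  have "l12_closed M"
    using Msub vacM step L1 L2 by (auto simp: l12_closed_def)
  then have "N \<subseteq> M" unfolding N_def by (intro hull_minimal) auto
  then have "vir_closed N" using sub by (auto simp: vir_closed_def M_def)
  then have "N = carrier V" using vac by (rule vir_closed_vac)
  moreover have "N \<subseteq> A" unfolding N_def using assms by (intro hull_minimal) auto
  moreover have "A \<subseteq> carrier V" using assms is_subspaceD(1)[of A] by (auto simp: l12_closed_def)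
  ultimately show ?thesis by blast
qed

text \<open>Both operators kill the vacuum and have the same commutator with each L(n).\<close>

lemma transl_eq: "v \<in> carrier V \<Longrightarrow> transl v = L (-1) v"
proof -
  define N where "N = {v \<in> carrier V. transl v = L (-1) v}"
  have lin: "vlinear V V transl" unfolding transl_def[abs_def] by (rule nprod_linear_left) simp
  have "is_subspace V N"
    unfolding N_def
    by (rule is_subspaceI)
      (auto simp: vlinear.map_add[OF lin] vlinear.map_smult[OF lin] vlinear.map_zero[OF lin] L_add L_smult)
  moreover have "L n v \<in> N" if v: "v \<in> N" for n v
  proof -
    have vc: "v \<in> carrier V" and tv: "transl v = L (-1) v" using v by (auto simp: N_def)
    have co: "vir_cocycle (-1) n = (0 :: 'k)" by (simp add: vir_cocycle_def ibinom_def numeral_3_eq_3)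
    have "transl (L n v) = L n (L (-1) v) \<ominus> of_int (n + 1) \<odot> L (n - 1) v"
      using transl_nprod[OF om_carrier vc, of "n + 1"] by (simp add: L_eq tv)
    also have "\<dots> = L n (L (-1) v) \<oplus> of_int (-1 - n) \<odot> L (-1 + n) v"
    proof -
      have "of_int (-1 - n) = - (of_int (n + 1) :: 'k)" "-1 + n = n - 1" by simp_all
      then show ?thesis using vc by (simp only: smult_uminus L_carrier M.minus_eq)
    qed
    also have "\<dots> = L (-1) (L n v)"
      using L_commute[OF vc, of "-1" n] vc by (simp add: Lrem_def co)
    finally show ?thesis using vc by (simp add: N_def)
  qed
  moreover have "vac V \<in> N" by (simp add: N_def transl_vac L_vac)
  ultimately have "N = carrier V" by (intro vir_closed_vac) (auto simp: vir_closed_def)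
  then show "v \<in> carrier V \<Longrightarrow> transl v = L (-1) v" by (auto simp: N_def)
qed

lemma L_minus_one_nprod:
  assumes "a \<in> carrier V" "b \<in> carrier V"
  shows "L (-1) (nprod V a n b) = nprod V a n (L (-1) b) \<ominus> of_int n \<odot> nprod V a (n - 1) b"
  using transl_nprod[OF assms] assms by (simp add: transl_eq)

lemma nprod_L_minus_one:
  assumes a: "a \<in> carrier V" and b: "b \<in> carrier V"
  shows "nprod V (L (-1) a) n b = (- of_int n) \<odot> nprod V a (n - 1) b"
proof -
  have "fsum V (\<lambda>i. ibinom 0 i \<odot> nprod V (nprod V om (int i) a) (0 + n - int i) b)
    = ibinom 0 0 \<odot> nprod V (nprod V om (int 0) a) (0 + n - int 0) b"
    by (rule fsum_single) (use a b in auto)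
  then have "L (-1) (nprod V a n b) \<ominus> nprod V a n (L (-1) b) = nprod V (L (-1) a) n b"
    using commutator[OF om_carrier a b, of 0 n] a b by (simp add: L_eq)
  moreover have "(x \<ominus> y) \<ominus> x = \<ominus> y" if "x \<in> carrier V" "y \<in> carrier V" for x y
    using that by (simp add: M.minus_eq M.a_ac M.r_neg2 M.r_neg1)
  ultimately show ?thesis
    using a b by (simp add: L_minus_one_nprod smult_uminus)
qed

subsection \<open>The functional turns the Zhu product into the product of polynomials\<close>

text \<open>For \<open>a\<close> of degree \<open>e\<close> this says, for all \<open>b\<close> at
  once, that \<open>ev\<close> sends a * b (index -1) to the product and every a \<circ> b (smaller
  indices) to 0.\<close>

definition corr_prod :: "nat \<Rightarrow> 'v \<Rightarrow> bool"
  where "corr_prod e a \<longleftrightarrow> (\<forall>b\<in>carrier V. \<forall>m\<le>-1.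
    (sh ^^ e) (\<lambda>m. ev (nprod V a m b)) m = (if m = -1 then ev a * ev b else 0))"

lemma corr_prod_L_minus_one:
  assumes a: "a \<in> grading V (int e)" and good: "corr_prod e a"
  shows "corr_prod (Suc e) (L (-1) a)"
  unfolding corr_prod_def
proof (intro ballI allI impI)
  fix b and m :: int
  assume b: "b \<in> carrier V" and m: "m \<le> -1"
  have ac: "a \<in> carrier V" by (rule grading_carrier[OF a])
  define G where "G = (\<lambda>m. ev (nprod V a m b))"
  define P where "P = (sh ^^ e) G"
  have P: "P n = (if n = -1 then ev a * ev b else 0)" if "n \<le> -1" for n
    using good that b unfolding corr_prod_def P_def G_def by blast
  have eva: "ev (L (-1) a) = - of_nat e * ev a"
    using ev_L_minus_one[OF ac] L0_grading[OF a] ac by (simp add: ev.fun_smult of_nat_poly)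
  have "(\<lambda>m. ev (nprod V (L (-1) a) m b)) = wt G"
    using ac b by (simp add: fun_eq_iff nprod_L_minus_one wt_def G_def ev.fun_smult of_int_poly smult_minus_left)
  then have "(sh ^^ Suc e) (\<lambda>m. ev (nprod V (L (-1) a) m b)) m = sh (wt P) m - of_nat e * P m"
    by (simp only: sh_pow_wt P_def)
  also have "\<dots> = - of_int m * P (m - 1) - of_int (m + 1) * P m - of_nat e * P m"
    by (simp add: sh_def wt_def algebra_simps)
  also have "\<dots> = (if m = -1 then ev (L (-1) a) * ev b else 0)"
    using P[of m] P[of "m - 1"] m by (simp add: eva)
  finally show "(sh ^^ Suc e) (\<lambda>m. ev (nprod V (L (-1) a) m b)) m = (if m = -1 then ev (L (-1) a) * ev b else 0)" .
qed

text \<open>The iterate formula for the mode -1 of \<omega>, with the recursion for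
  \<open>ev\<close> applied to the modes L(-(i+2)) that stand on the left. \<open>N\<close> and
  \<open>M\<close> bound the nonzero terms of the two sums.\<close>

lemma ev_nprod_L_minus_two:
  assumes a: "a \<in> carrier V" and b: "b \<in> carrier V"
    and tr: "\<And>n. n \<ge> m + int N \<Longrightarrow> nprod V a n b = \<zero>" and tr': "\<And>i. i \<ge> M \<Longrightarrow> L (int i - 1) b = \<zero>"
  shows "ev (nprod V (L (-2) a) m b)
    = (\<Sum>i<N. (-1) ^ i * (of_nat (Suc i) * xx * ev (nprod V a (m + int i) b) - ev (L (-1) (nprod V a (m + int i) b))))
      + (\<Sum>i<M. ev (nprod V a (m - 1 - int i) (L (int i - 1) b)))"
proof -
  define f g where "f i = L (- int (i + 2)) (nprod V a (m + int i) b)"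
    and "g i = nprod V a (m - 1 - int i) (L (int i - 1) b)" for i
  have fc: "f i \<in> carrier V" "g i \<in> carrier V" for i using a b by (simp_all add: f_def g_def)
  have sq: "(-1) ^ i * (-1) ^ i = (1 :: 'k)" for i by (simp flip: power_add)
  have "L (-2) a = nprod V om (-1) a" by (simp add: L_eq)
  moreover have "((-1) ^ i * ibinom (-1) i) \<odot> nprod V om (-1 - int i) (nprod V a (m + int i) b) = f i" for i
  proof -
    have "-1 - int i = - int (i + 2) + 1" by simp
    then have "nprod V om (-1 - int i) (nprod V a (m + int i) b) = f i"
      unfolding f_def L_eq by presburger
    then show ?thesis using fc by (simp add: ibinom_minus_one sq)
  qed
  moreover have "((-1) powi (-1) * (-1) ^ i * ibinom (-1) i) \<odot> nprod V a (m + -1 - int i) (nprod V om (int i) b) = \<ominus> g i" for i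
    using fc[of i] by (simp add: ibinom_minus_one mult.assoc sq smult_minus_one g_def L_eq)
  ultimately have "nprod V (L (-2) a) m b = fsum V f \<ominus> fsum V (\<lambda>i. \<ominus> g i)"
    using iterate[OF om_carrier a b, of "-1" m] by simp
  moreover have "ev (fsum V f) = (\<Sum>i<N. ev (f i))"
    by (rule ev.fun_fsum) (use fc tr in \<open>auto simp: f_def\<close>)
  moreover have "ev (fsum V (\<lambda>i. \<ominus> g i)) = (\<Sum>i<M. ev (\<ominus> g i))"
    by (rule ev.fun_fsum) (use fc tr' a in \<open>auto simp: g_def\<close>)
  moreover have "ev (\<ominus> g i) = - ev (g i)" for i
    using ev.fun_smult[OF fc(2), of "-1" i] fc by (simp add: smult_minus_one)
  moreover have "ev (f i) = (-1) ^ i * (of_nat (Suc i) * xx * ev (nprod V a (m + int i) b) - ev (L (-1) (nprod V a (m + int i) b)))" for i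
  proof -
    have "of_int (int (i + 2) - 1) = (of_nat (Suc i) :: 'k poly)" by simp
    then show ?thesis
      unfolding f_def using ev_L_neg[of "nprod V a (m + int i) b" "i + 2"] a b by simp
  qed
  ultimately show ?thesis using fc by (simp add: ev.fun_diff sum_negf f_def[symmetric] g_def)
qed

text \<open>The two extra factors 1 + z in the degree of L(-2) a clear the denominators (1 + z)^2
  and 1 + z created by the recursion for \<open>ev\<close>. In \<open>J\<close> only the modes L(-1)
  and L(0) acting on \<open>b\<close> contribute.\<close>

lemma corr_prod_L_minus_two:
  assumes a: "a \<in> grading V (int e)" and good: "corr_prod e a"
  shows "corr_prod (Suc (Suc e)) (L (-2) a)"
  unfolding corr_prod_def
proof (intro ballI allI impI)
  fix b and m :: int
  assume b: "b \<in> carrier V" and m: "m \<le> -1"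
  have ac: "a \<in> carrier V" by (rule grading_carrier[OF a])
  obtain M0 where M0: "\<And>n. n \<ge> M0 \<Longrightarrow> nprod V a n b = \<zero>" using truncation[OF ac b] by blast
  obtain M1 where M1: "\<And>n. n \<ge> M1 \<Longrightarrow> nprod V om n b = \<zero>" using truncation[OF om_carrier b] by blast
  define M where "M = nat M1"
  have Lb: "L (int i - 1) b = \<zero>" if "i \<ge> Suc (Suc M)" for i
    unfolding L_eq by (rule M1) (use that in \<open>simp add: M_def\<close>)
  define G where "G j = (\<lambda>m. ev (nprod V a m (L j b)))" for j
  define G' K where "G' m = ev (nprod V a m b)" and "K m = ev (L (-1) (nprod V a m b))" for m
  define P where "P j = (sh ^^ e) (G j)" for j
  define P' where "P' = (sh ^^ e) G'"
  have P': "P' n = (if n = -1 then ev a * ev b else 0)" if "n \<le> -1" for n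
    using good that b unfolding corr_prod_def P'_def G'_def[abs_def] by blast
  have P: "P j n = (if n = -1 then ev a * ev (L j b) else 0)" if "n \<le> -1" for n j
    using good that L_carrier[OF b] unfolding corr_prod_def P_def G_def by blast
  define h where "h m N = (\<Sum>i<N. (-1) ^ i * (of_nat (Suc i) * xx * G' (m + int i) - K (m + int i)))" for m N
  \<comment> \<open>Two terms beyond \<open>M\<close> guarantee that \<open>i = 0\<close> and
    \<open>i = 1\<close> can be split off below.\<close>
  define J where "J = (\<lambda>m. \<Sum>i<Suc (Suc M). G (int i - 1) (m + (- 1 - int i)))"
  define H where "H m = ev (nprod V (L (-2) a) m b) - J m" for m
  have H: "H m = h m N" if "m + int N \<ge> M0" for m N
    using ev_nprod_L_minus_two[OF ac b, of m N "Suc (Suc M)"] M0 Lb that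
    unfolding H_def h_def J_def G_def G'_def K_def by (simp add: algebra_simps)
  have "sh (sh H) n = xx * G' n - sh K n" for n
  proof -
    define N where "N = nat (M0 - n)"
    have "H n = h n (Suc (Suc N))" "H (n + 1) = h (n + 1) (Suc N)" "H (n + 2) = h (n + 2) N"
      by (rule H, simp add: N_def)+
    moreover have "sh (sh H) n = H n + H (n + 1) + (H (n + 1) + H (n + 2))"
      by (simp add: sh_def add.assoc)
    ultimately show ?thesis
      using alternating_second_difference[where x = xx and g = G' and k = K and m = n and N = N] by (simp add: h_def sh_def)
  qed
  then have "sh (sh H) = (\<lambda>n. xx * G' n - sh K n)" by (rule ext)
  then have "(sh ^^ e) (sh (sh H)) m = xx * P' m - (sh ^^ e) (sh K) m"
    by (simp only: sh_pow_diff sh_pow_mult P'_def)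
  moreover have "(sh ^^ e) (sh (sh H)) = (sh ^^ Suc (Suc e)) H" "(sh ^^ e) (sh K) = (sh ^^ Suc e) K"
    by (simp_all only: funpow_Suc_right comp_apply)
  moreover have "(sh ^^ Suc e) K m = sh (P (-1)) m + (sh (wt P') m - of_nat e * P' m)"
  proof -
    have "K = (\<lambda>m. G (-1) m + wt G' m)"
      using ac b by (simp add: fun_eq_iff K_def G_def G'_def L_minus_one_nprod ev.fun_diff ev.fun_smult wt_def of_int_poly)
    then have "(sh ^^ Suc e) K m = (sh ^^ Suc e) (G (-1)) m + (sh ^^ Suc e) (wt G') m"
      by (simp only: sh_pow_add)
    then show ?thesis unfolding sh_pow_wt P'_def P_def by simp
  qed
  moreover have "(sh ^^ Suc (Suc e)) J m = sh (sh (P (-1))) (m - 1) + ev a * (if m = -1 then ev (L 0 b) else 0)"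
  proof -
    have "(sh ^^ Suc (Suc e)) J m = (\<Sum>i<Suc (Suc M). sh (sh (P (int i - 1))) (m + (- 1 - int i)))"
      unfolding J_def by (simp only: sh_pow_sum sh_pow_translate sh_pow_Suc P_def)
    also have "\<dots> = sh (sh (P (-1))) (m - 1) + sh (sh (P 0)) (m - 2)
        + (\<Sum>i<M. sh (sh (P (int (i + 2) - 1))) (m + (- 1 - int (i + 2))))"
      unfolding sum.lessThan_Suc_shift by (simp add: algebra_simps)
    \<comment> \<open>From the third mode on only indices below -1 are seen, where \<open>P\<close>
      vanishes.\<close>
    also have "(\<Sum>i<M. sh (sh (P (int (i + 2) - 1))) (m + (- 1 - int (i + 2)))) = 0"
      using m by (intro sum.neutral ballI) (simp add: sh_def P)
    also have "sh (sh (P 0)) (m - 2) = ev a * (if m = -1 then ev (L 0 b) else 0)"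
      using m by (simp add: sh_def P)
    finally show ?thesis by simp
  qed
  moreover have "(\<lambda>m. ev (nprod V (L (-2) a) m b)) = (\<lambda>m. H m + J m)"
    by (simp add: H_def)
  then have "(sh ^^ Suc (Suc e)) (\<lambda>m. ev (nprod V (L (-2) a) m b)) m = (sh ^^ Suc (Suc e)) H m + (sh ^^ Suc (Suc e)) J m"
    by (simp only: sh_pow_add)
  ultimately have "(sh ^^ Suc (Suc e)) (\<lambda>m. ev (nprod V (L (-2) a) m b)) m
    = xx * P' m - (sh (P (-1)) m + (sh (wt P') m - of_nat e * P' m))
      + (sh (sh (P (-1))) (m - 1) + ev a * (if m = -1 then ev (L 0 b) else 0))"
    by (simp only:)
  \<comment> \<open>The value of \<open>P (-1)\<close> at m + 1, about which nothing is known when m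
    = -1, cancels.\<close>
  also have "\<dots> = (xx + of_nat e) * P' m + of_int m * P' (m - 1) + of_int (m + 1) * P' m
      + (P (-1) (m - 1) + P (-1) m) + ev a * (if m = -1 then ev (L 0 b) else 0)"
    by (simp add: sh_def wt_def algebra_simps)
  \<comment> \<open>\<open>P (-1)\<close> and the last term contribute ev a times ev (L (-1) b) + ev
    (L 0 b), which is zero, and xx + e is the factor by which \<open>ev\<close> changes under L(-2)
    in degree e.\<close>
  also have "\<dots> = (if m = -1 then ev (L (-2) a) * ev b else 0)"
    using m P'[of m] P'[of "m - 1"] P[of m "-1"] P[of "m - 1" "-1"] ev_L_neg_grading[OF a, of 2] ev_L_minus_one[OF b]
    by (simp add: mult.assoc)
  finally show "(sh ^^ Suc (Suc e)) (\<lambda>m. ev (nprod V (L (-2) a) m b)) m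
    = (if m = -1 then ev (L (-2) a) * ev b else 0)" .
qed

lemma corr_prod_zero: "corr_prod e \<zero>"
  by (simp add: corr_prod_def sh_pow_0)

text \<open>Induction along L(-1) and L(-2). The vanishing of components of negative degree is
  carried along because the exponent in \<open>corr_prod\<close> is a natural number.\<close>

lemma corr_prod_hom_comp:
  assumes "v \<in> carrier V"
  shows "(d < 0 \<longrightarrow> hom_comp V v d = \<zero>) \<and> corr_prod (nat d) (hom_comp V v d)"
proof -
  define good where "good d a \<longleftrightarrow> (d < 0 \<longrightarrow> a = \<zero>) \<and> corr_prod (nat d) a" for d a
  define N where "N = {v \<in> carrier V. \<forall>d. good d (hom_comp V v d)}"
  have "is_subspace V N"
    unfolding N_def
  proof (rule is_subspaceI)
    fix x y assume "x \<in> {v \<in> carrier V. \<forall>d. good d (hom_comp V v d)}" "y \<in> {v \<in> carrier V. \<forall>d. good d (hom_comp V v d)}"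
    then show "x \<oplus> y \<in> {v \<in> carrier V. \<forall>d. good d (hom_comp V v d)}"
      by (auto simp: good_def hom_comp_add corr_prod_def nprod_add_left ev.fun_add sh_pow_add algebra_simps)
  next
    fix s x assume "x \<in> {v \<in> carrier V. \<forall>d. good d (hom_comp V v d)}"
    then show "s \<odot> x \<in> {v \<in> carrier V. \<forall>d. good d (hom_comp V v d)}"
      using sh_pow_mult[of _ "[:s:]"]
      by (auto simp: good_def hom_comp_smult corr_prod_def nprod_smult_left ev.fun_smult)
  qed (auto simp: good_def corr_prod_zero)
  moreover have "vac V \<in> N"
    by (auto simp: N_def good_def hom_comp_homogeneous[OF vac_degree] corr_prod_zero corr_prod_def vacuum ev_vac sh_pow_0)
  moreover have "L (-1) v \<in> N" "L (-2) v \<in> N" if "v \<in> N" for v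
  proof -
    have v: "v \<in> carrier V" and g: "good d (hom_comp V v d)" for d using that by (auto simp: N_def)
    have "good d (L (-1) (hom_comp V v (d - 1)))" for d
    proof (cases "d \<ge> 1")
      case True
      then obtain e where e: "d - 1 = int e" "nat d = Suc e"
        by (intro that[of "nat (d - 1)"]) auto
      show ?thesis
        using corr_prod_L_minus_one[of "hom_comp V v (d - 1)" e] g[of "d - 1"] hom_comp_grading[OF v] e True
        by (simp add: good_def)
    next
      case False
      then show ?thesis using g[of "d - 1"] by (simp add: good_def corr_prod_zero)
    qed
    moreover have "good d (L (-2) (hom_comp V v (d - 2)))" for d
    proof (cases "d \<ge> 2")
      case True
      then obtain e where e: "d - 2 = int e" and e': "nat d = Suc (Suc e)"
        by (intro that[of "nat (d - 2)"]) auto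
      show ?thesis
        using corr_prod_L_minus_two[of "hom_comp V v (d - 2)" e] g[of "d - 2"] hom_comp_grading[OF v] e e' True
        by (simp add: good_def)
    next
      case False
      then show ?thesis using g[of "d - 2"] by (simp add: good_def corr_prod_zero)
    qed
    ultimately show "L (-1) v \<in> N" "L (-2) v \<in> N" using v by (auto simp: N_def hom_comp_L)
  qed
  ultimately have "N = carrier V" by (intro l12_closed_carrier) (auto simp: l12_closed_def)
  then show ?thesis using assms by (auto simp: N_def good_def)
qed

text \<open>For a homogeneous left factor of degree e the residue is a finite binomial sum, namely
  \<open>sh ^^ e\<close> at the index - k.\<close>

lemma ev_zhu_res:
  assumes a: "a \<in> carrier V" and b: "b \<in> carrier V" and k: "k \<ge> 1"
  shows "ev (zhu_res V k a b) = (if k = 1 then ev a * ev b else 0)"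
proof -
  have hom: "ev (zhu_res_hom V d k (hom_comp V a d) b) = (if k = 1 then ev (hom_comp V a d) * ev b else 0)" for d
  proof (cases "d < 0")
    case True
    then show ?thesis using corr_prod_hom_comp[OF a, of d] b by (simp add: zhu_res_hom_zero)
  next
    case False
    then obtain e where d: "d = int e" by (intro that[of "nat d"]) simp
    define a' where "a' = hom_comp V a d"
    have a': "a' \<in> carrier V" using a by (simp add: a'_def)
    have "ev (zhu_res_hom V d k a' b) = (\<Sum>i\<le>e. ev (ibinom d i \<odot> nprod V a' (int i - k) b))"
      unfolding zhu_res_hom_def
      by (rule ev.fun_fsum) (use a' b in \<open>auto simp: d ibinom_of_nat binomial_eq_0\<close>)
    also have "\<dots> = (\<Sum>i\<le>e. of_nat (e choose i) * ev (nprod V a' (- k + int i) b))"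
      using a' b by (simp add: d ibinom_of_nat ev.fun_smult of_nat_poly)
    also have "\<dots> = (sh ^^ e) (\<lambda>m. ev (nprod V a' m b)) (- k)"
      by (simp only: sh_pow_binomial)
    also have "\<dots> = (if k = 1 then ev a' * ev b else 0)"
      using corr_prod_hom_comp[OF a, of d] b k unfolding corr_prod_def a'_def by (simp add: d)
    finally show ?thesis by (simp add: a'_def)
  qed
  define A where "A = {d. hom_comp V a d \<noteq> \<zero>}"
  have A: "finite A" unfolding A_def by (rule finite_hom_comp[OF a])
  have "ev (zhu_res V k a b) = (\<Sum>d\<in>A. ev (zhu_res_hom V d k (hom_comp V a d) b))"
    unfolding zhu_res_def by (rule ev.fun_fsum[OF A]) (use a b in \<open>auto simp: A_def zhu_res_hom_zero\<close>)
  also have "\<dots> = (if k = 1 then (\<Sum>d\<in>A. ev (hom_comp V a d)) * ev b else 0)"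
    by (simp add: hom sum_distrib_right)
  also have "(\<Sum>d\<in>A. ev (hom_comp V a d)) = ev (fsum V (hom_comp V a))"
    by (rule ev.fun_fsum[OF A, symmetric]) (use a in \<open>auto simp: A_def\<close>)
  finally show ?thesis using a by (simp add: fsum_hom_comp)
qed

end

section \<open>Quotients of the polynomial algebra\<close>

lemma poly_algebra_simps [simp]:
  "carrier poly_algebra = UNIV"
  "add poly_algebra = (+)"
  "monoid.mult poly_algebra = (*)"
  "one poly_algebra = 1"
  "zero poly_algebra = 0"
  "module.smult poly_algebra = Polynomial.smult"
  by (simp_all add: poly_algebra_def ring_of_type_algebra_def ring.defs module.defs)

lemma vspace_poly_algebra: "vspace (poly_algebra :: ('k::field, 'k poly) module)"
proof (rule vspace.intro, rule moduleI)
  show "abelian_group (poly_algebra :: ('k, 'k poly) module)"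
  proof (rule abelian_groupI)
    fix f :: "'k poly"
    show "\<exists>g\<in>carrier poly_algebra. g \<oplus>\<^bsub>poly_algebra\<^esub> f = \<zero>\<^bsub>poly_algebra\<^esub>"
      by (intro bexI[of _ "- f"]) simp_all
  qed (auto simp: add_ac)
qed (auto simp: cring_scalars Polynomial.smult_add_left Polynomial.smult_add_right)

lemma poly_algebra_minus [simp]: "f \<ominus>\<^bsub>poly_algebra\<^esub> g = f - g"
  using vspace.eq_diff_iff[OF vspace_poly_algebra, of "f - g" f g] by simp

lemma PIdl_poly_algebra: "PIdl\<^bsub>poly_algebra\<^esub> q = {f. q dvd f}"
  by (auto simp: cgenideal_def dvd_def mult.commute)

lemma quotient_poly_algebra: "quotient_vspace (poly_algebra :: ('k::field, 'k poly) module) (PIdl\<^bsub>poly_algebra\<^esub> q)"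
  by (intro quotient_vspace.intro quotient_vspace_axioms.intro vspace_poly_algebra vspace.is_subspaceI)
    (auto simp: PIdl_poly_algebra dvd_smult)

text \<open>\<open>A\<close> enters as a vector space with a bare product and unit; its algebra
  structure is carried over from the polynomials by the surjection \<open>h\<close> with kernel
  (q).\<close>

locale poly_quotient = A: vspace A
  for A :: "('k::field, 'w, 'z) module_scheme" (structure) +
  fixes h :: "'k poly \<Rightarrow> 'w" and q :: "'k poly"
  assumes h_add: "h (f + g) = h f \<oplus> h g"
    and h_smult: "h (Polynomial.smult a f) = a \<odot> h f"
    and h_mult: "h (f * g) = h f \<otimes> h g"
    and h_one: "h 1 = \<one>"
    and h_surj: "carrier A = range h"
    and h_eq_iff: "h f = h g \<longleftrightarrow> q dvd f - g"
begin

lemma h_closed [simp]: "h f \<in> carrier A"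
  by (simp add: h_surj)

lemma h_zero: "h 0 = \<zero>"
  using h_smult[of 0 0] by simp

lemma h_sum: "finite S \<Longrightarrow> h (\<Sum>i\<in>S. f i) = (\<Oplus>i\<in>S. h (f i))"
  by (induction S rule: finite_induct) (simp_all add: h_zero h_add A.M.finsum_insert)

lemma h_power: "h (f ^ i) = h f [^] i"
proof (induction i)
  case 0
  show ?case by (simp add: nat_pow_def h_one)
next
  case (Suc i)
  have "h (f ^ Suc i) = h (f ^ i) \<otimes> h f" unfolding power_Suc2 by (rule h_mult)
  then show ?case using Suc by (simp add: nat_pow_def)
qed

lemma h_alg_eval: "h f = alg_eval A f (h [:0, 1:])"
proof -
  have "h f = h (\<Sum>i\<le>Polynomial.degree f. Polynomial.smult (Polynomial.coeff f i) ([:0, 1:] ^ i))"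
    by (simp add: poly_as_sum_of_monoms flip: monom_altdef)
  then show ?thesis by (simp only: h_sum finite_atMost h_smult h_power alg_eval_def)
qed

sublocale Q: quotient_vspace "poly_algebra :: ('k, 'k poly) module" "PIdl\<^bsub>poly_algebra\<^esub> q"
  by (rule quotient_poly_algebra)

abbreviation cos where "cos f \<equiv> PIdl\<^bsub>poly_algebra\<^esub> q +>\<^bsub>poly_algebra\<^esub> f"

lemma cos_eq_iff: "cos f = cos g \<longleftrightarrow> q dvd f - g"
  by (subst Q.coset_eq_iff) (simp_all add: PIdl_poly_algebra)

lemma cos_mult: "cos f \<otimes>\<^bsub>Q.Q\<^esub> cos g = cos (f * g)"
proof -
  have "cos (a * b) = cos (f * g)" if "a \<in> cos f" "b \<in> cos g" for a b
  proof -
    have "cos a = cos f" "cos b = cos g" using Q.in_coset[of f a] Q.in_coset[of g b] that by simp_all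
    then have "q dvd (a - f) * b + f * (b - g)" by (simp add: cos_eq_iff dvd_add)
    then show ?thesis unfolding cos_eq_iff by (simp add: algebra_simps)
  qed
  moreover have "f \<in> cos f" "g \<in> cos g" by (simp_all add: Q.in_coset_self)
  ultimately show ?thesis unfolding Q.Q_mult poly_algebra_simps by blast
qed

lemma algebra_iso_quotient:
  "\<exists>\<Phi>\<in>algebra_iso Q.Q A. \<forall>f. \<Phi> (cos f) = alg_eval A f (h [:0, 1:])"
proof -
  define \<Phi> where "\<Phi> C = h (SOME f. f \<in> C)" for C
  have \<Phi>: "\<Phi> (cos f) = h f" for f
  proof -
    have "(SOME g. g \<in> cos f) \<in> cos f" by (rule someI[of _ f]) (simp add: Q.in_coset_self)
    then have "cos (SOME g. g \<in> cos f) = cos f" using Q.in_coset[of f] by simp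
    then show ?thesis unfolding \<Phi>_def cos_eq_iff h_eq_iff .
  qed
  have car: "carrier Q.Q = range cos" using Q.Q_carrier by simp
  have add: "cos f \<oplus>\<^bsub>Q.Q\<^esub> cos g = cos (f + g)" for f g using Q.Q_add[of f g] by simp
  have smult: "a \<odot>\<^bsub>Q.Q\<^esub> cos f = cos (Polynomial.smult a f)" for a f using Q.Q_smult[of f a] by simp
  have one: "\<one>\<^bsub>Q.Q\<^esub> = cos 1" using Q.Q_one by simp
  have "\<Phi> \<in> ring_hom Q.Q A"
    by (rule ring_hom_memI) (auto simp: car add cos_mult one \<Phi> h_add h_mult h_one)
  moreover have "bij_betw \<Phi> (carrier Q.Q) (carrier A)"
    unfolding bij_betw_def inj_on_def h_surj car by (auto simp: \<Phi> h_eq_iff cos_eq_iff image_image)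
  ultimately have "\<Phi> \<in> algebra_iso Q.Q A"
    by (auto simp: algebra_iso_def ring_iso_def car smult \<Phi> h_smult)
  moreover have "\<Phi> (cos f) = alg_eval A f (h [:0, 1:])" for f unfolding \<Phi> by (rule h_alg_eval)
  ultimately show ?thesis by blast
qed

end

section \<open>The Zhu algebra of the quotient\<close>

context virasoro
begin

section \<open>Determination of O and of the Zhu algebra of the quotient through
  \<open>ev\<close>\<close>

interpretation I: graded_ideal V I0
  by (rule graded_ideal_I0)

lemma ev_surj: "\<exists>v\<in>carrier V. ev v = f"
  by (rule bexI[of _ "xpoly (vac V) f"]) (simp_all add: ev_xpoly ev_vac)

lemma ev_om: "ev om = xx"
proof -
  have "L (-2) (vac V) = om" using creation(2)[OF om_carrier] by (simp add: L_eq)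
  then show ?thesis using ev_L_neg[of "vac V" 2] by (simp add: ev_vac L_vac)
qed

lemma zhu_circ_om:
  assumes "b \<in> carrier V"
  shows "zhu_circ V n om b = Top (n + 3) b"
proof -
  define f where "f i = ibinom 2 i \<odot> nprod V om (int i - (int n + 2)) b" for i
  have ib: "ibinom 2 i = (of_nat (2 choose i) :: 'k)" for i using ibinom_of_nat[of 2 i] by simp
  have fc: "f i \<in> carrier V" for i using assms by (simp add: f_def)
  have z: "f i = \<zero>" if "i \<notin> {0, 1, 2}" for i
    using that assms by (simp add: f_def ib binomial_eq_0)
  have two: "2 \<odot> x = x \<oplus> x" if "x \<in> carrier V" for x
    using smult_add[OF that, of 1 1] that by simp
  have "zhu_circ V n om b = fsum V f"
    unfolding zhu_circ_def zhu_res_homogeneous[OF om assms] zhu_res_hom_def f_def ..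
  also have "\<dots> = (\<Oplus>i\<in>{0, 1, 2}. f i)"
    by (rule fsum_eq_finsum) (use z fc in auto)
  also have "\<dots> = f 0 \<oplus> (f 1 \<oplus> f 2)" using fc by (simp add: M.finsum_insert)
  finally have "zhu_circ V n om b = f 0 \<oplus> (f 1 \<oplus> f 2)" .
  moreover have fs: "f 0 = L (- int (n + 3)) b" "f 2 = L (- int (n + 1)) b" "f 1 = L (- int (n + 2)) b \<oplus> L (- int (n + 2)) b"
  proof -
    have "int 0 - (int n + 2) = - int (n + 3) + 1" "int 1 - (int n + 2) = - int (n + 2) + 1"
      "int 2 - (int n + 2) = - int (n + 1) + 1" by simp_all
    then show "f 0 = L (- int (n + 3)) b" "f 2 = L (- int (n + 1)) b" "f 1 = L (- int (n + 2)) b \<oplus> L (- int (n + 2)) b"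
      unfolding f_def L_eq using assms by (simp_all only:) (simp_all add: ib two)
  qed
  ultimately show ?thesis using assms by (simp add: Top_eq M.a_assoc)
qed

text \<open>One inclusion is \<open>ev_zhu_res\<close>. For the other, subtract from v an element of
  \<open>I0\<close> with the same value of \<open>ev\<close>; the difference is in the kernel of
  \<open>ev\<close>, hence a combination of products \<omega> \<circ> b.\<close>

lemma zhu_O_quotient: "zhu_O I.W = {I0 +> v | v. v \<in> carrier V \<and> qq dvd ev v}"
proof -
  let ?N = "{I0 +> v | v. v \<in> carrier V \<and> qq dvd ev v}"
  let ?S = "{zhu_circ I.W n a b | n a b. a \<in> carrier I.W \<and> b \<in> carrier I.W}"
  have circ: "zhu_circ I.W n (I0 +> a) (I0 +> b) = I0 +> zhu_circ V n a b"
    if "a \<in> carrier V" "b \<in> carrier V" for n a b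
    unfolding zhu_circ_def using that by (rule I.zhu_res_W)
  have S: "?S \<subseteq> carrier I.W"
  proof -
    have "I0 +> zhu_circ V n a b \<in> carrier I.W" if "a \<in> carrier V" "b \<in> carrier V" for n a b
      using that by (simp add: zhu_circ_def)
    then show ?thesis by (auto simp: I.W_carrier[of] circ)
  qed
  have "?S \<subseteq> ?N"
  proof -
    have "qq dvd ev (zhu_circ V n a b)" "zhu_circ V n a b \<in> carrier V" if "a \<in> carrier V" "b \<in> carrier V" for n a b
      using that ev_zhu_res[OF that, of "int n + 2"] by (simp_all add: zhu_circ_def)
    then show ?thesis by (auto simp: I.W_carrier circ)
  qed
  moreover have "is_subspace I.W ?N"
  proof (rule I.W.is_subspaceI)
    show "?N \<subseteq> carrier I.W" by auto
    show "\<zero>\<^bsub>I.W\<^esub> \<in> ?N" using I.C.map_zero by (auto intro!: exI[of _ \<zero>])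
  next
    fix C D assume "C \<in> ?N" "D \<in> ?N"
    then obtain u v where "C = I0 +> u" "D = I0 +> v" "u \<in> carrier V" "v \<in> carrier V" "qq dvd ev u" "qq dvd ev v"
      by blast
    then show "C \<oplus>\<^bsub>I.W\<^esub> D \<in> ?N"
      by (auto simp: I.C.map_add[symmetric] ev.fun_add intro!: exI[of _ "u \<oplus> v"])
  next
    fix a C assume "C \<in> ?N"
    then obtain u where "C = I0 +> u" "u \<in> carrier V" "qq dvd ev u" by blast
    then show "a \<odot>\<^bsub>I.W\<^esub> C \<in> ?N"
      by (auto simp: I.C.map_smult[symmetric] ev.fun_smult intro!: exI[of _ "a \<odot> u"] dvd_smult)
  qed
  ultimately have "zhu_O I.W \<subseteq> ?N" unfolding zhu_O_def by (rule I.W.lin_span_minimal)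
  moreover have "?N \<subseteq> zhu_O I.W"
  proof
    fix C assume "C \<in> ?N"
    then obtain v where v: "v \<in> carrier V" "qq dvd ev v" and C: "C = I0 +> v" by blast
    obtain u where u: "u \<in> I0" "ev u = ev v" using I0_ev_surj[OF v(2)] by blast
    have uc: "u \<in> carrier V" using u I0_subspaceD(1) by blast
    have O: "is_subspace I.W (zhu_O I.W)" unfolding zhu_O_def using S by (rule I.W.is_subspace_lin_span)
    note OD = I.W.is_subspaceD[OF O]
    define K where "K = {w \<in> carrier V. I0 +> w \<in> zhu_O I.W}"
    have "is_subspace V K"
      unfolding K_def
      by (rule is_subspaceI) (use OD in \<open>auto simp: I.C.map_add I.C.map_smult\<close>)
    moreover have "Top n b \<in> K" if n: "n \<ge> 3" and b: "b \<in> carrier V" for n b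
    proof -
      have "I0 +> Top n b = zhu_circ I.W (n - 3) (I0 +> om) (I0 +> b)"
        using circ[OF om_carrier b, of "n - 3"] zhu_circ_om[OF b, of "n - 3"] n by simp
      moreover have "I0 +> om \<in> carrier I.W" "I0 +> b \<in> carrier I.W" using b by simp_all
      then have "zhu_circ I.W (n - 3) (I0 +> om) (I0 +> b) \<in> ?S" by blast
      then have "zhu_circ I.W (n - 3) (I0 +> om) (I0 +> b) \<in> zhu_O I.W"
        unfolding zhu_O_def by (rule subsetD[OF I.W.lin_span_superset])
      ultimately show ?thesis using b by (simp add: K_def)
    qed
    ultimately have "ker_span \<subseteq> K"
      unfolding ker_span_def by (intro lin_span_minimal) auto
    moreover have "v \<ominus> u \<in> ker_span" using v uc u by (intro ker_ev) (simp_all add: ev.fun_diff)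
    ultimately have "I0 +> (v \<ominus> u) \<in> zhu_O I.W" by (auto simp: K_def)
    moreover have "I0 +> v = I0 +> (v \<ominus> u)"
    proof -
      have "v \<ominus> (v \<ominus> u) = u"
        using v(1) uc by (simp add: M.minus_eq M.minus_add M.r_neg2)
      then show ?thesis using v(1) uc u(1) by (subst I.Q.coset_eq_iff) auto
    qed
    ultimately show "C \<in> zhu_O I.W" by (simp add: C)
  qed
  ultimately show ?thesis by blast
qed

text \<open>The projection \<open>\<pi>\<close> from V to the Zhu algebra identifies two vectors
  exactly when their values under \<open>ev\<close> agree modulo \<open>qq\<close>, and by
  \<open>ev_zhu_res\<close> the product depends on these values only.\<close>

theorem zhu_algebra_quotient_iso:
  "\<exists>\<Phi>\<in>algebra_iso (quot_algebra poly_algebra (PIdl\<^bsub>poly_algebra\<^esub> qq)) (zhu_algebra (quot_vertex_alg V I0)).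
    \<forall>f. \<Phi> (PIdl\<^bsub>poly_algebra\<^esub> qq +>\<^bsub>poly_algebra\<^esub> f)
      = alg_eval (zhu_algebra (quot_vertex_alg V I0)) f (zhu_class (quot_vertex_alg V I0) (I0 +> om))"
proof -
  define Z where "Z = I.W\<lparr>mult := zhu_star I.W, one := vac I.W\<rparr>"
  define J where "J = zhu_O I.W"
  have Z_simps: "carrier Z = carrier I.W" "add Z = add I.W" "zero Z = zero I.W"
    "module.smult Z = module.smult I.W" "monoid.mult Z = zhu_star I.W" "one Z = I0 +> vac V"
    by (simp_all add: Z_def I.W_simps)
  interpret Z: vspace Z
    by (rule vspace_cong[OF I.W.vspace_axioms]) (simp_all add: Z_simps)
  interpret C: vlinear V Z "\<lambda>v. I0 +> v"
    by unfold_locales (auto simp: Z_simps I.C.map_add I.C.map_smult)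
  have carrier_Z: "carrier Z = (\<lambda>v. I0 +> v) ` carrier V" by (simp add: Z_simps I.W_carrier)
  have J_iff: "I0 +> v \<in> J \<longleftrightarrow> qq dvd ev v" if v: "v \<in> carrier V" for v
  proof
    assume "I0 +> v \<in> J"
    then obtain u where u: "I0 +> v = I0 +> u" "u \<in> carrier V" "qq dvd ev u"
      unfolding J_def zhu_O_quotient by blast
    then have "qq dvd ev (v \<ominus> u)" using v by (intro ev_I0) (simp add: I.Q.coset_eq_iff)
    then have "qq dvd ev v - ev u" using u v by (simp add: ev.fun_diff)
    with u(3) have "qq dvd (ev v - ev u) + ev u" by (rule dvd_add[rotated])
    then show "qq dvd ev v" by simp
  next
    assume "qq dvd ev v"
    then show "I0 +> v \<in> J" unfolding J_def zhu_O_quotient using v by blast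
  qed
  have J_rep: "\<exists>v\<in>carrier V. w = I0 +> v \<and> qq dvd ev v" if "w \<in> J" for w
    using that unfolding J_def zhu_O_quotient by blast
  have "is_subspace Z J"
  proof (rule Z.is_subspaceI)
    show "J \<subseteq> carrier Z" using J_rep carrier_Z by blast
    show "\<zero>\<^bsub>Z\<^esub> \<in> J" using J_iff[of \<zero>] C.map_zero by simp
  next
    fix x y assume "x \<in> J" "y \<in> J"
    then show "x \<oplus>\<^bsub>Z\<^esub> y \<in> J"
      using J_rep[of x] J_rep[of y] J_iff C.map_add[symmetric] by (auto simp: ev.fun_add)
  next
    fix a x assume "x \<in> J"
    then show "a \<odot>\<^bsub>Z\<^esub> x \<in> J"
      using J_rep[of x] J_iff C.map_smult[symmetric] by (auto simp: ev.fun_smult dvd_smult)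
  qed
  then interpret J: quotient_vspace Z J
    by (intro quotient_vspace.intro quotient_vspace_axioms.intro Z.vspace_axioms)
  define \<pi> where "\<pi> v = J +>\<^bsub>Z\<^esub> (I0 +> v)" for v
  have \<pi>_eq: "\<pi> u = \<pi> v \<longleftrightarrow> qq dvd ev u - ev v" if "u \<in> carrier V" "v \<in> carrier V" for u v
    unfolding \<pi>_def using that
    by (subst J.coset_eq_iff) (simp_all add: C.map_diff[symmetric] J_iff ev.fun_diff)
  have \<pi>_carrier: "carrier J.Q = \<pi> ` carrier V"
    by (simp add: J.Q_carrier carrier_Z image_image \<pi>_def)
  have \<pi>_add: "\<pi> u \<oplus>\<^bsub>J.Q\<^esub> \<pi> v = \<pi> (u \<oplus> v)" if "u \<in> carrier V" "v \<in> carrier V" for u v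
    using that by (simp add: \<pi>_def J.Q_add C.map_add)
  have \<pi>_smult: "a \<odot>\<^bsub>J.Q\<^esub> \<pi> v = \<pi> (a \<odot> v)" if "v \<in> carrier V" for a v
    using that by (simp add: \<pi>_def J.Q_smult C.map_smult)
  have \<pi>_mult: "\<pi> u \<otimes>\<^bsub>J.Q\<^esub> \<pi> v = \<pi> (zhu_res V 1 u v)" if uv: "u \<in> carrier V" "v \<in> carrier V" for u v
  proof -
    \<comment> \<open>The product in the quotient is a union over all representatives, so each
      element of a coset is lifted to V with control of \<open>ev\<close> modulo
      \<open>qq\<close>.\<close>
    have rep: "\<exists>w'\<in>carrier V. a = I0 +> w' \<and> qq dvd ev w' - ev w" if "a \<in> \<pi> w" "w \<in> carrier V" for a w
    proof -
      have "a \<in> carrier Z" "J +>\<^bsub>Z\<^esub> a = \<pi> w"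
        using J.in_coset[of "I0 +> w" a] that by (simp_all add: \<pi>_def)
      then obtain w' where "w' \<in> carrier V" "a = I0 +> w'" "\<pi> w' = \<pi> w"
        unfolding carrier_Z \<pi>_def by blast
      then show ?thesis using \<pi>_eq that by blast
    qed
    have "J +>\<^bsub>Z\<^esub> zhu_star I.W a b = \<pi> (zhu_res V 1 u v)" if ab: "a \<in> \<pi> u" "b \<in> \<pi> v" for a b
    proof -
      obtain u' v' where u': "u' \<in> carrier V" "a = I0 +> u'" "qq dvd ev u' - ev u"
        and v': "v' \<in> carrier V" "b = I0 +> v'" "qq dvd ev v' - ev v"
        using rep[OF ab(1) uv(1)] rep[OF ab(2) uv(2)] by blast
      have "J +>\<^bsub>Z\<^esub> zhu_star I.W a b = \<pi> (zhu_res V 1 u' v')"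
        using u' v' by (simp add: zhu_star_def I.zhu_res_W \<pi>_def)
      also have "\<dots> = \<pi> (zhu_res V 1 u v)"
      proof -
        have "qq dvd (ev u' - ev u) * ev v' + ev u * (ev v' - ev v)"
          using u' v' by (simp add: dvd_add)
        then have "qq dvd ev u' * ev v' - ev u * ev v" by (simp add: algebra_simps)
        then show ?thesis using u' v' uv by (simp add: \<pi>_eq ev_zhu_res)
      qed
      finally show ?thesis .
    qed
    moreover have "I0 +> u \<in> carrier Z" "I0 +> v \<in> carrier Z" using uv by simp_all
    then have "I0 +> u \<in> \<pi> u" "I0 +> v \<in> \<pi> v"
      unfolding \<pi>_def by (auto intro: J.in_coset_self)
    ultimately show ?thesis unfolding J.Q_mult Z_simps by blast
  qed
  have \<pi>_one: "\<pi> (vac V) = \<one>\<^bsub>J.Q\<^esub>" by (simp add: J.Q_one Z_simps \<pi>_def)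
  define h where "h f = \<pi> (xpoly (vac V) f)" for f
  have hv: "\<pi> v = h (ev v)" if "v \<in> carrier V" for v
    unfolding h_def using that by (simp add: \<pi>_eq ev_xpoly ev_vac)
  interpret poly_quotient J.Q h qq
  proof unfold_locales
    fix f g and a :: 'k
    obtain u v where u: "u \<in> carrier V" "ev u = f" and v: "v \<in> carrier V" "ev v = g"
      using ev_surj by metis
    show "h (f + g) = h f \<oplus>\<^bsub>J.Q\<^esub> h g"
      using u v hv[of u] hv[of v] hv[of "u \<oplus> v"] \<pi>_add[of u v] by (simp add: ev.fun_add)
    show "h (Polynomial.smult a f) = a \<odot>\<^bsub>J.Q\<^esub> h f"
      using u hv[of u] hv[of "a \<odot> u"] \<pi>_smult[of u a] by (simp add: ev.fun_smult)
    show "h (f * g) = h f \<otimes>\<^bsub>J.Q\<^esub> h g"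
      using u v hv[of u] hv[of v] hv[of "zhu_res V 1 u v"] \<pi>_mult[of u v] by (simp add: ev_zhu_res)
    show "h f = h g \<longleftrightarrow> qq dvd f - g"
      using u v hv[of u] hv[of v] \<pi>_eq[of u v] by simp
    show "h 1 = \<one>\<^bsub>J.Q\<^esub>"
      using hv[of "vac V"] by (simp add: \<pi>_one ev_vac)
    show "carrier J.Q = range h"
    proof
      show "carrier J.Q \<subseteq> range h" using hv by (auto simp: \<pi>_carrier)
      show "range h \<subseteq> carrier J.Q" by (auto simp: \<pi>_carrier h_def)
    qed
  qed
  have "zhu_algebra I.W = J.Q" by (simp add: zhu_algebra_def Z_def J_def)
  moreover have "zhu_class I.W (I0 +> om) = h [:0, 1:]"
  proof -
    have "zhu_class I.W (I0 +> om) = \<pi> om"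
      by (simp add: zhu_class_def \<pi>_def J_def a_r_coset_def r_coset_def Z_simps)
    then show ?thesis using hv[OF om_carrier] by (simp add: ev_om xx_def)
  qed
  ultimately show ?thesis using algebra_iso_quotient by simp
qed

end

section \<open>The universal Virasoro vertex algebra\<close>

context vir_construction
begin

section \<open>The concrete vertex algebra as an instance of \<open>virasoro\<close>\<close>

context
  fixes Y
  assumes Y: "is_vir_vertex_structure c Y"
begin

abbreviation VV where "VV \<equiv> vir_vertex_alg c Y"
text \<open>\<open>L_eq\<close> holds for all arguments, also outside the carrier, so the operators
  are taken to be the modes of \<omega>; on the carrier they agree with
  \<open>vir_L\<close>.\<close>

abbreviation LL where "LL n v \<equiv> nprod VV (vir_omega c) (n + 1) v"

lemma VV_simps:
  "carrier VV = carrier MM" "add VV = add MM" "zero VV = zero MM" "module.smult VV = module.smult MM"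
  "vac VV = vac0" "nprod VV = Y" "grading VV = vir_grading c"
  by (simp_all add: vir_vertex_alg_def module.defs vertex_alg.defs)

lemma VV_coset: "N +>\<^bsub>VV\<^esub> x = N +>\<^bsub>MM\<^esub> x"
  by (simp add: a_r_coset_def r_coset_def VV_simps)

lemma VV_vertex_algebra: "graded_vertex_algebra VV"
  using Y by (simp add: is_vir_vertex_structure_def)

lemma vspace_VV: "vspace VV"
  by (rule vspace_cong[OF MM_vspace]) (simp_all add: VV_simps)

lemma VV_minus: "y \<in> carrier MM \<Longrightarrow> x \<ominus>\<^bsub>VV\<^esub> y = x \<ominus>\<^bsub>MM\<^esub> y"
  using vspace.smult_minus_one[OF vspace_VV, of y] vspace.smult_minus_one[OF MM_vspace, of y]
  by (simp add: a_minus_def VV_simps)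

lemma is_subspace_VV: "is_subspace VV N \<longleftrightarrow> is_subspace MM N"
proof
  assume "is_subspace VV N"
  from vspace.is_subspaceD[OF vspace_VV this] show "is_subspace MM N"
    by (intro vspace.is_subspaceI[OF MM_vspace]) (simp_all add: VV_simps)
next
  assume "is_subspace MM N"
  from vspace.is_subspaceD[OF MM_vspace this] show "is_subspace VV N"
    by (intro vspace.is_subspaceI[OF vspace_VV]) (simp_all add: VV_simps)
qed

lemma LL_eq: "v \<in> carrier MM \<Longrightarrow> LL n v = vir_L c n v"
  using Y by (simp add: is_vir_vertex_structure_def VV_simps)

lemma vir_L_carrier: "v \<in> carrier MM \<Longrightarrow> vir_L c n v \<in> carrier MM"
  unfolding vir_L_def by (rule vlinear.map_closed[OF act_linear])

lemma vac0_carrier: "vac0 \<in> carrier MM"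
  using vertex_algebra.vac_closed[OF graded_vertex_algebra.axioms(1)[OF VV_vertex_algebra]]
  by (simp add: VV_simps)

lemma virasoro_VV:
  assumes "CHAR('k) = p" "p \<ge> 3"
  shows "virasoro VV (vir_omega c) LL c corr_fun p"
proof (intro virasoro.intro virasoro_axioms.intro VV_vertex_algebra assms refl)
  have "vir_omega c = foldr (vir_L c) [-2] vac0" by (simp add: vir_omega_def)
  then have "vir_omega c \<in> {foldr (vir_L c) ks vac0 | ks. - sum_list ks = 2}"
    by (intro CollectI exI[of _ "[-2]"]) simp
  then show "vir_omega c \<in> grading VV 2"
    unfolding VV_simps vir_grading_def by (rule subsetD[OF vspace.lin_span_superset[OF MM_vspace]])
next
  fix v and m n :: int
  assume "v \<in> carrier VV"
  then have v: "v \<in> carrier MM" by (simp add: VV_simps)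
  have "vir_L c m (vir_L c n v) \<ominus>\<^bsub>MM\<^esub> vir_L c n (vir_L c m v)
    = of_int (m - n) \<odot>\<^bsub>MM\<^esub> vir_L c (m + n) v \<oplus>\<^bsub>MM\<^esub> (vir_cocycle m n * c) \<odot>\<^bsub>MM\<^esub> v"
    using act_bracket[OF v, of "Vir_L m" "Vir_L n"] v
    by (simp add: vir_L_def act_c vspace.smult_smult[OF MM_vspace])
  then show "LL m (LL n v) \<ominus>\<^bsub>VV\<^esub> LL n (LL m v)
      = of_int (m - n) \<odot>\<^bsub>VV\<^esub> LL (m + n) v \<oplus>\<^bsub>VV\<^esub> (vir_cocycle m n * c) \<odot>\<^bsub>VV\<^esub> v"
    using v by (simp only: LL_eq vir_L_carrier VV_minus VV_simps(2,4))
next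
  fix N
  assume N: "is_subspace VV N" "vac VV \<in> N" "\<And>n v. v \<in> N \<Longrightarrow> LL n v \<in> N"
  note D = vspace.is_subspaceD[OF vspace_VV N(1), unfolded VV_simps]
  show "carrier VV \<subseteq> N"
  proof
    fix v assume "v \<in> carrier VV"
    then have "v \<in> carrier MM" by (simp add: VV_simps)
    then show "v \<in> N"
    proof (induction v rule: MM_induct)
      case vac
      then show ?case using N(2) by (simp add: VV_simps)
    next
      case (act x v)
      show ?case
      proof (cases x)
        case (Vir_L n)
        then show ?thesis using N(3)[OF act.IH, of n] LL_eq[OF act.hyps] by (simp add: vir_L_def)
      next
        case Vir_c
        then show ?thesis using D(4)[OF act.IH] act.hyps by (simp add: act_c)
      qed
    qed (use D in blast)+
  qed
next
  interpret poly_functional MM corr_fun by (rule corr_fun_functional)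
  show "poly_functional VV corr_fun"
    by (intro poly_functional.intro poly_functional_axioms.intro vspace_VV)
      (simp_all add: VV_simps fun_add fun_smult)
next
  show "corr_fun (vac VV) = 1" by (simp add: VV_simps corr_fun_vac)
next
  fix v and n :: int
  assume "v \<in> carrier VV" "n < -1"
  then show "corr_fun (LL n v) = (-1) ^ nat (- n) * (of_int (- n - 1) * [:0, 1:] * corr_fun v - corr_fun (LL (-1) v))"
    using corr_fun_act[of v n] LL_eq[of v n] LL_eq[of v "-1"] by (simp only: VV_simps vir_L_def)
qed

lemma funpow_LL: "v \<in> carrier MM \<Longrightarrow> (LL n ^^ r) v = (vir_L c n ^^ r) v \<and> (vir_L c n ^^ r) v \<in> carrier MM"
  by (induction r) (simp_all add: LL_eq vir_L_carrier)

lemma vir_I0_eq: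
  assumes "CHAR('k) = p" "p \<ge> 3"
  shows "vir_I0 c = virasoro.I0 VV LL p"
proof -
  interpret V: virasoro VV "vir_omega c" LL c corr_fun p
    by (rule virasoro_VV[OF assms])
  have closed: "vir_submodule c N \<longleftrightarrow> V.vir_closed N" for N
  proof -
    have "LL n v = vir_L c n v" if "is_subspace MM N" "v \<in> N" for n v
      using vspace.is_subspaceD(1)[OF MM_vspace that(1)] that(2) LL_eq by blast
    then show ?thesis by (auto simp: vir_submodule_def V.vir_closed_def is_subspace_VV)
  qed
  define g where "g n = (vir_L c (- n) ^^ p) vac0
    \<ominus>\<^bsub>MM\<^esub> (if int p dvd n then vir_L c (- n * int p) vac0 else \<zero>\<^bsub>MM\<^esub>)" for n :: int
  have sv: "g (int n) = V.sv n" for n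
  proof -
    define t where "t = (if int p dvd int n then vir_L c (- int n * int p) vac0 else \<zero>\<^bsub>MM\<^esub>)"
    have "t \<in> carrier MM"
      using vir_L_carrier[OF vac0_carrier]
        vspace.is_subspaceD(2)[OF MM_vspace vspace.is_subspace_carrier[OF MM_vspace]]
      by (simp add: t_def)
    moreover have "(if p dvd n then LL (- int n * int p) vac0 else \<zero>\<^bsub>VV\<^esub>) = t"
      by (simp only: LL_eq[OF vac0_carrier] VV_simps(3) int_dvd_int_iff t_def)
    moreover have "(LL (- int n) ^^ p) vac0 = (vir_L c (- int n) ^^ p) vac0"
      using funpow_LL[OF vac0_carrier] by blast
    ultimately show ?thesis
      unfolding V.sv_eq g_def VV_simps(5) t_def[symmetric] by (simp only: VV_minus)
  qed
  have "{g n | n. n \<ge> 2} = {V.sv n | n. n \<ge> 2}"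
  proof (intro equalityI subsetI)
    fix x assume "x \<in> {g n | n. n \<ge> 2}"
    then obtain n where n: "n \<ge> 2" "x = g n" by blast
    then have "x = V.sv (nat n)" "nat n \<ge> 2" by (simp_all flip: sv)
    then show "x \<in> {V.sv n | n. n \<ge> 2}" by blast
  next
    fix x assume "x \<in> {V.sv n | n. n \<ge> 2}"
    then obtain n where n: "n \<ge> 2" "x = V.sv n" by blast
    then show "x \<in> {g n | n. n \<ge> 2}" by (auto simp: sv[symmetric] intro!: exI[of _ "int n"])
  qed
  moreover have "vir_submodule c = V.vir_closed" using closed by (simp add: fun_eq_iff)
  ultimately show ?thesis
    unfolding vir_I0_def V.I0_def Let_def assms(1) g_def by simp
qed

end

end

theorem theorem4p4:
  fixes c :: "'a::alg_closed_field"
    and p :: nat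
    and Y :: "'a vir_vec \<Rightarrow> int \<Rightarrow> 'a vir_vec \<Rightarrow> 'a vir_vec"
    and q :: "'a poly"
  assumes "CHAR('a) = p" and "p \<ge> 3"
    and "is_vir_vertex_structure c Y"
  defines "q \<equiv> [:0, 1:] ^ p - [:0, 1:]"
  shows "\<exists>\<Phi> \<in> algebra_iso (quot_algebra poly_algebra (PIdl\<^bsub>poly_algebra\<^esub> q))
                         (zhu_algebra (vir0_vertex_alg c Y)).
           \<forall>f. \<Phi> (PIdl\<^bsub>poly_algebra\<^esub> q +>\<^bsub>poly_algebra\<^esub> f) =
               alg_eval (zhu_algebra (vir0_vertex_alg c Y)) f
                 (zhu_class (vir0_vertex_alg c Y) (vir0_omega c))"
proof -
  interpret vir_construction c .
  interpret V: virasoro "vir_vertex_alg c Y" "vir_omega c" "\<lambda>n v. nprod (vir_vertex_alg c Y) (vir_omega c) (n + 1) v"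
    c corr_fun p
    using virasoro_VV[OF assms(3,1,2)] .
  have "V.qq = q" by (simp add: V.qq_def V.xx_def q_def)
  moreover have "vir0_vertex_alg c Y = quot_vertex_alg (vir_vertex_alg c Y) V.I0"
    by (simp add: vir0_vertex_alg_def vir_I0_eq[OF assms(3,1,2)])
  moreover have "vir0_omega c = V.I0 +>\<^bsub>vir_vertex_alg c Y\<^esub> vir_omega c"
    by (simp add: vir0_omega_def vir_I0_eq[OF assms(3,1,2)] VV_coset[OF assms(3)])
  ultimately show ?thesis using V.zhu_algebra_quotient_iso by simp
qed

end
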